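(* Let $G$ be a pro-oligomorphic group. Then the commutative ring $\Theta(G)$ is a binomial ring.
   Context: A pro-oligomorphic group is a topological group $G$ that is Hausdorff, non-archimedean (its open subgroups form a neighborhood basis of the identity), and Roelcke precompact (in the presence of the previous condition: $U\backslash G/V$ is finite for all open subgroups $U,V$). A $G$-set is a set with a smooth action of $G$, i.e. every stabilizer is open (same convention for open subgroups of $G$). A set with a group action is finitary if it has finitely many orbits. A $\hat G$-set is a set $X$ with a smooth action of some open subgroup $U$ of $G$ (a group of definition), where shrinking the group of definition does not change the $\hat G$-set; it is finitary if $U$ has finitely many orbits on $X$ (this is independent of $U$). Maps of $\hat G$-sets are functions equivariant for some common open group of definition. For $g\in G$, the conjugate $X^g$ is the same set with action $h\bullet x=(g^{-1}hg)\cdot x$. $\Theta(G)$ is the commutative ring generated by symbols $[X]$, one for each finitary $\hat G$-set $X$, subject to: (a) $[X]=[Y]$ if $X\cong Y$ as $\hat G$-sets; (b) $[X]=1$ if $X$ is a singleton; (c) $[X\amalg Y]=[X]+[Y]$; (d) $[X]=[X^g]$ for $g\in G$; (e) if $U$ is an open subgroup, $X\to Y$ is a map of transitive $U$-sets, and $F$ is the fiber over a point $y\in Y$ (a $\hat G$-set via the stabilizer of $y$ in $U$), then $[X]=[F]\cdot[Y]$. A commutative ring $R$ is a binomial ring if it is torsion-free as a $\mathbb Z$-module and for every $x\in R$ and $n\in\mathbb N$ the element $\binom{x}{n}=\frac{x(x-1)\cdots(x-n+1)}{n!}$ of $R\otimes\mathbb Q$ belongs to $R$. *)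

theory Defs
  imports
    "HOL-Algebra.Group_Action"
    "HOL-Algebra.Generated_Groups"
    "HOL-Algebra.QuotRing"
    "HOL-Algebra.Free_Abelian_Groups"
    "HOL-Analysis.T1_Spaces"
    "HOL-Analysis.Product_Topology"
begin

section \<open>Pro-oligomorphic groups\<close>

definition open_subgroup :: "('a, 'm) monoid_scheme \<Rightarrow> 'a topology \<Rightarrow> 'a set \<Rightarrow> bool"
  where "open_subgroup G T U \<longleftrightarrow> subgroup U G \<and> openin T U"

locale topological_group = group G for G (structure) +
  fixes T :: "'a topology"
  assumes topspace_eq: "topspace T = carrier G"
    and continuous_mult: "continuous_map (prod_topology T T) T (\<lambda>(x, y). x \<otimes> y)"
    and continuous_inv: "continuous_map T T (\<lambda>x. inv x)"

locale pro_oligomorphic = topological_group +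
  assumes hausdorff: "Hausdorff_space T"
    and non_archimedean:
      "\<lbrakk>openin T W; \<one> \<in> W\<rbrakk> \<Longrightarrow> \<exists>U. open_subgroup G T U \<and> U \<subseteq> W"
    and roelcke_precompact:
      "\<lbrakk>open_subgroup G T U; open_subgroup G T V\<rbrakk>
        \<Longrightarrow> finite {U <#> (g <# V) | g. g \<in> carrier G}"

section \<open>Sets with a germ of a smooth action\<close>

text \<open>
  A \<open>G-hat\<close>-set is recorded together with one group of definition. Records that differ only by
  shrinking the group of definition are identified by \<open>ghat_iso\<close> below, since morphisms need only
  be equivariant for some common open subgroup.
\<close>

record ('a, 'x) ghat_set =
  gdom :: "'a set"
  gset :: "'x set"
  gact :: "'a \<Rightarrow> 'x \<Rightarrow> 'x"

abbreviation ghat_grp :: "('a, 'm) monoid_scheme \<Rightarrow> ('a, 'x) ghat_set \<Rightarrow> ('a, 'm) monoid_scheme"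
  where "ghat_grp G X \<equiv> G\<lparr>carrier := gdom X\<rparr>"

definition is_ghat_set :: "('a, 'm) monoid_scheme \<Rightarrow> 'a topology \<Rightarrow> ('a, 'x) ghat_set \<Rightarrow> bool"
  where "is_ghat_set G T X \<longleftrightarrow>
    open_subgroup G T (gdom X) \<and>
    group_action (ghat_grp G X) (gset X) (gact X) \<and>
    (\<forall>x\<in>gset X. openin T (stabilizer (ghat_grp G X) (gact X) x))"

definition finitary_ghat_set ::
    "('a, 'm) monoid_scheme \<Rightarrow> 'a topology \<Rightarrow> ('a, 'x) ghat_set \<Rightarrow> bool"
  where "finitary_ghat_set G T X \<longleftrightarrow>
    is_ghat_set G T X \<and> finite (orbits (ghat_grp G X) (gset X) (gact X))"

definition ghat_map ::
    "('a, 'm) monoid_scheme \<Rightarrow> 'a topology \<Rightarrow> ('a, 'x) ghat_set \<Rightarrow> ('a, 'y) ghat_set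
      \<Rightarrow> ('x \<Rightarrow> 'y) \<Rightarrow> bool"
  where "ghat_map G T X Y f \<longleftrightarrow>
    f \<in> gset X \<rightarrow> gset Y \<and>
    (\<exists>W. open_subgroup G T W \<and> W \<subseteq> gdom X \<inter> gdom Y \<and>
         (\<forall>h\<in>W. \<forall>x\<in>gset X. f (gact X h x) = gact Y h (f x)))"

definition ghat_iso ::
    "('a, 'm) monoid_scheme \<Rightarrow> 'a topology \<Rightarrow> ('a, 'x) ghat_set \<Rightarrow> ('a, 'y) ghat_set \<Rightarrow> bool"
  where "ghat_iso G T X Y \<longleftrightarrow> (\<exists>f. ghat_map G T X Y f \<and> bij_betw f (gset X) (gset Y))"

definition ghat_coprod :: "('a, 'x) ghat_set \<Rightarrow> ('a, 'y) ghat_set \<Rightarrow> ('a, 'x + 'y) ghat_set"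
  where "ghat_coprod X Y =
    \<lparr>gdom = gdom X \<inter> gdom Y,
     gset = gset X <+> gset Y,
     gact = (\<lambda>h. \<lambda>z \<in> gset X <+> gset Y. map_sum (gact X h) (gact Y h) z)\<rparr>"

text \<open>The conjugate \<open>X\<^sup>g\<close> is defined on the conjugate \<open>g U g\<inverse>\<close> of the group of definition.\<close>

definition ghat_conj ::
    "('a, 'm) monoid_scheme \<Rightarrow> 'a \<Rightarrow> ('a, 'x) ghat_set \<Rightarrow> ('a, 'x) ghat_set"
  where "ghat_conj G g X =
    \<lparr>gdom = (\<lambda>u. g \<otimes>\<^bsub>G\<^esub> u \<otimes>\<^bsub>G\<^esub> inv\<^bsub>G\<^esub> g) ` gdom X,
     gset = gset X,
     gact = (\<lambda>h. gact X (inv\<^bsub>G\<^esub> g \<otimes>\<^bsub>G\<^esub> h \<otimes>\<^bsub>G\<^esub> g))\<rparr>"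

definition transitive_map ::
    "('a, 'm) monoid_scheme \<Rightarrow> ('a, 'x) ghat_set \<Rightarrow> ('a, 'y) ghat_set \<Rightarrow> ('x \<Rightarrow> 'y) \<Rightarrow> bool"
  where "transitive_map G X Y f \<longleftrightarrow>
    gdom X = gdom Y \<and>
    transitive_action (ghat_grp G X) (gset X) (gact X) \<and> gset X \<noteq> {} \<and>
    transitive_action (ghat_grp G Y) (gset Y) (gact Y) \<and> gset Y \<noteq> {} \<and>
    f \<in> gset X \<rightarrow> gset Y \<and>
    (\<forall>h\<in>gdom X. \<forall>x\<in>gset X. f (gact X h x) = gact Y h (f x))"

definition ghat_fiber ::
    "('a, 'm) monoid_scheme \<Rightarrow> ('a, 'x) ghat_set \<Rightarrow> ('a, 'y) ghat_set \<Rightarrow> ('x \<Rightarrow> 'y) \<Rightarrow> 'y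
      \<Rightarrow> ('a, 'x) ghat_set"
  where "ghat_fiber G X Y f y =
    \<lparr>gdom = stabilizer (ghat_grp G Y) (gact Y) y,
     gset = {x \<in> gset X. f x = y},
     gact = (\<lambda>h. restrict (gact X h) {x \<in> gset X. f x = y})\<rparr>"

section \<open>The ring \<open>\<Theta>(G)\<close>\<close>

text \<open>
  The polynomial ring over the integers in a set \<open>S\<close> of commuting variables: monomials are finitely
  supported exponent functions, polynomials are finitely supported functions on monomials.
\<close>

definition int_poly_ring :: "'s set \<Rightarrow> (('s \<Rightarrow>\<^sub>0 nat) \<Rightarrow>\<^sub>0 int) ring"
  where "int_poly_ring S =
    \<lparr>carrier = {p. \<forall>m \<in> Poly_Mapping.keys p. Poly_Mapping.keys m \<subseteq> S},
     monoid.mult = (*), one = 1, ring.zero = 0, add = (+)\<rparr>"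

definition poly_var :: "'s \<Rightarrow> (('s \<Rightarrow>\<^sub>0 nat) \<Rightarrow>\<^sub>0 int)"
  where "poly_var s = Poly_Mapping.single (Poly_Mapping.single s 1) 1"

text \<open>
  The finitary \<open>G-hat\<close>-sets form a proper class, so the symbols are restricted to those whose
  underlying set is a subset of the type \<open>nat \<times> 'a set\<close>. Every finitary \<open>G-hat\<close>-set, in any type, is
  isomorphic to one of these (lemmas \<open>ex_symbol\<close> and \<open>ex_ghat_iso_symbol\<close> below).
\<close>

definition Theta_symbols ::
    "('a, 'm) monoid_scheme \<Rightarrow> 'a topology \<Rightarrow> ('a, nat \<times> 'a set) ghat_set set"
  where "Theta_symbols G T = {X. finitary_ghat_set G T X}"

lemma group_action_iff:
  assumes "group H"
  shows "group_action H E \<phi> \<longleftrightarrow>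
    (\<forall>g\<in>carrier H. \<phi> g \<in> Bij E) \<and>
    (\<forall>g\<in>carrier H. \<forall>h\<in>carrier H. \<forall>x\<in>E. \<phi> (g \<otimes>\<^bsub>H\<^esub> h) x = \<phi> g (\<phi> h x))"
    (is "_ \<longleftrightarrow> ?B \<and> ?C")
proof
  assume a: "group_action H E \<phi>"
  then interpret group_action H E \<phi> .
  show "?B \<and> ?C" using bij_prop0 composition_rule by blast
next
  assume bc: "?B \<and> ?C"
  have "\<phi> \<in> hom H (BijGroup E)"
  proof (rule homI)
    fix g h assume gh: "g \<in> carrier H" "h \<in> carrier H"
    then have "g \<otimes>\<^bsub>H\<^esub> h \<in> carrier H" using assms by (simp add: group.is_monoid monoid.m_closed)
    then have b: "\<phi> (g \<otimes>\<^bsub>H\<^esub> h) \<in> Bij E" "\<phi> g \<in> Bij E" "\<phi> h \<in> Bij E" using bc gh by auto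
    have "\<phi> (g \<otimes>\<^bsub>H\<^esub> h) = compose E (\<phi> g) (\<phi> h)"
    proof (rule extensionalityI[of _ E])
      show "\<phi> (g \<otimes>\<^bsub>H\<^esub> h) \<in> extensional E" using b by (simp add: Bij_imp_extensional)
      show "\<phi> (g \<otimes>\<^bsub>H\<^esub> h) x = compose E (\<phi> g) (\<phi> h) x" if "x \<in> E" for x
        using that bc gh by (simp add: compose_def)
    qed simp
    then show "\<phi> (g \<otimes>\<^bsub>H\<^esub> h) = \<phi> g \<otimes>\<^bsub>BijGroup E\<^esub> \<phi> h"
      using b by (simp add: BijGroup_def)
  qed (use bc in \<open>auto simp: BijGroup_def\<close>)
  then show "group_action H E \<phi>"
    using assms by (simp add: group_action_def group_hom_def group_hom_axioms_def group_BijGroup)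
qed

lemma ex_symbol:
  fixes G :: "('a, 'm) monoid_scheme" and X :: "('a, 'x) ghat_set"
  assumes G: "group G" and X: "finitary_ghat_set G T X"
  obtains Y f where "Y \<in> Theta_symbols G T" "gdom Y = gdom X" "bij_betw f (gset X) (gset Y)"
    "\<And>h x. h \<in> gdom X \<Longrightarrow> x \<in> gset X \<Longrightarrow> f (gact X h x) = gact Y h (f x)"
proof -
  define H where "H = ghat_grp G X"
  define E where "E = gset X"
  define \<phi> where "\<phi> = gact X"
  have U: "subgroup (gdom X) G" "openin T (gdom X)" and act: "group_action H E \<phi>"
    and st: "\<And>x. x \<in> E \<Longrightarrow> openin T (stabilizer H \<phi> x)"
    and fin: "finite (orbits H E \<phi>)"
    using X by (auto simp: finitary_ghat_set_def is_ghat_set_def open_subgroup_def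
        H_def E_def \<phi>_def)
  have cH: "carrier H = gdom X" by (simp add: H_def)
  have gH: "group H" unfolding H_def using U(1) G by (rule subgroup.subgroup_is_group)
  interpret group_action H E \<phi> by (rule act)
  obtain idx :: "'x set \<Rightarrow> nat" where idx: "inj_on idx (orbits H E \<phi>)"
    using finite_imp_inj_to_nat_seg[OF fin] that by metis
  define rep where "rep x = (SOME z. z \<in> orbit H \<phi> x)" for x
  define f where "f x = (idx (orbit H \<phi> x), {h \<in> gdom X. \<phi> h (rep x) = x})" for x
  have rep: "\<exists>h\<in>gdom X. \<phi> h (rep x) = x" if "x \<in> E" for x
  proof -
    have "\<phi> \<one>\<^bsub>H\<^esub> x \<in> orbit H \<phi> x"
      using group.is_monoid[OF gH] by (auto simp: orbit_def)
    then have r: "rep x \<in> orbit H \<phi> x" unfolding rep_def by (rule someI)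
    then have "rep x \<in> E" using that by (auto simp: orbit_def element_image)
    then have "x \<in> orbit H \<phi> (rep x)" using r that orbit_sym by blast
    then show ?thesis unfolding orbit_def cH by force
  qed
  have inj: "inj_on f E"
  proof (rule inj_onI)
    fix x y assume xy: "x \<in> E" "y \<in> E" "f x = f y"
    then have "orbit H \<phi> x = orbit H \<phi> y"
      using idx by (auto simp: f_def inj_on_def orbits_def)
    then have "rep x = rep y" by (simp add: rep_def)
    then show "x = y" using rep[OF xy(1)] xy(3) by (auto simp: f_def)
  qed
  define \<psi> where "\<psi> h = restrict (\<lambda>z. f (\<phi> h (inv_into E f z))) (f ` E)" for h
  have \<psi>f: "\<psi> h (f x) = f (\<phi> h x)" if "x \<in> E" for h x
    using that inj by (simp add: \<psi>_def)
  define Y :: "('a, nat \<times> 'a set) ghat_set" where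
    "Y = \<lparr>gdom = gdom X, gset = f ` E, gact = \<psi>\<rparr>"
  have "group_action H (f ` E) \<psi>"
    unfolding group_action_iff[OF gH]
  proof (intro conjI ballI)
    fix g assume g: "g \<in> carrier H"
    have "bij_betw (\<psi> g) (f ` E) (f ` E)"
    proof (rule bij_betw_imageI)
      show "inj_on (\<psi> g) (f ` E)"
      proof (rule inj_onI)
        fix z w assume "z \<in> f ` E" "w \<in> f ` E" and eq: "\<psi> g z = \<psi> g w"
        then obtain x y where xy: "x \<in> E" "y \<in> E" "z = f x" "w = f y" by blast
        then have "f (\<phi> g x) = f (\<phi> g y)" using eq by (simp add: \<psi>f)
        then have "\<phi> g x = \<phi> g y"
          using inj element_image[OF g] xy by (meson inj_onD)
        then show "z = w" using inj_prop[OF g] xy by (metis inj_onD)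
      qed
      show "\<psi> g ` f ` E = f ` E"
      proof -
        have "\<psi> g ` f ` E = f ` \<phi> g ` E" by (simp add: image_image \<psi>f cong: image_cong_simp)
        then show ?thesis using surj_prop[OF g] by simp
      qed
    qed
    then show "\<psi> g \<in> Bij (f ` E)" by (auto simp: Bij_def \<psi>_def)
  next
    fix g h z assume gh: "g \<in> carrier H" "h \<in> carrier H" "z \<in> f ` E"
    then obtain x where x: "x \<in> E" "z = f x" by blast
    then show "\<psi> (g \<otimes>\<^bsub>H\<^esub> h) z = \<psi> g (\<psi> h z)"
      using gh element_image[OF gh(2) x(1)] by (simp add: \<psi>f composition_rule)
  qed
  moreover have "stabilizer H \<psi> (f x) = stabilizer H \<phi> x" if "x \<in> E" for x
  proof -
    have "f (\<phi> h x) = f x \<longleftrightarrow> \<phi> h x = x" if "h \<in> carrier H" for h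
      using inj element_image[OF that \<open>x \<in> E\<close>] \<open>x \<in> E\<close> by (metis inj_onD)
    then show ?thesis using that by (auto simp: stabilizer_def \<psi>f)
  qed
  moreover have "orbits H (f ` E) \<psi> = (\<lambda>O'. f ` O') ` orbits H E \<phi>"
  proof -
    have "orbit H \<psi> (f x) = f ` orbit H \<phi> x" if "x \<in> E" for x
      using that by (auto simp: orbit_def \<psi>f)
    then have "orbit H \<psi> ` f ` E = (\<lambda>O'. f ` O') ` orbit H \<phi> ` E"
      unfolding image_image by (rule image_cong[OF refl])
    then show ?thesis unfolding orbits_def Setcompr_eq_image .
  qed
  ultimately have "Y \<in> Theta_symbols G T"
    using U st fin by (auto simp: Theta_symbols_def finitary_ghat_set_def is_ghat_set_def
        open_subgroup_def Y_def H_def)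
  moreover have "bij_betw f (gset X) (gset Y)"
    using inj by (simp add: Y_def E_def bij_betw_def)
  moreover have "f (gact X h x) = gact Y h (f x)" if "x \<in> gset X" for h x
    using that \<psi>f[of x h] by (simp add: Y_def E_def \<phi>_def)
  ultimately show ?thesis using that[of Y f] by (simp add: Y_def)
qed

lemma ex_ghat_iso_symbol:
  assumes "group G" "finitary_ghat_set G T X"
  shows "\<exists>Y \<in> Theta_symbols G T. ghat_iso G T X Y"
proof -
  obtain Y f where Y: "Y \<in> Theta_symbols G T" "gdom Y = gdom X" "bij_betw f (gset X) (gset Y)"
    and eq: "\<And>h x. h \<in> gdom X \<Longrightarrow> x \<in> gset X \<Longrightarrow> f (gact X h x) = gact Y h (f x)"
    using ex_symbol[OF assms] by metis
  have "open_subgroup G T (gdom X)"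
    using assms(2) by (simp add: finitary_ghat_set_def is_ghat_set_def)
  then have "ghat_map G T X Y f"
    using Y eq unfolding ghat_map_def by (auto simp: bij_betw_def intro!: exI[of _ "gdom X"])
  then show ?thesis using Y unfolding ghat_iso_def by blast
qed

inductive_set Theta_relations ::
    "('a, 'm) monoid_scheme \<Rightarrow> 'a topology
      \<Rightarrow> ((('a, nat \<times> 'a set) ghat_set \<Rightarrow>\<^sub>0 nat) \<Rightarrow>\<^sub>0 int) set"
  for G :: "('a, 'm) monoid_scheme" and T :: "'a topology"
  where
    iso: "\<lbrakk>X \<in> Theta_symbols G T; Y \<in> Theta_symbols G T; ghat_iso G T X Y\<rbrakk>
      \<Longrightarrow> poly_var X - poly_var Y \<in> Theta_relations G T"
  | singleton: "\<lbrakk>X \<in> Theta_symbols G T; gset X = {x}\<rbrakk>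
      \<Longrightarrow> poly_var X - 1 \<in> Theta_relations G T"
  | coprod: "\<lbrakk>X \<in> Theta_symbols G T; Y \<in> Theta_symbols G T; Z \<in> Theta_symbols G T;
        ghat_iso G T Z (ghat_coprod X Y)\<rbrakk>
      \<Longrightarrow> poly_var Z - (poly_var X + poly_var Y) \<in> Theta_relations G T"
  | conj: "\<lbrakk>X \<in> Theta_symbols G T; g \<in> carrier G\<rbrakk>
      \<Longrightarrow> poly_var X - poly_var (ghat_conj G g X) \<in> Theta_relations G T"
  | fiber: "\<lbrakk>X \<in> Theta_symbols G T; Y \<in> Theta_symbols G T; transitive_map G X Y f; y \<in> gset Y\<rbrakk>
      \<Longrightarrow> poly_var X - poly_var (ghat_fiber G X Y f y) * poly_var Y \<in> Theta_relations G T"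

lemma (in group) conj_cancel:
  assumes "g \<in> carrier G" "u \<in> carrier G"
  shows "inv g \<otimes> (g \<otimes> u \<otimes> inv g) \<otimes> g = u"
  using assms by (simp add: m_assoc) (simp add: m_assoc[symmetric])

lemma (in topological_group) openin_conj:
  assumes "g \<in> carrier G" "openin T U"
  shows "openin T ((\<lambda>u. g \<otimes> u \<otimes> inv g) ` U)"
proof -
  have mult: "continuous_map T T (\<lambda>x. f x \<otimes> h x)"
    if "continuous_map T T f" "continuous_map T T h" for f h
  proof -
    have "continuous_map T (prod_topology T T) (\<lambda>x. (f x, h x))"
      using that by (simp add: continuous_map_pairwise o_def)
    from continuous_map_compose[OF this continuous_mult] show ?thesis by (simp add: o_def)
  qed
  have "continuous_map T T (\<lambda>x. inv g \<otimes> x \<otimes> g)"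
    using assms by (intro mult) (auto simp: topspace_eq)
  then have "openin T {x \<in> topspace T. inv g \<otimes> x \<otimes> g \<in> U}"
    using assms by (auto simp: continuous_map_def)
  moreover have "{x \<in> topspace T. inv g \<otimes> x \<otimes> g \<in> U} = (\<lambda>u. g \<otimes> u \<otimes> inv g) ` U"
  proof (rule equalityI; rule subsetI)
    fix x assume "x \<in> {x \<in> topspace T. inv g \<otimes> x \<otimes> g \<in> U}"
    then have x: "x \<in> carrier G" "inv g \<otimes> x \<otimes> g \<in> U" by (auto simp: topspace_eq)
    have "x = g \<otimes> (inv g \<otimes> x \<otimes> g) \<otimes> inv g"
      using x assms(1) conj_cancel[of "inv g" x] by simp
    then show "x \<in> (\<lambda>u. g \<otimes> u \<otimes> inv g) ` U" using x(2) by blast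
  next
    fix x assume "x \<in> (\<lambda>u. g \<otimes> u \<otimes> inv g) ` U"
    then obtain u where u: "u \<in> U" "x = g \<otimes> u \<otimes> inv g" by blast
    moreover have "u \<in> carrier G" using u assms(2) openin_subset topspace_eq by blast
    ultimately show "x \<in> {x \<in> topspace T. inv g \<otimes> x \<otimes> g \<in> U}"
      using assms(1) conj_cancel by (simp add: topspace_eq)
  qed
  ultimately show ?thesis by simp
qed

lemma (in topological_group) finitary_ghat_conj:
  assumes X: "finitary_ghat_set G T X" and g: "g \<in> carrier G"
  shows "finitary_ghat_set G T (ghat_conj G g X)"
proof -
  define U where "U = gdom X"
  define c where "c = (\<lambda>u. g \<otimes> u \<otimes> inv g)"
  define H where "H = ghat_grp G X"
  define K where "K = ghat_grp G (ghat_conj G g X)"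
  define E where "E = gset X"
  define \<phi> where "\<phi> = gact X"
  define \<psi> where "\<psi> = (\<lambda>h. \<phi> (inv g \<otimes> h \<otimes> g))"
  have U: "subgroup U G" "openin T U" and act: "group_action H E \<phi>"
    and st: "\<And>x. x \<in> E \<Longrightarrow> openin T (stabilizer H \<phi> x)" and fin: "finite (orbits H E \<phi>)"
    using X by (auto simp: finitary_ghat_set_def is_ghat_set_def open_subgroup_def
        H_def E_def \<phi>_def U_def)
  interpret U: subgroup U G by (rule U(1))
  interpret A: group_action H E \<phi> by (rule act)
  have H: "carrier H = U" "mult H = mult G" by (simp_all add: H_def U_def)
  have K: "carrier K = c ` U" "mult K = mult G" by (simp_all add: K_def ghat_conj_def c_def U_def)
  have cl: "u \<in> carrier G" if "u \<in> U" for u using that by (rule U.mem_carrier)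
  have cc: "c u \<otimes> c v = c (u \<otimes> v)" if "u \<in> carrier G" "v \<in> carrier G" for u v
  proof -
    have "inv g \<otimes> (g \<otimes> z) = z" if "z \<in> carrier G" for z
      using that g by (simp add: m_assoc[symmetric])
    then show ?thesis using that g by (simp add: c_def m_assoc)
  qed
  have sub: "subgroup (c ` U) G"
  proof (rule subgroupI)
    show "c ` U \<subseteq> carrier G" using cl g by (auto simp: c_def)
    show "c ` U \<noteq> {}" using U.one_closed by blast
    fix a assume "a \<in> c ` U"
    then obtain u where u: "u \<in> U" "a = c u" by blast
    have "inv a = c (inv u)"
      using u cl g by (simp add: c_def inv_mult_group m_assoc)
    then show "inv a \<in> c ` U" using u U.m_inv_closed by blast
    fix b assume "b \<in> c ` U"
    then show "a \<otimes> b \<in> c ` U" using u cc cl U.m_closed by force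
  qed
  have gK: "group K"
    using subgroup.subgroup_is_group[OF sub is_group]
    by (simp add: K_def ghat_conj_def c_def U_def)
  have \<psi>c: "\<psi> (c u) = \<phi> u" if "u \<in> U" for u
    using cl[OF that] g by (simp add: \<psi>_def c_def conj_cancel)
  have "group_action K E \<psi>"
    unfolding group_action_iff[OF gK]
    using A.bij_prop0 A.composition_rule by (auto simp: K H cc cl \<psi>c U.m_closed)
  moreover have "stabilizer K \<psi> x = c ` stabilizer H \<phi> x" for x
    by (auto simp: stabilizer_def K H \<psi>c)
  moreover have "orbit K \<psi> x = orbit H \<phi> x" for x
    by (auto simp: orbit_def K H \<psi>c) (metis \<psi>c imageI)
  then have "orbits K E \<psi> = orbits H E \<phi>"
    by (simp add: orbits_def)
  moreover have "openin T (c ` V)" if "openin T V" for V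
    using openin_conj[OF g that] by (simp add: c_def)
  ultimately have "finitary_ghat_set G T \<lparr>gdom = c ` U, gset = E, gact = \<psi>\<rparr>"
    using sub U(2) st fin
    by (simp add: finitary_ghat_set_def is_ghat_set_def open_subgroup_def K_def ghat_conj_def
        c_def U_def)
  then show ?thesis
    by (simp add: ghat_conj_def c_def U_def E_def \<psi>_def \<phi>_def)
qed

lemma finitary_ghat_fiber:
  assumes G: "group G" and X: "is_ghat_set G T X" and Y: "is_ghat_set G T Y"
    and f: "transitive_map G X Y f" and y: "y \<in> gset Y"
  shows "finitary_ghat_set G T (ghat_fiber G X Y f y)"
proof -
  define H where "H = ghat_grp G X"
  define F where "F = {x \<in> gset X. f x = y}"
  define \<phi> where "\<phi> = gact X"
  define S where "S = stabilizer H (gact Y) y"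
  define K where "K = G\<lparr>carrier := S\<rparr>"
  define \<psi> where "\<psi> = (\<lambda>h. restrict (\<phi> h) F)"
  have dom: "gdom Y = gdom X" using f by (simp add: transitive_map_def)
  have U: "subgroup (gdom X) G"
    using X by (simp add: is_ghat_set_def open_subgroup_def)
  have st: "\<And>x. x \<in> gset X \<Longrightarrow> openin T (stabilizer H \<phi> x)"
    using X by (simp add: is_ghat_set_def H_def \<phi>_def)
  have S_open: "openin T S" using Y y by (simp add: is_ghat_set_def S_def H_def dom)
  interpret A: transitive_action H "gset X" \<phi>
    using f unfolding transitive_map_def H_def \<phi>_def by blast
  interpret B: transitive_action H "gset Y" "gact Y"
    using f unfolding transitive_map_def H_def by metis
  have H: "carrier H = gdom X" "mult H = mult G" by (simp_all add: H_def)
  have eqv: "f (\<phi> h x) = gact Y h (f x)" if "h \<in> carrier H" "x \<in> gset X" for h x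
    using f that by (simp add: transitive_map_def H \<phi>_def)
  have S_H: "subgroup S H" unfolding S_def using y by (rule B.stabilizer_subgroup)
  then have S_G: "subgroup S G"
    using group.incl_subgroup[OF G U] by (simp add: H_def)
  then have gK: "group K"
    unfolding K_def using G by (rule subgroup.subgroup_is_group)
  have SH: "S \<subseteq> carrier H" using S_H by (rule subgroup.subset)
  have K: "carrier K = S" "mult K = mult G" by (simp_all add: K_def)
  have inF: "\<phi> h x \<in> F \<longleftrightarrow> h \<in> S" if "h \<in> carrier H" "x \<in> F" for h x
  proof -
    have "x \<in> gset X" "f x = y" using that by (auto simp: F_def)
    moreover from this have "\<phi> h x \<in> gset X" using A.element_image[OF that(1)] by blast
    ultimately show ?thesis using that by (simp add: F_def S_def stabilizer_def eqv)
  qed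
  have "group_action K F \<psi>"
    unfolding group_action_iff[OF gK]
  proof (intro conjI ballI)
    fix h assume h: "h \<in> carrier K"
    then have hH: "h \<in> carrier H" using SH by (auto simp: K)
    have "bij_betw (\<phi> h) F F"
    proof (rule bij_betw_imageI)
      show "inj_on (\<phi> h) F"
        using A.inj_prop[OF hH] by (rule inj_on_subset) (auto simp: F_def)
      show "\<phi> h ` F = F"
      proof
        show "\<phi> h ` F \<subseteq> F" using h hH inF by (auto simp: K)
        show "F \<subseteq> \<phi> h ` F"
        proof
          fix x assume x: "x \<in> F"
          then have xE: "x \<in> gset X" by (simp add: F_def)
          have ih: "inv\<^bsub>H\<^esub> h \<in> S" using h S_H K subgroup.m_inv_closed by metis
          then have "\<phi> (inv\<^bsub>H\<^esub> h) x \<in> F" using x inF SH by blast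
          moreover have "\<phi> h (\<phi> (inv\<^bsub>H\<^esub> h) x) = x"
            using A.orbit_sym_aux[of "inv\<^bsub>H\<^esub> h" x] hH xE ih SH A.group_hom
            by (metis (no_types, lifting) group.inv_inv group_hom.axioms(1) subsetD)
          ultimately show "x \<in> \<phi> h ` F" by (metis imageI)
        qed
      qed
    qed
    then show "\<psi> h \<in> Bij F" by (simp add: Bij_def \<psi>_def)
  next
    fix g h x assume gh: "g \<in> carrier K" "h \<in> carrier K" and x: "x \<in> F"
    then have "g \<in> carrier H" "h \<in> carrier H" "x \<in> gset X" "\<phi> h x \<in> F"
      using SH inF by (auto simp: K F_def)
    then show "\<psi> (g \<otimes>\<^bsub>K\<^esub> h) x = \<psi> g (\<psi> h x)"
      using x A.composition_rule[of x g h] by (simp add: \<psi>_def K H)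
  qed
  moreover have "stabilizer K \<psi> x = stabilizer H \<phi> x" if x: "x \<in> F" for x
  proof -
    have "h \<in> S" if "h \<in> carrier H" "\<phi> h x = x" for h
      using inF[OF that(1) x] that(2) x by simp
    then show ?thesis using x SH unfolding stabilizer_def K \<psi>_def by auto
  qed
  moreover have "finite (orbits K F \<psi>)"
  proof -
    have "orbit K \<psi> x = F" if x: "x \<in> F" for x
    proof
      have "\<phi> h x \<in> F" if "h \<in> S" for h using inF[of h x] that x SH by blast
      then show "orbit K \<psi> x \<subseteq> F" using x unfolding orbit_def K \<psi>_def by auto
      show "F \<subseteq> orbit K \<psi> x"
      proof
        fix z assume z: "z \<in> F"
        then obtain h where h: "h \<in> carrier H" "\<phi> h x = z"
          using A.unique_orbit[of x z] x by (auto simp: F_def)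
        then have "h \<in> S" using inF x z by blast
        then have "z = \<psi> h x \<and> h \<in> carrier K" using h x by (simp add: K \<psi>_def)
        then show "z \<in> orbit K \<psi> x" unfolding orbit_def by blast
      qed
    qed
    then have "orbits K F \<psi> \<subseteq> {F}" by (auto simp: orbits_def)
    then show ?thesis using finite_subset by blast
  qed
  ultimately have "finitary_ghat_set G T \<lparr>gdom = S, gset = F, gact = \<psi>\<rparr>"
    using S_G S_open st
    by (simp add: finitary_ghat_set_def is_ghat_set_def open_subgroup_def K_def F_def)
  then show ?thesis
    by (simp add: ghat_fiber_def S_def H_def dom F_def \<psi>_def \<phi>_def)
qed

lemma cring_int_poly_ring:
  fixes S :: "'s set"
  shows "cring (int_poly_ring S)"
proof -
  define C :: "(('s \<Rightarrow>\<^sub>0 nat) \<Rightarrow>\<^sub>0 int) set"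
    where "C = {p. \<forall>m \<in> Poly_Mapping.keys p. Poly_Mapping.keys m \<subseteq> S}"
  have R: "carrier (int_poly_ring S) = C" "monoid.mult (int_poly_ring S) = (*)" "monoid.one (int_poly_ring S) = 1"
    "ring.zero (int_poly_ring S) = 0" "ring.add (int_poly_ring S) = (+)"
    by (simp_all add: int_poly_ring_def C_def)
  have mult: "p * q \<in> C" if "p \<in> C" "q \<in> C" for p q
  proof -
    have "Poly_Mapping.keys m \<subseteq> S" if m: "m \<in> Poly_Mapping.keys (p * q)" for m
    proof -
      obtain a b where "m = a + b" "a \<in> Poly_Mapping.keys p" "b \<in> Poly_Mapping.keys q"
        using m keys_mult[of p q] by blast
      then show ?thesis using \<open>p \<in> C\<close> \<open>q \<in> C\<close> keys_add[of a b] unfolding C_def by blast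
    qed
    then show ?thesis by (simp add: C_def)
  qed
  have add: "p + q \<in> C" if "p \<in> C" "q \<in> C" for p q
    using that keys_add[of p q] unfolding C_def by blast
  have minus: "- p \<in> C" if "p \<in> C" for p
    using that by (simp add: C_def keys_minus)
  have "0 \<in> C" "1 \<in> C" by (simp_all add: C_def)
  show ?thesis
  proof (rule cringI)
    show "abelian_group (int_poly_ring S)"
    proof (rule abelian_groupI)
      fix x assume "x \<in> carrier (int_poly_ring S)"
      then show "\<exists>y\<in>carrier (int_poly_ring S). y \<oplus>\<^bsub>int_poly_ring S\<^esub> x = \<zero>\<^bsub>int_poly_ring S\<^esub>"
        unfolding R by (intro bexI[of _ "- x"] minus) simp_all
    qed (simp_all add: R add \<open>0 \<in> C\<close> add.assoc add.commute)
    show "comm_monoid (int_poly_ring S)"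
      by (rule comm_monoidI) (simp_all add: R mult \<open>1 \<in> C\<close> mult.assoc mult.commute)
  qed (simp add: R distrib_right)
qed

lemma (in topological_group) Theta_relations_subset:
  "Theta_relations G T \<subseteq> carrier (int_poly_ring (Theta_symbols G T))"
proof -
  define R where "R = int_poly_ring (Theta_symbols G T)"
  interpret R: cring R unfolding R_def by (rule cring_int_poly_ring)
  have var: "poly_var X \<in> carrier R" if "X \<in> Theta_symbols G T" for X
    using that by (simp add: R_def int_poly_ring_def poly_var_def)
  have diff: "p - q \<in> carrier R" if "p \<in> carrier R" "q \<in> carrier R" for p q
    using that keys_diff[of p q] by (fastforce simp: R_def int_poly_ring_def)
  have sum: "p + q \<in> carrier R" and prod: "p * q \<in> carrier R" and one: "1 \<in> carrier R"
    if "p \<in> carrier R" "q \<in> carrier R" for p q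
    using R.a_closed[OF that] R.m_closed[OF that] R.one_closed
    by (simp_all add: R_def int_poly_ring_def)
  have conj: "ghat_conj G g X \<in> Theta_symbols G T"
    if "X \<in> Theta_symbols G T" "g \<in> carrier G" for X g
    using that finitary_ghat_conj by (simp add: Theta_symbols_def)
  have fiber: "ghat_fiber G X Y f y \<in> Theta_symbols G T"
    if "X \<in> Theta_symbols G T" "Y \<in> Theta_symbols G T" "transitive_map G X Y f" "y \<in> gset Y"
    for X Y f y
  proof -
    have "is_ghat_set G T X" "is_ghat_set G T Y"
      using that by (auto simp: Theta_symbols_def finitary_ghat_set_def)
    from finitary_ghat_fiber[OF is_group this that(3,4)] show ?thesis
      by (simp add: Theta_symbols_def)
  qed
  show ?thesis
    unfolding R_def[symmetric]
    by (rule subsetI, erule Theta_relations.cases)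
      (auto intro!: diff sum prod one var conj fiber)
qed

definition Theta ::
    "('a, 'm) monoid_scheme \<Rightarrow> 'a topology
      \<Rightarrow> ((('a, nat \<times> 'a set) ghat_set \<Rightarrow>\<^sub>0 nat) \<Rightarrow>\<^sub>0 int) set ring"
  where "Theta G T =
    int_poly_ring (Theta_symbols G T) Quot
      genideal (int_poly_ring (Theta_symbols G T)) (Theta_relations G T)"

lemma (in topological_group) cring_Theta: "cring (Theta G T)"
proof -
  interpret cring "int_poly_ring (Theta_symbols G T)" by (rule cring_int_poly_ring)
  show ?thesis
    unfolding Theta_def
    by (intro ideal.quotient_is_cring genideal_ideal Theta_relations_subset cring_axioms)
qed

section \<open>Binomial rings\<close>

text \<open>
  The tensor product over the integers of the additive group of \<open>R\<close> with the rationals, as the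
  quotient of the free abelian group on all pairs by the bilinearity relations.
\<close>

abbreviation rat_tensor_free :: "('r, 'm) ring_scheme \<Rightarrow> ('r \<times> rat \<Rightarrow>\<^sub>0 int) monoid"
  where "rat_tensor_free R \<equiv> free_Abelian_group (carrier R \<times> UNIV)"

definition rat_tensor_relations :: "('r, 'm) ring_scheme \<Rightarrow> ('r \<times> rat \<Rightarrow>\<^sub>0 int) set"
  where "rat_tensor_relations R =
    {frag_of (x \<oplus>\<^bsub>R\<^esub> y, q) - (frag_of (x, q) + frag_of (y, q)) | x y q.
       x \<in> carrier R \<and> y \<in> carrier R} \<union>
    {frag_of (x, p + q) - (frag_of (x, p) + frag_of (x, q)) | x p q. x \<in> carrier R}"

definition rat_tensor :: "('r, 'm) ring_scheme \<Rightarrow> ('r \<times> rat \<Rightarrow>\<^sub>0 int) set monoid"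
  where "rat_tensor R =
    rat_tensor_free R Mod generate (rat_tensor_free R) (rat_tensor_relations R)"

definition pure_tensor :: "('r, 'm) ring_scheme \<Rightarrow> 'r \<Rightarrow> rat \<Rightarrow> ('r \<times> rat \<Rightarrow>\<^sub>0 int) set"
  where "pure_tensor R x q =
    generate (rat_tensor_free R) (rat_tensor_relations R) #>\<^bsub>rat_tensor_free R\<^esub> frag_of (x, q)"

lemma pure_tensor_in_rat_tensor:
  assumes "x \<in> carrier R"
  shows "pure_tensor R x q \<in> carrier (rat_tensor R)"
proof -
  have "frag_of (x, q) \<in> carrier (rat_tensor_free R)"
    using assms by (simp add: free_Abelian_group_def)
  then show ?thesis by (auto simp: pure_tensor_def rat_tensor_def FactGroup_def RCOSETS_def)
qed

definition falling_product :: "('r, 'm) ring_scheme \<Rightarrow> 'r \<Rightarrow> nat \<Rightarrow> 'r"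
  where "falling_product R x n =
    (\<Otimes>\<^bsub>R\<^esub>i\<in>{..<n}. x \<ominus>\<^bsub>R\<^esub> ([i] \<cdot>\<^bsub>R\<^esub> \<one>\<^bsub>R\<^esub>))"

text \<open>An element \<open>a / m\<close> of the ring \<open>R \<otimes> \<rat>\<close> with \<open>a\<close> in \<open>R\<close> is the pure tensor \<open>a \<otimes> 1/m\<close>.\<close>

definition binomial_element :: "('r, 'm) ring_scheme \<Rightarrow> 'r \<Rightarrow> nat \<Rightarrow> ('r \<times> rat \<Rightarrow>\<^sub>0 int) set"
  where "binomial_element R x n = pure_tensor R (falling_product R x n) (1 / of_nat (fact n))"

definition binomial_ring :: "('r, 'm) ring_scheme \<Rightarrow> bool"
  where "binomial_ring R \<longleftrightarrow>
    cring R \<and>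
    (\<forall>k::int. \<forall>x\<in>carrier R. k \<noteq> 0 \<longrightarrow> [k] \<cdot>\<^bsub>R\<^esub> x = \<zero>\<^bsub>R\<^esub> \<longrightarrow> x = \<zero>\<^bsub>R\<^esub>) \<and>
    (\<forall>x\<in>carrier R. \<forall>n. binomial_element R x n \<in> (\<lambda>y. pure_tensor R y 1) ` carrier R)"

end

theory Submission
  imports Defs "HOL-Number_Theory.Cong"
begin

text \<open>
  Write \<open>[X]\<close> for the class of a finitary set \<open>X\<close>. All computations of classes rest on one principle
  (\<open>cls_constant_fiber\<close>): an equivariant map all of whose fibers have class \<open>c\<close> satisfies
  \<open>[X] = c [Y]\<close>. It follows from the relation for transitive maps by cutting source and target into
  orbits. That products, powers and sets of subsets of finitary sets are again finitary is the content
  of Roelcke precompactness (\<open>finitary_action_shrink\<close>).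

  \<^bold>\<open>Divisibility.\<close> The product \<open>[X] ([X] - 1) \<dots> ([X] - n + 1)\<close> is the class of the set of \<open>n\<close>-tuples
  of distinct points, since a tuple of length \<open>i\<close> extends by any point outside it. Forgetting the order
  is \<open>n!\<close> to one, so the product is \<open>n!\<close> times the class of the set of \<open>n\<close>-element subsets
  (\<open>cls_falling_factorial\<close>). An arbitrary element is congruent modulo \<open>n!\<close> to the class of some set,
  because \<open>-1\<close> is congruent to \<open>n! - 1\<close> and classes of sets are closed under sums and products
  (\<open>effective_representative\<close>); and the residue modulo \<open>n!\<close> of a falling factorial depends only on that of
  its argument.

  \<^bold>\<open>Torsion.\<close> Fix a prime \<open>p\<close>. Rotation permutes the nonconstant \<open>p\<close>-tuples of points of \<open>X\<close> in orbits
  of exactly \<open>p\<close> elements, called necklaces. If \<open>N X\<close> is the set of necklaces, then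
  \<open>[X]\<^sup>p = [X] + p [N X]\<close> (\<open>cls_power_prime\<close>). In the polynomial ring on the symbols let \<open>\<psi>\<close> be the ring
  endomorphism \<open>X \<mapsto> X\<^sup>p - p [N X]\<close> (\<open>frob\<close>). It is the Frobenius modulo \<open>p\<close>, so that
  \<open>\<psi> x = x\<^sup>p + p \<delta> x\<close> for a unique \<open>\<delta> x\<close>, and it is the identity modulo the ideal \<open>J\<close> of relations.
  The key point is that \<open>\<delta>\<close> maps \<open>J\<close> into \<open>J\<close> (\<open>frob_lift_ideal\<close>). As \<open>\<delta>\<close> of a sum or a product is given
  by universal formulas, this only has to be checked for the defining relations, where it says that
  necklaces of disjoint unions, conjugates and fibrations have the expected classes
  (\<open>neck_cls_Un\<close>, \<open>neck_cls_conj\<close>, \<open>neck_cls_fibration\<close>). Now let \<open>p x\<close> be in \<open>J\<close>. Then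
  \<open>p \<psi> x = \<psi> (p x) = p\<^sup>p x\<^sup>p + p \<delta> (p x)\<close>, and dividing by \<open>p\<close> in the polynomial ring shows that
  \<open>\<psi> x = p\<^sup>p\<^sup>-\<^sup>1 x\<^sup>p + \<delta> (p x)\<close> lies in \<open>J\<close>; hence so does \<open>x\<close>, which is congruent to \<open>\<psi> x\<close>.
\<close>

section \<open>Smooth actions of open subgroups\<close>

context topological_group
begin

abbreviation open_sub :: "'a set \<Rightarrow> bool" where
  "open_sub \<equiv> open_subgroup G T"

lemma open_subD:
  assumes "open_sub U"
  shows "subgroup U G" "openin T U" "\<one> \<in> U"
    "\<And>h. h \<in> U \<Longrightarrow> h \<in> carrier G"
    "\<And>h. h \<in> U \<Longrightarrow> inv h \<in> U"
    "\<And>g h. g \<in> U \<Longrightarrow> h \<in> U \<Longrightarrow> g \<otimes> h \<in> U"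
  using assms by (auto simp: open_subgroup_def subgroup.one_closed subgroup.m_inv_closed
      subgroup.m_closed subgroup.mem_carrier)

lemma open_sub_Int: "open_sub U \<Longrightarrow> open_sub V \<Longrightarrow> open_sub (U \<inter> V)"
  by (simp add: open_subgroup_def subgroups_Inter_pair openin_Int)

lemma open_sub_carrier: "open_sub (carrier G)"
  using openin_topspace[of T] by (simp add: open_subgroup_def subgroup_self topspace_eq)

lemma open_sub_conj:
  assumes "open_sub U" "g \<in> carrier G"
  shows "open_sub ((\<lambda>u. g \<otimes> u \<otimes> inv g) ` U)"
  unfolding open_subgroup_def
proof
  note U = open_subD[OF assms(1)]
  show "openin T ((\<lambda>u. g \<otimes> u \<otimes> inv g) ` U)" using openin_conj assms(2) U(2) by blast
  show "subgroup ((\<lambda>u. g \<otimes> u \<otimes> inv g) ` U) G"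
  proof (rule subgroupI)
    show "(\<lambda>u. g \<otimes> u \<otimes> inv g) ` U \<subseteq> carrier G" using U(4) assms(2) by auto
    show "(\<lambda>u. g \<otimes> u \<otimes> inv g) ` U \<noteq> {}" using U(3) by blast
    fix a assume "a \<in> (\<lambda>u. g \<otimes> u \<otimes> inv g) ` U"
    then obtain u where u: "u \<in> U" "a = g \<otimes> u \<otimes> inv g" by blast
    have "inv a = g \<otimes> inv u \<otimes> inv g"
      using u U(4) assms(2) by (simp add: inv_mult_group m_assoc)
    then show "inv a \<in> (\<lambda>u. g \<otimes> u \<otimes> inv g) ` U" using U(5) u(1) by blast
    fix b assume "b \<in> (\<lambda>u. g \<otimes> u \<otimes> inv g) ` U"
    then obtain v where v: "v \<in> U" "b = g \<otimes> v \<otimes> inv g" by blast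
    have "inv g \<otimes> (g \<otimes> z) = z" if "z \<in> carrier G" for z
      using that assms(2) by (simp add: m_assoc[symmetric])
    then have "a \<otimes> b = g \<otimes> (u \<otimes> v) \<otimes> inv g"
      using u v U(4) assms(2) by (simp add: m_assoc)
    then show "a \<otimes> b \<in> (\<lambda>u. g \<otimes> u \<otimes> inv g) ` U" using U(6) u(1) v(1) by blast
  qed
qed

lemma openin_translate:
  assumes "openin T V" "k \<in> carrier G"
  shows "openin T ((\<lambda>v. k \<otimes> v) ` V)"
proof -
  have V: "V \<subseteq> carrier G" using assms(1) openin_subset topspace_eq by blast
  have "continuous_map T (prod_topology T T) (\<lambda>x. (inv k, x))"
    using assms(2) by (simp add: continuous_map_pairwise o_def topspace_eq)
  from continuous_map_compose[OF this continuous_mult]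
  have "continuous_map T T (\<lambda>x. inv k \<otimes> x)" by (simp add: o_def)
  then have "openin T {x \<in> topspace T. inv k \<otimes> x \<in> V}"
    using assms by (auto simp: continuous_map_def)
  moreover have "{x \<in> topspace T. inv k \<otimes> x \<in> V} = (\<lambda>v. k \<otimes> v) ` V"
  proof (intro equalityI subsetI)
    fix x assume "x \<in> {x \<in> topspace T. inv k \<otimes> x \<in> V}"
    then have "x \<in> carrier G" "inv k \<otimes> x \<in> V" by (auto simp: topspace_eq)
    moreover from this have "x = k \<otimes> (inv k \<otimes> x)"
      using assms(2) by (simp add: m_assoc[symmetric])
    ultimately show "x \<in> (\<lambda>v. k \<otimes> v) ` V" by blast
  next
    fix x assume "x \<in> (\<lambda>v. k \<otimes> v) ` V"
    then show "x \<in> {x \<in> topspace T. inv k \<otimes> x \<in> V}"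
      using V assms(2) by (auto simp: topspace_eq m_assoc[symmetric] subset_iff)
  qed
  ultimately show ?thesis by simp
qed

lemma open_sub_super:
  assumes "subgroup K G" "open_sub V" "V \<subseteq> K"
  shows "open_sub K"
proof -
  have "K = (\<Union>k\<in>K. (\<lambda>v. k \<otimes> v) ` V)"
  proof (intro equalityI subsetI)
    fix k assume "k \<in> K"
    then have "k = k \<otimes> \<one>" using assms(1) subgroup.mem_carrier by fastforce
    then show "k \<in> (\<Union>k\<in>K. (\<lambda>v. k \<otimes> v) ` V)" using \<open>k \<in> K\<close> open_subD(3)[OF assms(2)] by blast
  next
    fix x assume "x \<in> (\<Union>k\<in>K. (\<lambda>v. k \<otimes> v) ` V)"
    then obtain k v where "k \<in> K" "v \<in> V" "x = k \<otimes> v" by blast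
    then show "x \<in> K" using subgroup.m_closed[OF assms(1), of k v] assms(3) by blast
  qed
  moreover have "openin T (\<Union>k\<in>K. (\<lambda>v. k \<otimes> v) ` V)"
    using assms by (auto intro!: openin_translate simp: open_subgroup_def subgroup.mem_carrier)
  ultimately show ?thesis using assms(1) by (simp add: open_subgroup_def)
qed

text \<open>
  Nothing is required of \<open>\<phi>\<close> off the set \<open>E\<close>. So subsets keep the same \<open>\<phi>\<close>, and the induced actions on
  products, lists and sets are plainly \<open>map_prod\<close>, \<open>map\<close> and \<open>image\<close>.
\<close>

definition smooth_action :: "'a set \<Rightarrow> 'x set \<Rightarrow> ('a \<Rightarrow> 'x \<Rightarrow> 'x) \<Rightarrow> bool" where
  "smooth_action U E \<phi> \<longleftrightarrow>
    open_sub U \<and>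
    (\<forall>h\<in>U. \<forall>x\<in>E. \<phi> h x \<in> E) \<and>
    (\<forall>x\<in>E. \<phi> \<one> x = x) \<and>
    (\<forall>g\<in>U. \<forall>h\<in>U. \<forall>x\<in>E. \<phi> (g \<otimes> h) x = \<phi> g (\<phi> h x)) \<and>
    (\<forall>x\<in>E. \<exists>V. open_sub V \<and> (\<forall>h\<in>V. \<phi> h x = x))"

definition finitary_action :: "'a set \<Rightarrow> 'x set \<Rightarrow> ('a \<Rightarrow> 'x \<Rightarrow> 'x) \<Rightarrow> bool" where
  "finitary_action U E \<phi> \<longleftrightarrow>
    smooth_action U E \<phi> \<and>
    (\<exists>F. finite F \<and> F \<subseteq> E \<and> (\<forall>x\<in>E. \<exists>h\<in>U. \<exists>y\<in>F. x = \<phi> h y))"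

lemma smooth_actionD:
  assumes "smooth_action U E \<phi>"
  shows "open_sub U"
    "\<And>h x. h \<in> U \<Longrightarrow> x \<in> E \<Longrightarrow> \<phi> h x \<in> E"
    "\<And>x. x \<in> E \<Longrightarrow> \<phi> \<one> x = x"
    "\<And>g h x. g \<in> U \<Longrightarrow> h \<in> U \<Longrightarrow> x \<in> E \<Longrightarrow> \<phi> (g \<otimes> h) x = \<phi> g (\<phi> h x)"
    "\<And>x. x \<in> E \<Longrightarrow> \<exists>V. open_sub V \<and> (\<forall>h\<in>V. \<phi> h x = x)"
  using assms unfolding smooth_action_def by blast+

lemma finitary_actionD:
  assumes "finitary_action U E \<phi>"
  shows "smooth_action U E \<phi>"
    "\<exists>F. finite F \<and> F \<subseteq> E \<and> (\<forall>x\<in>E. \<exists>h\<in>U. \<exists>y\<in>F. x = \<phi> h y)"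
  using assms unfolding finitary_action_def by blast+

lemma finitary_action_open: "finitary_action U E \<phi> \<Longrightarrow> open_sub U"
  unfolding finitary_action_def smooth_action_def by blast

lemma finitary_actionI:
  assumes "smooth_action U E \<phi>" "finite F" "F \<subseteq> E" "\<And>x. x \<in> E \<Longrightarrow> \<exists>h\<in>U. \<exists>y\<in>F. x = \<phi> h y"
  shows "finitary_action U E \<phi>"
  using assms unfolding finitary_action_def by blast

lemma smooth_action_inv:
  assumes "smooth_action U E \<phi>" "h \<in> U" "x \<in> E"
  shows "\<phi> (inv h) (\<phi> h x) = x" "\<phi> h (\<phi> (inv h) x) = x"
proof -
  note A = smooth_actionD[OF assms(1)] and U = open_subD[OF smooth_actionD(1)[OF assms(1)]]
  show "\<phi> (inv h) (\<phi> h x) = x"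
    using A(4)[OF U(5)[OF assms(2)] assms(2,3)] A(3)[OF assms(3)] U(4)[OF assms(2)] by simp
  show "\<phi> h (\<phi> (inv h) x) = x"
    using A(4)[OF assms(2) U(5)[OF assms(2)] assms(3)] A(3)[OF assms(3)] U(4)[OF assms(2)] by simp
qed

lemma smooth_action_bij:
  assumes "smooth_action U E \<phi>" "h \<in> U"
  shows "bij_betw (\<phi> h) E E"
proof (rule bij_betwI[where g = "\<phi> (inv h)"])
  note A = smooth_actionD[OF assms(1)] and U = open_subD[OF smooth_actionD(1)[OF assms(1)]]
  show "\<phi> h \<in> E \<rightarrow> E" "\<phi> (inv h) \<in> E \<rightarrow> E" using A(2) U(5) assms(2) by auto
qed (use smooth_action_inv[OF assms] in auto)

lemma open_sub_stabilizer:
  assumes "smooth_action U E \<phi>" "x \<in> E"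
  shows "open_sub {h \<in> U. \<phi> h x = x}"
proof -
  note A = smooth_actionD[OF assms(1)] and U = open_subD[OF smooth_actionD(1)[OF assms(1)]]
  obtain V where V: "open_sub V" "\<forall>h\<in>V. \<phi> h x = x" using A(5) assms(2) by blast
  have "subgroup {h \<in> U. \<phi> h x = x} G"
  proof (rule subgroupI)
    show "{h \<in> U. \<phi> h x = x} \<noteq> {}" using U(3) A(3)[OF assms(2)] by blast
    fix a assume "a \<in> {h \<in> U. \<phi> h x = x}"
    then show "inv a \<in> {h \<in> U. \<phi> h x = x}"
      using U(5) smooth_action_inv(1)[OF assms(1) _ assms(2), of a] by simp
  next
    fix a b assume "a \<in> {h \<in> U. \<phi> h x = x}" "b \<in> {h \<in> U. \<phi> h x = x}"
    then show "a \<otimes> b \<in> {h \<in> U. \<phi> h x = x}" using A(4) U(6) assms(2) by auto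
  qed (use U in auto)
  then show ?thesis
    by (rule open_sub_super[OF _ open_sub_Int[OF A(1) V(1)]]) (use V in auto)
qed

lemma open_sub_pointwise_stabilizer:
  assumes "smooth_action U E \<phi>" "finite F" "F \<subseteq> E"
  shows "\<exists>V. open_sub V \<and> V \<subseteq> U \<and> (\<forall>h\<in>V. \<forall>x\<in>F. \<phi> h x = x)"
  using assms(2,3)
proof (induction F)
  case empty
  then show ?case using smooth_actionD(1)[OF assms(1)] by blast
next
  case (insert x F)
  then obtain V where V: "open_sub V" "V \<subseteq> U" "\<forall>h\<in>V. \<forall>x\<in>F. \<phi> h x = x" by auto
  show ?case
    using open_sub_Int[OF V(1) open_sub_stabilizer[OF assms(1), of x]] V insert.prems
    by (intro exI[of _ "V \<inter> {h \<in> U. \<phi> h x = x}"]) auto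
qed

lemma smooth_action_sub:
  assumes "smooth_action U E \<phi>" "open_sub V" "V \<subseteq> U" "E' \<subseteq> E"
    "\<And>h x. h \<in> V \<Longrightarrow> x \<in> E' \<Longrightarrow> \<phi> h x \<in> E'"
  shows "smooth_action V E' \<phi>"
  unfolding smooth_action_def
proof (intro conjI ballI)
  note A = smooth_actionD[OF assms(1)]
  show "open_sub V" by (rule assms(2))
  fix x assume x: "x \<in> E'"
  then have xE: "x \<in> E" using assms(4) by blast
  show "\<phi> h x \<in> E'" if "h \<in> V" for h using assms(5) that x by blast
  show "\<phi> \<one> x = x" "\<exists>W. open_sub W \<and> (\<forall>h\<in>W. \<phi> h x = x)" using A(3,5) xE by blast+
  show "\<phi> (g \<otimes> h) x = \<phi> g (\<phi> h x)" if "g \<in> V" "h \<in> V" for g h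
    using A(4) that xE assms(3) by blast
qed

lemma finitary_action_sub:
  assumes "finitary_action U E \<phi>" "E' \<subseteq> E" "\<And>h x. h \<in> U \<Longrightarrow> x \<in> E' \<Longrightarrow> \<phi> h x \<in> E'"
  shows "finitary_action U E' \<phi>"
proof -
  note S = finitary_actionD(1)[OF assms(1)]
  note A = smooth_actionD[OF S] and U = open_subD[OF smooth_actionD(1)[OF S]]
  obtain F where F: "finite F" "F \<subseteq> E" "\<forall>x\<in>E. \<exists>h\<in>U. \<exists>y\<in>F. x = \<phi> h y"
    using finitary_actionD(2)[OF assms(1)] by blast
  show ?thesis
  proof (rule finitary_actionI[where F = "F \<inter> E'"])
    show "smooth_action U E' \<phi>" using smooth_action_sub[OF S A(1) order_refl] assms by blast
    fix x assume x: "x \<in> E'"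
    then obtain h y where h: "h \<in> U" "y \<in> F" "x = \<phi> h y" using F assms(2) by blast
    then have "y = \<phi> (inv h) x" using smooth_action_inv(1)[OF S] F by auto
    then have "y \<in> E'" using x assms(3) U(5) h by blast
    then show "\<exists>h\<in>U. \<exists>y\<in>F \<inter> E'. x = \<phi> h y" using h by blast
  qed (use F in auto)
qed

lemma finitary_action_image:
  assumes "finitary_action U E \<phi>" "f ` E = B"
    and eq: "\<And>h x. h \<in> U \<Longrightarrow> x \<in> E \<Longrightarrow> f (\<phi> h x) = \<psi> h (f x)"
  shows "finitary_action U B \<psi>"
proof -
  note S = finitary_actionD(1)[OF assms(1)]
  note A = smooth_actionD[OF S] and U = open_subD[OF smooth_actionD(1)[OF S]]
  obtain F where F: "finite F" "F \<subseteq> E" "\<forall>x\<in>E. \<exists>h\<in>U. \<exists>y\<in>F. x = \<phi> h y"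
    using finitary_actionD(2)[OF assms(1)] by blast
  have B: "\<exists>x\<in>E. b = f x" if "b \<in> B" for b using assms(2) that by blast
  show ?thesis
  proof (rule finitary_actionI[where F = "f ` F"])
    show "smooth_action U B \<psi>"
      unfolding smooth_action_def
    proof (intro conjI ballI)
      fix b h assume "h \<in> U" "b \<in> B"
      then show "\<psi> h b \<in> B" using B eq A(2) assms(2) by (metis image_eqI)
    next
      fix b assume "b \<in> B"
      then obtain x where x: "x \<in> E" "b = f x" using B by blast
      show "\<psi> \<one> b = b" using eq[OF U(3) x(1)] A(3) x by simp
      obtain V where V: "open_sub V" "\<forall>h\<in>V. \<phi> h x = x" using A(5) x by blast
      have "\<forall>h\<in>U \<inter> V. \<psi> h b = b" using V eq x by force
      then show "\<exists>V. open_sub V \<and> (\<forall>h\<in>V. \<psi> h b = b)" using open_sub_Int[OF A(1) V(1)] by blast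
    next
      fix g h b assume gh: "g \<in> U" "h \<in> U" "b \<in> B"
      then obtain x where x: "x \<in> E" "b = f x" using B by blast
      then show "\<psi> (g \<otimes> h) b = \<psi> g (\<psi> h b)"
        using gh eq[of "g \<otimes> h" x] eq[of g "\<phi> h x"] eq[of h x] A(2,4) U(6) by simp
    qed (rule A(1))
    show "finite (f ` F)" "f ` F \<subseteq> B" using F assms(2) by auto
    fix b assume "b \<in> B"
    then obtain x where x: "x \<in> E" "b = f x" using B by blast
    then obtain h y where "h \<in> U" "y \<in> F" "x = \<phi> h y" using F by blast
    then show "\<exists>h\<in>U. \<exists>y\<in>f ` F. b = \<psi> h y" using x eq F by blast
  qed
qed

lemma finitary_action_fiber:
  assumes "finitary_action U E \<phi>" "b \<in> B"
    and B: "smooth_action U B \<psi>" "f \<in> E \<rightarrow> B"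
    and eq: "\<And>h x. h \<in> U \<Longrightarrow> x \<in> E \<Longrightarrow> f (\<phi> h x) = \<psi> h (f x)"
  shows "finitary_action {h \<in> U. \<psi> h b = b} {x \<in> E. f x = b} \<phi>"
proof -
  note S = finitary_actionD(1)[OF assms(1)]
  note A = smooth_actionD[OF S] and U = open_subD[OF smooth_actionD(1)[OF S]]
  note AB = smooth_actionD[OF B(1)]
  obtain F where F: "finite F" "F \<subseteq> E" "\<forall>x\<in>E. \<exists>h\<in>U. \<exists>y\<in>F. x = \<phi> h y"
    using finitary_actionD(2)[OF assms(1)] by blast
  let ?V = "{h \<in> U. \<psi> h b = b}" and ?E = "{x \<in> E. f x = b}"
  \<comment> \<open>Move every generator whose orbit meets the fiber into the fiber.\<close>
  define t where "t y = (SOME h. h \<in> U \<and> f (\<phi> h y) = b)" for y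
  define F' where "F' = {y \<in> F. \<exists>h\<in>U. f (\<phi> h y) = b}"
  have t: "t y \<in> U" "f (\<phi> (t y) y) = b" if "y \<in> F'" for y
  proof -
    have "\<exists>h. h \<in> U \<and> f (\<phi> h y) = b" using that by (auto simp: F'_def)
    then have "t y \<in> U \<and> f (\<phi> (t y) y) = b" unfolding t_def by (rule someI_ex)
    then show "t y \<in> U" "f (\<phi> (t y) y) = b" by auto
  qed
  show ?thesis
  proof (rule finitary_actionI[where F = "(\<lambda>y. \<phi> (t y) y) ` F'"])
    show "smooth_action ?V ?E \<phi>"
      by (rule smooth_action_sub[OF S open_sub_stabilizer[OF B(1) assms(2)]])
        (use A eq in auto)
    show "finite ((\<lambda>y. \<phi> (t y) y) ` F')" using F by (simp add: F'_def)
    have "F' \<subseteq> E" using F(2) by (auto simp: F'_def)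
    then show "(\<lambda>y. \<phi> (t y) y) ` F' \<subseteq> ?E" using t A(2) by blast
    fix x assume x: "x \<in> ?E"
    then obtain h y where h: "h \<in> U" "y \<in> F" "x = \<phi> h y" using F by blast
    then have y: "y \<in> F'" "y \<in> E" using x F by (auto simp: F'_def)
    let ?k = "h \<otimes> inv (t y)"
    have k: "?k \<in> U" using h t[OF y(1)] U by blast
    have "inv (t y) \<otimes> t y = \<one>" using t[OF y(1)] U by simp
    then have "?k \<otimes> t y = h" using h t[OF y(1)] U by (simp add: m_assoc)
    then have xk: "x = \<phi> ?k (\<phi> (t y) y)"
      using A(4)[OF k t(1)[OF y(1)] y(2)] h by simp
    then have "b = \<psi> ?k b" using eq[OF k, of "\<phi> (t y) y"] t[OF y(1)] A(2) y(2) x by simp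
    then show "\<exists>h\<in>?V. \<exists>z\<in>(\<lambda>y. \<phi> (t y) y) ` F'. x = \<phi> h z" using xk k y by force
  qed
qed

text \<open>
  A point is first moved over one of finitely many representatives in the base, and then within the
  fiber over that representative.
\<close>

lemma finitary_action_total:
  assumes S: "smooth_action U E \<phi>" and B: "finitary_action U B \<psi>" and f: "f \<in> E \<rightarrow> B"
    and eq: "\<And>h x. h \<in> U \<Longrightarrow> x \<in> E \<Longrightarrow> f (\<phi> h x) = \<psi> h (f x)"
    and fib: "\<And>b. b \<in> B \<Longrightarrow>
      \<exists>F. finite F \<and> F \<subseteq> E \<and> (\<forall>x\<in>E. f x = b \<longrightarrow> (\<exists>h\<in>U. \<exists>y\<in>F. x = \<phi> h y))"
  shows "finitary_action U E \<phi>"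
proof -
  note A = smooth_actionD[OF S] and U = open_subD[OF smooth_actionD(1)[OF S]]
  obtain C where C: "finite C" "C \<subseteq> B" "\<forall>b\<in>B. \<exists>h\<in>U. \<exists>c\<in>C. b = \<psi> h c"
    using finitary_actionD(2)[OF B] by blast
  obtain F where F: "\<And>b. b \<in> B \<Longrightarrow> finite (F b) \<and> F b \<subseteq> E \<and>
      (\<forall>x\<in>E. f x = b \<longrightarrow> (\<exists>h\<in>U. \<exists>y\<in>F b. x = \<phi> h y))"
    using fib by metis
  show ?thesis
  proof (rule finitary_actionI[OF S, where F = "\<Union>(F ` C)"])
    show "finite (\<Union>(F ` C))" "\<Union>(F ` C) \<subseteq> E" using C F by blast+
    fix x assume x: "x \<in> E"
    then obtain h c where h: "h \<in> U" "c \<in> C" "f x = \<psi> h c" using C f by blast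
    have "f (\<phi> (inv h) x) = c"
      using eq[OF U(5)[OF h(1)] x] h smooth_action_inv(1)[OF finitary_actionD(1)[OF B] h(1)] C by auto
    then obtain k y where k: "k \<in> U" "y \<in> F c" "\<phi> (inv h) x = \<phi> k y"
      using F[of c] C h A(2)[OF U(5)[OF h(1)] x] by blast
    have "y \<in> E" using F[of c] C h k by blast
    have "x = \<phi> h (\<phi> k y)" using k smooth_action_inv(2)[OF S h(1) x] by simp
    also have "\<dots> = \<phi> (h \<otimes> k) y" using A(4) h k \<open>y \<in> E\<close> by simp
    finally show "\<exists>h\<in>U. \<exists>y\<in>\<Union>(F ` C). x = \<phi> h y" using h k U(6) by blast
  qed
qed

lemma finitary_action_finite:
  assumes "smooth_action U E \<phi>" "finite E"
  shows "finitary_action U E \<phi>"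
  by (rule finitary_actionI[OF assms(1,2) order_refl])
    (use smooth_actionD(1,3)[OF assms(1)] open_subD(3) in metis)

lemma finitary_action_Un:
  assumes "finitary_action U E \<phi>" "finitary_action U E' \<phi>"
  shows "finitary_action U (E \<union> E') \<phi>"
proof -
  obtain F where F: "finite F" "F \<subseteq> E" "\<forall>x\<in>E. \<exists>h\<in>U. \<exists>y\<in>F. x = \<phi> h y"
    using finitary_actionD(2)[OF assms(1)] by blast
  obtain F' where F': "finite F'" "F' \<subseteq> E'" "\<forall>x\<in>E'. \<exists>h\<in>U. \<exists>y\<in>F'. x = \<phi> h y"
    using finitary_actionD(2)[OF assms(2)] by blast
  show ?thesis
  proof (rule finitary_actionI[where F = "F \<union> F'"])
    show "smooth_action U (E \<union> E') \<phi>"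
      using finitary_actionD(1)[OF assms(1)] finitary_actionD(1)[OF assms(2)]
      unfolding smooth_action_def by blast
  qed (use F F' in blast)+
qed

end

context pro_oligomorphic
begin

text \<open>
  Roelcke precompactness enters here: two translates \<open>\<phi> u y\<close> and \<open>\<phi> r y\<close> lie in the
  same \<open>V\<close>-orbit as soon as \<open>u\<close> and \<open>r\<close> lie in the same double coset of \<open>V\<close> and the stabilizer of \<open>y\<close>.
\<close>

lemma finitary_action_shrink:
  assumes "finitary_action U E \<phi>" "open_sub V" "V \<subseteq> U"
  shows "finitary_action V E \<phi>"
proof -
  note S = finitary_actionD(1)[OF assms(1)]
  note A = smooth_actionD[OF S] and U = open_subD[OF smooth_actionD(1)[OF S]]
  note V = open_subD[OF assms(2)]
  obtain F where F: "finite F" "F \<subseteq> E" "\<forall>x\<in>E. \<exists>h\<in>U. \<exists>y\<in>F. x = \<phi> h y"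
    using finitary_actionD(2)[OF assms(1)] by blast
  have *: "\<exists>R. finite R \<and> R \<subseteq> U \<and> (\<forall>u\<in>U. \<exists>v\<in>V. \<exists>r\<in>R. \<phi> u y = \<phi> v (\<phi> r y))" if y: "y \<in> F" for y
  proof -
    have yE: "y \<in> E" using y F by blast
    let ?S = "{h \<in> U. \<phi> h y = y}"
    let ?d = "\<lambda>u. V <#> (u <# ?S)"
    have oS: "open_sub ?S" using open_sub_stabilizer[OF S yE] .
    note Sd = open_subD[OF oS]
    have "finite (?d ` U)"
      using roelcke_precompact[OF assms(2) oS]
      by (rule rev_finite_subset) (use U(4) in auto)
    then obtain R where R: "R \<subseteq> U" "finite R" "?d ` U = ?d ` R"
      using finite_subset_image[of "?d ` U" ?d U] by auto
    have "\<exists>v\<in>V. \<exists>r\<in>R. \<phi> u y = \<phi> v (\<phi> r y)" if u: "u \<in> U" for u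
    proof -
      obtain r where r: "r \<in> R" "?d u = ?d r" using R u by blast
      have "\<one> \<otimes> (u \<otimes> \<one>) \<in> ?d u"
        using V(3) Sd(3) unfolding set_mult_def l_coset_def by blast
      then have "u \<in> ?d u" using U(4)[OF u] by simp
      then have "u \<in> ?d r" using r by simp
      then obtain v s where vs: "v \<in> V" "s \<in> ?S" "u = v \<otimes> (r \<otimes> s)"
        unfolding set_mult_def l_coset_def by blast
      have "\<phi> u y = \<phi> v (\<phi> r (\<phi> s y))"
        using vs A(4) yE assms(3) r(1) R(1) U(6) A(2) by (simp add: subset_iff)
      then have "\<phi> u y = \<phi> v (\<phi> r y)" using vs by simp
      then show ?thesis using r vs by blast
    qed
    then show ?thesis using R by blast
  qed
  obtain R where R: "\<And>y. y \<in> F \<Longrightarrow> finite (R y) \<and> R y \<subseteq> U \<and>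
      (\<forall>u\<in>U. \<exists>v\<in>V. \<exists>r\<in>R y. \<phi> u y = \<phi> v (\<phi> r y))"
    using * by metis
  show ?thesis
  proof (rule finitary_actionI[where F = "\<Union>y\<in>F. (\<lambda>r. \<phi> r y) ` R y"])
    show "smooth_action V E \<phi>"
      using smooth_action_sub[OF S assms(2,3) order_refl] A(2) assms(3) by blast
    show "finite (\<Union>y\<in>F. (\<lambda>r. \<phi> r y) ` R y)" using F R by blast
    show "(\<Union>y\<in>F. (\<lambda>r. \<phi> r y) ` R y) \<subseteq> E"
    proof (clarify)
      fix y r assume "y \<in> F" "r \<in> R y"
      then show "\<phi> r y \<in> E" using R[of y] A(2) F by blast
    qed
    fix x assume "x \<in> E"
    then obtain u y where uy: "u \<in> U" "y \<in> F" "x = \<phi> u y" using F by blast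
    then show "\<exists>h\<in>V. \<exists>z\<in>\<Union>y\<in>F. (\<lambda>r. \<phi> r y) ` R y. x = \<phi> h z" using R[of y] by blast
  qed
qed

lemma finitary_action_prod:
  assumes "finitary_action U E \<phi>" "finitary_action U B \<psi>"
  shows "finitary_action U (E \<times> B) (\<lambda>h. map_prod (\<phi> h) (\<psi> h))"
proof -
  note S = finitary_actionD(1)[OF assms(1)] and S' = finitary_actionD(1)[OF assms(2)]
  note A = smooth_actionD[OF S] and A' = smooth_actionD[OF S']
  have sm: "smooth_action U (E \<times> B) (\<lambda>h. map_prod (\<phi> h) (\<psi> h))"
    unfolding smooth_action_def
  proof (intro conjI ballI)
    fix x assume x: "x \<in> E \<times> B"
    obtain V where "open_sub V" "\<forall>h\<in>V. \<phi> h (fst x) = fst x"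
      using A(5)[of "fst x"] x by (auto simp: mem_Times_iff)
    moreover obtain V' where "open_sub V'" "\<forall>h\<in>V'. \<psi> h (snd x) = snd x"
      using A'(5)[of "snd x"] x by (auto simp: mem_Times_iff)
    ultimately show "\<exists>V. open_sub V \<and> (\<forall>h\<in>V. map_prod (\<phi> h) (\<psi> h) x = x)"
      by (intro exI[of _ "V \<inter> V'"]) (auto simp: open_sub_Int prod_eq_iff)
  qed (auto simp: A(1-4) A'(1-4))
  show ?thesis
  proof (rule finitary_action_total[OF sm assms(2), where f = snd])
    fix b assume b: "b \<in> B"
    let ?V = "{h \<in> U. \<psi> h b = b}"
    have fin: "finitary_action ?V E \<phi>"
      by (rule finitary_action_shrink[OF assms(1) open_sub_stabilizer[OF S' b]]) auto
    then obtain F where F: "finite F" "F \<subseteq> E" "\<forall>x\<in>E. \<exists>h\<in>?V. \<exists>y\<in>F. x = \<phi> h y"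
      using finitary_actionD(2)[OF fin] by blast
    show "\<exists>F. finite F \<and> F \<subseteq> E \<times> B \<and> (\<forall>x\<in>E \<times> B. snd x = b \<longrightarrow>
        (\<exists>h\<in>U. \<exists>y\<in>F. x = map_prod (\<phi> h) (\<psi> h) y))"
    proof (intro exI[of _ "F \<times> {b}"] conjI ballI impI)
      fix x assume x: "x \<in> E \<times> B" "snd x = b"
      then have "fst x \<in> E" by (simp add: mem_Times_iff)
      then obtain h y where "h \<in> ?V" "y \<in> F" "fst x = \<phi> h y" using F(3) by blast
      then show "\<exists>h\<in>U. \<exists>y\<in>F \<times> {b}. x = map_prod (\<phi> h) (\<psi> h) y"
        using x by (intro bexI[of _ h] bexI[of _ "(y, b)"]) (auto simp: prod_eq_iff)
    qed (use F(1,2) b in auto)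
  qed auto
qed

definition list_set :: "nat \<Rightarrow> 'x set \<Rightarrow> 'x list set" where
  "list_set n E = {l. length l = n \<and> set l \<subseteq> E}"

lemma finitary_action_trivial:
  assumes "open_sub U" "finite E" "\<And>h x. h \<in> U \<Longrightarrow> x \<in> E \<Longrightarrow> \<phi> h x = x"
  shows "finitary_action U E \<phi>"
proof (rule finitary_action_finite[OF _ assms(2)])
  show "smooth_action U E \<phi>"
    unfolding smooth_action_def
    by (intro conjI ballI) (use assms(1) in \<open>auto simp: assms(3) open_subD[OF assms(1)]\<close>)
qed

lemma finitary_action_lists:
  assumes "finitary_action U E \<phi>"
  shows "finitary_action U (list_set n E) (\<lambda>h. map (\<phi> h))"
proof (induction n)
  case 0
  have "list_set 0 E = {[]}" by (auto simp: list_set_def)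
  moreover have "finitary_action U {[]} (\<lambda>h. map (\<phi> h))"
  proof (rule finitary_action_trivial)
    show "open_sub U" by (rule finitary_action_open[OF assms])
  qed simp_all
  ultimately show ?case by simp
next
  case (Suc n)
  show ?case
  proof (rule finitary_action_image[OF finitary_action_prod[OF assms Suc]])
    show "(\<lambda>(x, l). x # l) ` (E \<times> list_set n E) = list_set (Suc n) E"
      by (force simp: list_set_def image_iff length_Suc_conv)
  qed auto
qed

end

section \<open>Congruence modulo the defining relations\<close>

inductive_set ideal_hull :: "'r::comm_ring_1 set \<Rightarrow> 'r set" for R where
  zero: "0 \<in> ideal_hull R"
| gen: "r \<in> R \<Longrightarrow> r \<in> ideal_hull R"
| add: "x \<in> ideal_hull R \<Longrightarrow> y \<in> ideal_hull R \<Longrightarrow> x + y \<in> ideal_hull R"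
| mult: "x \<in> ideal_hull R \<Longrightarrow> y * x \<in> ideal_hull R"

lemma ideal_hull_uminus: "x \<in> ideal_hull R \<Longrightarrow> - x \<in> ideal_hull R"
  using ideal_hull.mult[of x R "-1"] by simp

lemma ideal_hull_diff: "x \<in> ideal_hull R \<Longrightarrow> y \<in> ideal_hull R \<Longrightarrow> x - y \<in> ideal_hull R"
  using ideal_hull.add[OF _ ideal_hull_uminus, of x R y] by simp

lemma ideal_hull_dvd: "x \<in> ideal_hull R \<Longrightarrow> x dvd y \<Longrightarrow> y \<in> ideal_hull R"
  using ideal_hull.mult[of x R] by (auto simp: dvd_def mult.commute)

type_synonym 'a theta_poly = "(('a, nat \<times> 'a set) ghat_set \<Rightarrow>\<^sub>0 nat) \<Rightarrow>\<^sub>0 int"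

context pro_oligomorphic
begin

text \<open>
  The variables that are not symbols are killed as well. This makes the congruence an ideal congruence
  on the whole type of polynomials, where the ring operations are total; on polynomials in the symbols
  it agrees with the ideal defining \<open>\<Theta>(G)\<close> (\<open>mem_genideal_iff\<close>).
\<close>

definition theta_ideal :: "'a theta_poly set" where
  "theta_ideal = ideal_hull (Theta_relations G T \<union> poly_var ` (- Theta_symbols G T))"

definition theta_cong :: "'a theta_poly \<Rightarrow> 'a theta_poly \<Rightarrow> bool" (infix "\<doteq>" 50) where
  "x \<doteq> y \<longleftrightarrow> x - y \<in> theta_ideal"

lemma theta_cong_refl [simp, intro]: "x \<doteq> x"
  by (simp add: theta_cong_def theta_ideal_def ideal_hull.zero)

lemma theta_cong_sym: "x \<doteq> y \<Longrightarrow> y \<doteq> x"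
  unfolding theta_cong_def theta_ideal_def using ideal_hull_uminus[of "x - y"] by simp

lemma theta_cong_trans [trans]: "x \<doteq> y \<Longrightarrow> y \<doteq> z \<Longrightarrow> x \<doteq> z"
  unfolding theta_cong_def theta_ideal_def using ideal_hull.add[of "x - y" _ "y - z"] by simp

lemma theta_cong_add: "x \<doteq> y \<Longrightarrow> x' \<doteq> y' \<Longrightarrow> x + x' \<doteq> y + y'"
  unfolding theta_cong_def theta_ideal_def using ideal_hull.add[of "x - y" _ "x' - y'"]
  by (simp add: algebra_simps)

lemma theta_cong_uminus: "x \<doteq> y \<Longrightarrow> - x \<doteq> - y"
  unfolding theta_cong_def theta_ideal_def using ideal_hull_uminus[of "x - y"] by (simp add: algebra_simps)

lemma theta_cong_diff: "x \<doteq> y \<Longrightarrow> x' \<doteq> y' \<Longrightarrow> x - x' \<doteq> y - y'"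
  using theta_cong_add[OF _ theta_cong_uminus, of x y x' y'] by simp

lemma theta_cong_mult: "x \<doteq> y \<Longrightarrow> x' \<doteq> y' \<Longrightarrow> x * x' \<doteq> y * y'"
  unfolding theta_cong_def theta_ideal_def
  using ideal_hull.add[OF ideal_hull.mult[of "x - y" _ x'] ideal_hull.mult[of "x' - y'" _ y]]
  by (simp add: algebra_simps)

lemma theta_cong_power: "x \<doteq> y \<Longrightarrow> x ^ n \<doteq> y ^ n"
  by (induction n) (auto intro: theta_cong_mult)

lemma theta_cong_sum: "(\<And>i. i \<in> I \<Longrightarrow> f i \<doteq> g i) \<Longrightarrow> sum f I \<doteq> sum g I"
  by (induction I rule: infinite_finite_induct) (auto intro: theta_cong_add)

lemma theta_cong_relation: "x - y \<in> Theta_relations G T \<Longrightarrow> x \<doteq> y"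
  by (simp add: theta_cong_def theta_ideal_def ideal_hull.gen)

section \<open>The class of a set with a finitary action\<close>

lemma ghat_set_finitary_action:
  assumes "finitary_ghat_set G T X"
  shows "finitary_action (gdom X) (gset X) (gact X)"
proof -
  let ?K = "ghat_grp G X"
  have U: "open_sub (gdom X)" and act: "group_action ?K (gset X) (gact X)"
    and st: "\<And>x. x \<in> gset X \<Longrightarrow> openin T (stabilizer ?K (gact X) x)"
    and fin: "finite (orbits ?K (gset X) (gact X))"
    using assms by (auto simp: finitary_ghat_set_def is_ghat_set_def)
  interpret A: group_action ?K "gset X" "gact X" by (rule act)
  have one: "gact X \<one> x = x" if "x \<in> gset X" for x
    using fun_cong[OF A.id_eq_one, of x] that by simp
  have "orbits ?K (gset X) (gact X) = orbit ?K (gact X) ` gset X" by (auto simp: orbits_def)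
  then obtain F where F: "F \<subseteq> gset X" "finite F"
      "orbits ?K (gset X) (gact X) = orbit ?K (gact X) ` F"
    using fin finite_subset_image[of "orbit ?K (gact X) ` gset X" "orbit ?K (gact X)" "gset X"] by auto
  show ?thesis
  proof (rule finitary_actionI[OF _ F(2,1)])
    show "smooth_action (gdom X) (gset X) (gact X)"
      unfolding smooth_action_def
    proof (intro conjI ballI)
      fix h x assume "h \<in> gdom X" "x \<in> gset X"
      then show "gact X h x \<in> gset X" using A.element_image[of h x] by simp
    next
      fix g h x assume "g \<in> gdom X" "h \<in> gdom X" "x \<in> gset X"
      then show "gact X (g \<otimes> h) x = gact X g (gact X h x)" using A.composition_rule[of x g h] by simp
    next
      fix x assume x: "x \<in> gset X"
      have "subgroup (stabilizer ?K (gact X) x) G"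
        using A.stabilizer_subgroup[OF x] group.incl_subgroup[OF is_group open_subD(1)[OF U]] by simp
      then have "open_sub (stabilizer ?K (gact X) x)" using st[OF x] by (simp add: open_subgroup_def)
      moreover have "\<forall>h\<in>stabilizer ?K (gact X) x. gact X h x = x" by (simp add: stabilizer_def)
      ultimately show "\<exists>V. open_sub V \<and> (\<forall>h\<in>V. gact X h x = x)" by blast
    qed (use U one in auto)
    fix x assume x: "x \<in> gset X"
    then have "orbit ?K (gact X) x \<in> orbits ?K (gset X) (gact X)" by (auto simp: orbits_def)
    then obtain y where y: "y \<in> F" "orbit ?K (gact X) x = orbit ?K (gact X) y" using F(3) by auto
    have "x \<in> orbit ?K (gact X) x" using one[OF x] open_subD(3)[OF U] unfolding orbit_def by force
    then have "x \<in> orbit ?K (gact X) y" using y by simp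
    then show "\<exists>h\<in>gdom X. \<exists>y\<in>F. x = gact X h y" using y(1) unfolding orbit_def by auto
  qed
qed

lemma finitary_action_ghat_set:
  assumes "finitary_action U E \<phi>"
  shows "finitary_ghat_set G T \<lparr>gdom = U, gset = E, gact = \<lambda>h. restrict (\<phi> h) E\<rparr>"
proof -
  note S = finitary_actionD(1)[OF assms]
  note A = smooth_actionD[OF S] and U = open_subD[OF smooth_actionD(1)[OF S]]
  obtain F where F: "finite F" "F \<subseteq> E" "\<forall>x\<in>E. \<exists>h\<in>U. \<exists>y\<in>F. x = \<phi> h y"
    using finitary_actionD(2)[OF assms] by blast
  let ?K = "G\<lparr>carrier := U\<rparr>" and ?r = "\<lambda>h. restrict (\<phi> h) E"
  have gK: "group ?K" using subgroup.subgroup_is_group[OF U(1) is_group] .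
  have act: "group_action ?K E ?r"
    unfolding group_action_iff[OF gK]
  proof (intro conjI ballI)
    fix h assume "h \<in> carrier ?K"
    then show "?r h \<in> Bij E" using smooth_action_bij[OF S, of h] by (simp add: Bij_def)
  next
    fix g h x assume "g \<in> carrier ?K" "h \<in> carrier ?K" "x \<in> E"
    then show "?r (g \<otimes>\<^bsub>?K\<^esub> h) x = ?r g (?r h x)" by (simp add: A(2,4))
  qed
  interpret A: group_action ?K E ?r by (rule act)
  have "openin T (stabilizer ?K ?r x)" if "x \<in> E" for x
  proof -
    have "stabilizer ?K ?r x = {h \<in> U. \<phi> h x = x}" using that by (auto simp: stabilizer_def)
    then show ?thesis using open_sub_stabilizer[OF S that] by (simp add: open_subgroup_def)
  qed
  moreover have "orbits ?K E ?r \<subseteq> orbit ?K ?r ` F"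
  proof
    fix O' assume "O' \<in> orbits ?K E ?r"
    then obtain x where x: "x \<in> E" "O' = orbit ?K ?r x" by (auto simp: orbits_def)
    then obtain h y where h: "h \<in> U" "y \<in> F" "x = \<phi> h y" using F by blast
    then have y: "y \<in> E" using F by blast
    have sub: "orbit ?K ?r z \<subseteq> E" if "z \<in> E" for z
      using A.element_image that unfolding orbit_def by blast
    have xy: "x \<in> orbit ?K ?r y" using h y by (auto simp: orbit_def)
    have "orbit ?K ?r x = orbit ?K ?r y"
    proof (intro equalityI subsetI)
      fix z assume "z \<in> orbit ?K ?r x"
      then show "z \<in> orbit ?K ?r y" using A.orbit_trans[OF y x(1) _ xy] sub[OF x(1)] by blast
    next
      fix z assume "z \<in> orbit ?K ?r y"
      then show "z \<in> orbit ?K ?r x"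
        using A.orbit_trans[OF x(1) y _ A.orbit_sym[OF y x(1) xy]] sub[OF y] by blast
    qed
    then show "O' \<in> orbit ?K ?r ` F" using x h by blast
  qed
  ultimately show ?thesis
    using act A(1) F finite_subset[OF _ finite_imageI]
    by (auto simp: finitary_ghat_set_def is_ghat_set_def)
qed

text \<open>
  Equivariance is only asked for a small open subgroup, because a class does not see the group of
  definition.
\<close>

definition represents ::
  "('a, nat \<times> 'a set) ghat_set \<Rightarrow> 'x set \<Rightarrow> ('a \<Rightarrow> 'x \<Rightarrow> 'x) \<Rightarrow> bool" where
  "represents Y E \<phi> \<longleftrightarrow> Y \<in> Theta_symbols G T \<and>
    (\<exists>f W. bij_betw f E (gset Y) \<and> open_sub W \<and> W \<subseteq> gdom Y \<and>
      (\<forall>h\<in>W. \<forall>x\<in>E. \<phi> h x \<in> E \<and> f (\<phi> h x) = gact Y h (f x)))"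

lemma representsE:
  assumes "represents Y E \<phi>"
  obtains f W where "Y \<in> Theta_symbols G T" "bij_betw f E (gset Y)" "open_sub W" "W \<subseteq> gdom Y"
    "\<And>h x. h \<in> W \<Longrightarrow> x \<in> E \<Longrightarrow> \<phi> h x \<in> E"
    "\<And>h x. h \<in> W \<Longrightarrow> x \<in> E \<Longrightarrow> f (\<phi> h x) = gact Y h (f x)"
  using assms unfolding represents_def by blast

lemma representsI:
  assumes "Y \<in> Theta_symbols G T" "bij_betw f E (gset Y)" "open_sub W" "W \<subseteq> gdom Y"
    "\<And>h x. h \<in> W \<Longrightarrow> x \<in> E \<Longrightarrow> \<phi> h x \<in> E"
    "\<And>h x. h \<in> W \<Longrightarrow> x \<in> E \<Longrightarrow> f (\<phi> h x) = gact Y h (f x)"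
  shows "represents Y E \<phi>"
  using assms unfolding represents_def by blast

lemma finitary_action_symbol:
  assumes "finitary_action U E \<phi>"
  obtains Y f where "Y \<in> Theta_symbols G T" "gdom Y = U" "bij_betw f E (gset Y)"
    "\<And>h x. h \<in> U \<Longrightarrow> x \<in> E \<Longrightarrow> f (\<phi> h x) = gact Y h (f x)" "represents Y E \<phi>"
proof -
  let ?X = "\<lparr>gdom = U, gset = E, gact = \<lambda>h. restrict (\<phi> h) E\<rparr>"
  obtain Y f where Y: "Y \<in> Theta_symbols G T" "gdom Y = gdom ?X" "bij_betw f (gset ?X) (gset Y)"
    "\<And>h x. h \<in> gdom ?X \<Longrightarrow> x \<in> gset ?X \<Longrightarrow> f (gact ?X h x) = gact Y h (f x)"
    using ex_symbol[OF is_group finitary_action_ghat_set[OF assms]] by metis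
  have eq: "f (\<phi> h x) = gact Y h (f x)" if "h \<in> U" "x \<in> E" for h x using Y(4)[of h x] that by simp
  note A = smooth_actionD[OF finitary_actionD(1)[OF assms]]
  have "represents Y E \<phi>"
    by (rule representsI[of Y f E U]) (use Y A(1,2) eq in auto)
  then show ?thesis using that[of Y f] Y eq by simp
qed

lemma ghat_isoI:
  assumes f: "bij_betw f E (gset X)" and g: "bij_betw g E (gset Y)"
    and W: "open_sub W" "W \<subseteq> gdom X" "W \<subseteq> gdom Y"
    and E: "\<And>h x. h \<in> W \<Longrightarrow> x \<in> E \<Longrightarrow> \<phi> h x \<in> E"
    and fe: "\<And>h x. h \<in> W \<Longrightarrow> x \<in> E \<Longrightarrow> f (\<phi> h x) = gact X h (f x)"
    and ge: "\<And>h x. h \<in> W \<Longrightarrow> x \<in> E \<Longrightarrow> g (\<phi> h x) = gact Y h (g x)"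
  shows "ghat_iso G T X Y"
proof -
  let ?k = "g \<circ> inv_into E f"
  have bij: "bij_betw ?k (gset X) (gset Y)"
    using bij_betw_trans[OF bij_betw_inv_into[OF f] g] .
  have kf: "?k (f x) = g x" if "x \<in> E" for x
    using that f by (simp add: bij_betw_def)
  have "?k (gact X h y) = gact Y h (?k y)" if hy: "h \<in> W" "y \<in> gset X" for h y
  proof -
    obtain x where x: "x \<in> E" "y = f x" using f hy(2) by (auto simp: bij_betw_def)
    then have "?k (gact X h y) = ?k (f (\<phi> h x))" using fe hy by simp
    then show ?thesis using kf[of x] kf[of "\<phi> h x"] E ge hy x by simp
  qed
  then have "ghat_map G T X Y ?k"
    unfolding ghat_map_def using W bij by (auto simp: bij_betw_def)
  then show ?thesis unfolding ghat_iso_def using bij by blast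
qed

definition cls :: "'x set \<Rightarrow> ('a \<Rightarrow> 'x \<Rightarrow> 'x) \<Rightarrow> 'a theta_poly" where
  "cls E \<phi> = poly_var (SOME Y. represents Y E \<phi>)"

lemma represents_iso:
  assumes "represents Y E \<phi>" "represents Y' E' \<phi>'" "bij_betw f E E'" "open_sub W"
    and eq: "\<And>h x. h \<in> W \<Longrightarrow> x \<in> E \<Longrightarrow> f (\<phi> h x) = \<phi>' h (f x)"
  shows "poly_var Y \<doteq> poly_var Y'"
proof -
  obtain f1 W1 where 1: "Y \<in> Theta_symbols G T" "bij_betw f1 E (gset Y)" "open_sub W1" "W1 \<subseteq> gdom Y"
    "\<And>h x. h \<in> W1 \<Longrightarrow> x \<in> E \<Longrightarrow> \<phi> h x \<in> E"
    "\<And>h x. h \<in> W1 \<Longrightarrow> x \<in> E \<Longrightarrow> f1 (\<phi> h x) = gact Y h (f1 x)"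
    using representsE[OF assms(1)] by metis
  obtain f2 W2 where 2: "Y' \<in> Theta_symbols G T" "bij_betw f2 E' (gset Y')" "open_sub W2" "W2 \<subseteq> gdom Y'"
    "\<And>h x. h \<in> W2 \<Longrightarrow> x \<in> E' \<Longrightarrow> \<phi>' h x \<in> E'"
    "\<And>h x. h \<in> W2 \<Longrightarrow> x \<in> E' \<Longrightarrow> f2 (\<phi>' h x) = gact Y' h (f2 x)"
    using representsE[OF assms(2)] by metis
  have "ghat_iso G T Y Y'"
  proof (rule ghat_isoI[OF 1(2) bij_betw_trans[OF assms(3) 2(2)]])
    show "open_sub (W \<inter> W1 \<inter> W2)" using assms(4) 1(3) 2(3) by (intro open_sub_Int)
    fix h x assume h: "h \<in> W \<inter> W1 \<inter> W2" "x \<in> E"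
    then have "f x \<in> E'" using assms(3) by (auto simp: bij_betw_def)
    then show "(f2 \<circ> f) (\<phi> h x) = gact Y' h ((f2 \<circ> f) x)" using h eq 2(6) by simp
  qed (use 1 2 in auto)
  then show ?thesis using theta_cong_relation Theta_relations.iso 1(1) 2(1) by blast
qed

lemma cls_represents:
  assumes "represents Y E \<phi>"
  shows "cls E \<phi> \<doteq> poly_var Y"
proof -
  have "represents (SOME Y. represents Y E \<phi>) E \<phi>" using someI[of "\<lambda>Y. represents Y E \<phi>"] assms .
  then show ?thesis unfolding cls_def
    by (rule represents_iso[OF _ assms bij_betw_id open_sub_carrier]) simp
qed

lemma cls_symbol:
  assumes "X \<in> Theta_symbols G T"
  shows "cls (gset X) (gact X) \<doteq> poly_var X"
proof (rule cls_represents)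
  have "finitary_action (gdom X) (gset X) (gact X)"
    using ghat_set_finitary_action assms by (simp add: Theta_symbols_def)
  note A = smooth_actionD[OF finitary_actionD(1)[OF this]]
  show "represents X (gset X) (gact X)"
    by (rule representsI[OF assms bij_betw_id A(1) order_refl A(2)]) auto
qed

lemma cls_iso:
  assumes "finitary_action U E \<phi>" "finitary_action U' E' \<phi>'" "bij_betw f E E'" "open_sub W"
    and "\<And>h x. h \<in> W \<Longrightarrow> x \<in> E \<Longrightarrow> f (\<phi> h x) = \<phi>' h (f x)"
  shows "cls E \<phi> \<doteq> cls E' \<phi>'"
proof -
  obtain Y where Y: "represents Y E \<phi>" by (rule finitary_action_symbol[OF assms(1)])
  obtain Y' where Y': "represents Y' E' \<phi>'" by (rule finitary_action_symbol[OF assms(2)])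
  have "poly_var Y \<doteq> poly_var Y'" by (rule represents_iso[OF Y Y' assms(3,4)]) (rule assms(5))
  then show ?thesis
    by (rule theta_cong_trans[OF cls_represents[OF Y] theta_cong_trans[OF _
          theta_cong_sym[OF cls_represents[OF Y']]]])
qed

text \<open>
  The bijection twists the action by conjugation with \<open>g\<close>. The main example is translation by \<open>g\<close>
  from one fiber of an equivariant map to another.
\<close>

lemma cls_conj:
  assumes "finitary_action U E \<phi>" "finitary_action U' E' \<phi>'" "g \<in> carrier G"
    "bij_betw f E E'" "open_sub W"
    and eq: "\<And>h x. h \<in> W \<Longrightarrow> x \<in> E \<Longrightarrow> f (\<phi> h x) = \<phi>' (g \<otimes> h \<otimes> inv g) (f x)"
  shows "cls E \<phi> \<doteq> cls E' \<phi>'"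
proof -
  obtain Y f1 where Y: "Y \<in> Theta_symbols G T" "gdom Y = U" "bij_betw f1 E (gset Y)"
    "\<And>h x. h \<in> U \<Longrightarrow> x \<in> E \<Longrightarrow> f1 (\<phi> h x) = gact Y h (f1 x)" "represents Y E \<phi>"
    using finitary_action_symbol[OF assms(1)] by metis
  obtain Y' f2 where Y': "Y' \<in> Theta_symbols G T" "gdom Y' = U'" "bij_betw f2 E' (gset Y')"
    "\<And>h x. h \<in> U' \<Longrightarrow> x \<in> E' \<Longrightarrow> f2 (\<phi>' h x) = gact Y' h (f2 x)" "represents Y' E' \<phi>'"
    using finitary_action_symbol[OF assms(2)] by metis
  note A = smooth_actionD[OF finitary_actionD(1)[OF assms(1)]]
  note A' = smooth_actionD[OF finitary_actionD(1)[OF assms(2)]]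
  let ?Z = "ghat_conj G g Y" and ?c = "\<lambda>u. g \<otimes> u \<otimes> inv g" and ?d = "\<lambda>h. inv g \<otimes> h \<otimes> g"
  have Z: "?Z \<in> Theta_symbols G T"
    using finitary_ghat_conj[OF _ assms(3)] Y(1) by (simp add: Theta_symbols_def)
  have "ghat_iso G T ?Z Y'"
  proof (rule ghat_isoI[where E = E and \<phi> = "\<lambda>h. \<phi> (?d h)" and W = "?c ` (W \<inter> U) \<inter> U'"])
    show "bij_betw f1 E (gset ?Z)" using Y(3) by (simp add: ghat_conj_def)
    show "bij_betw (f2 \<circ> f) E (gset Y')" using bij_betw_trans[OF assms(4) Y'(3)] .
    show "open_sub (?c ` (W \<inter> U) \<inter> U')"
      by (intro open_sub_Int open_sub_conj assms(3,5) A(1) A'(1))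
    show "?c ` (W \<inter> U) \<inter> U' \<subseteq> gdom ?Z" using Y(2) by (auto simp: ghat_conj_def)
    show "?c ` (W \<inter> U) \<inter> U' \<subseteq> gdom Y'" using Y'(2) by auto
    fix h x assume h: "h \<in> ?c ` (W \<inter> U) \<inter> U'" "x \<in> E"
    then obtain u where u: "u \<in> W" "u \<in> U" "h = ?c u" by blast
    have du: "?d h = u" using u conj_cancel[OF assms(3)] open_subD(4)[OF A(1)] by simp
    show "\<phi> (?d h) x \<in> E" using A(2) u h du by simp
    show "f1 (\<phi> (?d h) x) = gact ?Z h (f1 x)" using Y(4) u h du by (simp add: ghat_conj_def)
    have fx: "f x \<in> E'" using assms(4) h by (auto simp: bij_betw_def)
    then show "(f2 \<circ> f) (\<phi> (?d h) x) = gact Y' h ((f2 \<circ> f) x)"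
      using Y'(4)[of h "f x"] eq[of u x] u h du by simp
  qed
  then have "poly_var ?Z \<doteq> poly_var Y'"
    using theta_cong_relation Theta_relations.iso Z Y'(1) by blast
  moreover have "poly_var Y \<doteq> poly_var ?Z"
    using theta_cong_relation Theta_relations.conj[OF Y(1) assms(3)] by blast
  ultimately have "poly_var Y \<doteq> poly_var Y'" using theta_cong_trans by blast
  then show ?thesis
    by (rule theta_cong_trans[OF cls_represents[OF Y(5)] theta_cong_trans[OF _
          theta_cong_sym[OF cls_represents[OF Y'(5)]]]])
qed

lemma cls_Un:
  assumes "finitary_action U E1 \<phi>" "finitary_action U E2 \<phi>" "E1 \<inter> E2 = {}"
  shows "cls (E1 \<union> E2) \<phi> \<doteq> cls E1 \<phi> + cls E2 \<phi>"
proof -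
  obtain Y1 f1 where Y1: "Y1 \<in> Theta_symbols G T" "gdom Y1 = U" "bij_betw f1 E1 (gset Y1)"
    "\<And>h x. h \<in> U \<Longrightarrow> x \<in> E1 \<Longrightarrow> f1 (\<phi> h x) = gact Y1 h (f1 x)" "represents Y1 E1 \<phi>"
    using finitary_action_symbol[OF assms(1)] by metis
  obtain Y2 f2 where Y2: "Y2 \<in> Theta_symbols G T" "gdom Y2 = U" "bij_betw f2 E2 (gset Y2)"
    "\<And>h x. h \<in> U \<Longrightarrow> x \<in> E2 \<Longrightarrow> f2 (\<phi> h x) = gact Y2 h (f2 x)" "represents Y2 E2 \<phi>"
    using finitary_action_symbol[OF assms(2)] by metis
  obtain Y f where Y: "Y \<in> Theta_symbols G T" "gdom Y = U" "bij_betw f (E1 \<union> E2) (gset Y)"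
    "\<And>h x. h \<in> U \<Longrightarrow> x \<in> E1 \<union> E2 \<Longrightarrow> f (\<phi> h x) = gact Y h (f x)" "represents Y (E1 \<union> E2) \<phi>"
    using finitary_action_symbol[OF finitary_action_Un[OF assms(1,2)]] by metis
  note A1 = smooth_actionD[OF finitary_actionD(1)[OF assms(1)]]
  note A2 = smooth_actionD[OF finitary_actionD(1)[OF assms(2)]]
  let ?k = "\<lambda>x. if x \<in> E1 then Inl (f1 x) else Inr (f2 x)"
  have "ghat_iso G T Y (ghat_coprod Y1 Y2)"
  proof (rule ghat_isoI[OF Y(3), where g = ?k and W = U and \<phi> = \<phi>])
    have "bij_betw ?k E1 (Inl ` gset Y1)"
      using Y1(3) by (auto simp: bij_betw_def inj_on_def)
    moreover have "bij_betw ?k E2 (Inr ` gset Y2)"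
    proof (rule bij_betw_cong[THEN iffD1])
      show "bij_betw (\<lambda>x. Inr (f2 x)) E2 (Inr ` gset Y2)"
        using Y2(3) by (auto simp: bij_betw_def inj_on_def)
    qed (use assms(3) in auto)
    ultimately have "bij_betw ?k (E1 \<union> E2) (Inl ` gset Y1 \<union> Inr ` gset Y2)"
      by (rule bij_betw_combine) auto
    then show "bij_betw ?k (E1 \<union> E2) (gset (ghat_coprod Y1 Y2))"
      by (simp add: ghat_coprod_def Plus_def)
    show "open_sub U" "U \<subseteq> gdom Y" "U \<subseteq> gdom (ghat_coprod Y1 Y2)"
      using A1(1) Y(2) Y1(2) Y2(2) by (simp_all add: ghat_coprod_def)
    fix h x assume h: "h \<in> U" "x \<in> E1 \<union> E2"
    then show "\<phi> h x \<in> E1 \<union> E2" using A1(2) A2(2) by blast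
    show "f (\<phi> h x) = gact Y h (f x)" using Y(4) h by simp
    show "?k (\<phi> h x) = gact (ghat_coprod Y1 Y2) h (?k x)"
    proof (cases "x \<in> E1")
      case True
      then have "f1 x \<in> gset Y1" using Y1(3) by (auto simp: bij_betw_def)
      then show ?thesis using True A1(2) Y1(4) h by (auto simp: ghat_coprod_def)
    next
      case False
      then have "x \<in> E2" using h by simp
      then have "f2 x \<in> gset Y2" "\<phi> h x \<notin> E1" using Y2(3) A2(2)[OF h(1)] assms(3) by (auto simp: bij_betw_def)
      then show ?thesis using False \<open>x \<in> E2\<close> Y2(4) h by (auto simp: ghat_coprod_def)
    qed
  qed
  then have "poly_var Y \<doteq> poly_var Y1 + poly_var Y2"
    using theta_cong_relation Theta_relations.coprod[OF Y1(1) Y2(1) Y(1)] by blast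
  also have "\<dots> \<doteq> cls E1 \<phi> + cls E2 \<phi>"
    by (intro theta_cong_add theta_cong_sym[OF cls_represents] Y1 Y2)
  finally show ?thesis using cls_represents[OF Y(5)] theta_cong_trans by blast
qed

text \<open>
  The empty set is the disjoint union of two copies of itself.
\<close>

lemma cls_empty: "cls {} \<phi> \<doteq> 0"
proof -
  have "finitary_action (carrier G) {} \<phi>"
    by (rule finitary_action_trivial[OF open_sub_carrier]) auto
  from cls_Un[OF this this] have "cls {} \<phi> \<doteq> cls {} \<phi> + cls {} \<phi>" by simp
  from theta_cong_diff[OF this theta_cong_refl[of "cls {} \<phi>"]] show ?thesis
    by (simp add: theta_cong_sym)
qed

lemma cls_singleton:
  assumes "finitary_action U {x} \<phi>"
  shows "cls {x} \<phi> \<doteq> 1"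
proof -
  obtain Y f where Y: "Y \<in> Theta_symbols G T" "bij_betw f {x} (gset Y)" "represents Y {x} \<phi>"
    using finitary_action_symbol[OF assms] by metis
  have "gset Y = {f x}" using Y(2) by (auto simp: bij_betw_def)
  then have "poly_var Y \<doteq> 1" using theta_cong_relation Theta_relations.singleton[OF Y(1)] by blast
  then show ?thesis using cls_represents[OF Y(3)] theta_cong_trans by blast
qed

lemma cls_finite:
  assumes "finitary_action U E \<phi>" "finite E"
  shows "cls E \<phi> \<doteq> of_nat (card E)"
proof -
  obtain V where V: "open_sub V" "V \<subseteq> U" "\<forall>h\<in>V. \<forall>x\<in>E. \<phi> h x = x"
    using open_sub_pointwise_stabilizer[OF finitary_actionD(1)[OF assms(1)] assms(2) order_refl] by blast
  have fin: "finitary_action V F \<phi>" if "F \<subseteq> E" for F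
    by (rule finitary_action_trivial[OF V(1)]) (use V(3) that assms(2) finite_subset in auto)
  have "F \<subseteq> E \<Longrightarrow> cls F \<phi> \<doteq> of_nat (card F)" if "finite F" for F
    using that
  proof (induction F)
    case empty
    then show ?case using cls_empty by simp
  next
    case (insert x F)
    have "cls ({x} \<union> F) \<phi> \<doteq> cls {x} \<phi> + cls F \<phi>"
      by (rule cls_Un[of V]) (use insert fin in auto)
    also have "\<dots> \<doteq> 1 + of_nat (card F)"
      by (rule theta_cong_add[OF cls_singleton[of V] insert.IH]) (use insert fin in auto)
    finally show ?case using insert by simp
  qed
  then show ?thesis using assms(2) by simp
qed

section \<open>Fibrations\<close>

text \<open>
  The defining relation for transitive maps, carried over from symbols to arbitrary actions.
\<close>

lemma cls_fiber_transitive: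
  assumes E: "finitary_action U E \<phi>" and B: "finitary_action U B \<psi>"
    and orb: "E = (\<lambda>h. \<phi> h a) ` U" "B = (\<lambda>h. \<psi> h b) ` U" "a \<in> E" "b \<in> B"
    and f: "f \<in> E \<rightarrow> B" "\<And>h x. h \<in> U \<Longrightarrow> x \<in> E \<Longrightarrow> f (\<phi> h x) = \<psi> h (f x)"
  shows "cls E \<phi> \<doteq> cls {x \<in> E. f x = b} \<phi> * cls B \<psi>"
proof -
  obtain X e where X: "X \<in> Theta_symbols G T" "gdom X = U" "bij_betw e E (gset X)"
    "\<And>h x. h \<in> U \<Longrightarrow> x \<in> E \<Longrightarrow> e (\<phi> h x) = gact X h (e x)" "represents X E \<phi>"
    using finitary_action_symbol[OF E] by metis
  obtain Y d where Y: "Y \<in> Theta_symbols G T" "gdom Y = U" "bij_betw d B (gset Y)"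
    "\<And>h x. h \<in> U \<Longrightarrow> x \<in> B \<Longrightarrow> d (\<psi> h x) = gact Y h (d x)" "represents Y B \<psi>"
    using finitary_action_symbol[OF B] by metis
  note SE = finitary_actionD(1)[OF E] and SB = finitary_actionD(1)[OF B]
  note AE = smooth_actionD[OF SE] and AB = smooth_actionD[OF SB] and U = open_subD[OF smooth_actionD(1)[OF SE]]
  have trans: "transitive_action (ghat_grp G Z) (gset Z) (gact Z)"
    if Z: "Z \<in> Theta_symbols G T" "gdom Z = U" "bij_betw k C (gset Z)"
      "\<And>h x. h \<in> U \<Longrightarrow> x \<in> C \<Longrightarrow> k (\<rho> h x) = gact Z h (k x)"
      and C: "smooth_action U C \<rho>" "C = (\<lambda>h. \<rho> h c) ` U" "c \<in> C"
    for Z :: "('a, nat \<times> 'a set) ghat_set" and k and C :: "'z set" and \<rho> c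
  proof -
    have "group_action (ghat_grp G Z) (gset Z) (gact Z)"
      using Z(1) by (simp add: Theta_symbols_def finitary_ghat_set_def is_ghat_set_def)
    moreover have "\<exists>g\<in>carrier (ghat_grp G Z). gact Z g x = y" if xy: "x \<in> gset Z" "y \<in> gset Z" for x y
    proof -
      note AC = smooth_actionD[OF C(1)]
      have "gset Z = k ` (\<lambda>h. \<rho> h c) ` U" using Z(3) C(2) by (simp add: bij_betw_def)
      then obtain u v where u: "u \<in> U" "x = k (\<rho> u c)" and v: "v \<in> U" "y = k (\<rho> v c)"
        using xy by blast
      have vu: "v \<otimes> inv u \<in> U" using U(5,6) u(1) v(1) by blast
      have uc: "\<rho> u c \<in> C" using AC(2) u(1) C(3) by blast
      have "\<rho> (v \<otimes> inv u) (\<rho> u c) = \<rho> v (\<rho> (inv u) (\<rho> u c))"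
        by (rule AC(4)[OF v(1) U(5)[OF u(1)] uc])
      also have "\<dots> = \<rho> v c" using smooth_action_inv(1)[OF C(1) u(1) C(3)] by simp
      finally have "gact Z (v \<otimes> inv u) x = y"
        using Z(4)[OF vu uc] u(2) v(2) by simp
      then show ?thesis using Z(2) vu by (intro bexI[of _ "v \<otimes> inv u"]) auto
    qed
    ultimately show ?thesis by (simp add: transitive_action_def transitive_action_axioms_def)
  qed
  let ?f = "d \<circ> f \<circ> inv_into E e"
  have fe: "?f (e x) = d (f x)" if "x \<in> E" for x using that X(3) by (simp add: bij_betw_def)
  have dB: "d x \<in> gset Y" if "x \<in> B" for x using that Y(3) by (auto simp: bij_betw_def)
  have eE: "\<exists>x\<in>E. y = e x" if "y \<in> gset X" for y using that X(3) by (auto simp: bij_betw_def)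
  have tm: "transitive_map G X Y ?f"
    unfolding transitive_map_def
  proof (intro conjI ballI)
    show "gdom X = gdom Y" using X Y by simp
    show "transitive_action (ghat_grp G X) (gset X) (gact X)"
      by (rule trans[OF X(1-4) SE orb(1,3)])
    show "transitive_action (ghat_grp G Y) (gset Y) (gact Y)"
      by (rule trans[OF Y(1-4) SB orb(2,4)])
    show "gset X \<noteq> {}" "gset Y \<noteq> {}" using X(3) Y(3) orb by (auto simp: bij_betw_def)
    show "?f \<in> gset X \<rightarrow> gset Y"
    proof
      fix y assume "y \<in> gset X"
      then obtain x where "x \<in> E" "y = e x" using eE by blast
      then show "?f y \<in> gset Y" using fe[of x] dB f(1) by (simp add: Pi_iff)
    qed
    fix h y assume h: "h \<in> gdom X" "y \<in> gset X"
    then obtain x where x: "x \<in> E" "y = e x" using eE by blast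
    then have "gact X h y = e (\<phi> h x)" using X(2,4) h by simp
    then have "?f (gact X h y) = d (f (\<phi> h x))" using fe AE(2) h X(2) x by simp
    also have "\<dots> = gact Y h (d (f x))" using f Y(4) h x X(2) by (simp add: Pi_iff)
    also have "\<dots> = gact Y h (?f y)" using fe x by simp
    finally show "?f (gact X h y) = gact Y h (?f y)" .
  qed
  have db: "d b \<in> gset Y" using dB orb by blast
  let ?F = "ghat_fiber G X Y ?f (d b)"
  have "is_ghat_set G T X" "is_ghat_set G T Y"
    using X(1) Y(1) by (auto simp: Theta_symbols_def finitary_ghat_set_def)
  then have FS: "?F \<in> Theta_symbols G T"
    using finitary_ghat_fiber[OF is_group _ _ tm db] by (simp add: Theta_symbols_def)
  have dinj: "d x = d b \<longleftrightarrow> x = b" if "x \<in> B" for x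
    using inj_on_eq_iff[OF bij_betw_imp_inj_on[OF Y(3)] that orb(4)] .
  have "represents ?F {x \<in> E. f x = b} \<phi>"
  proof (rule representsI[OF FS, where f = e and W = "{h \<in> U. \<psi> h b = b}"])
    have fib: "{y \<in> gset X. ?f y = d b} = e ` {x \<in> E. f x = b}"
    proof (intro equalityI subsetI)
      fix y assume y: "y \<in> {y \<in> gset X. ?f y = d b}"
      then obtain x where "x \<in> E" "y = e x" using eE by blast
      then show "y \<in> e ` {x \<in> E. f x = b}" using y fe dinj f(1) by (auto simp: Pi_iff)
    next
      fix y assume "y \<in> e ` {x \<in> E. f x = b}"
      then show "y \<in> {y \<in> gset X. ?f y = d b}" using fe X(3) by (auto simp: bij_betw_def)
    qed
    show "bij_betw e {x \<in> E. f x = b} (gset ?F)"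
      using bij_betw_subset[OF X(3), of "{x \<in> E. f x = b}" "e ` {x \<in> E. f x = b}"] fib
      by (simp add: ghat_fiber_def)
    show "open_sub {h \<in> U. \<psi> h b = b}" using open_sub_stabilizer[OF SB orb(4)] .
    show "{h \<in> U. \<psi> h b = b} \<subseteq> gdom ?F"
    proof
      fix h assume "h \<in> {h \<in> U. \<psi> h b = b}"
      then have "h \<in> U" "gact Y h (d b) = d b" using Y(4)[of h b] orb(4) by auto
      then show "h \<in> gdom ?F" using Y(2) by (simp add: ghat_fiber_def stabilizer_def)
    qed
    fix h x assume h: "h \<in> {h \<in> U. \<psi> h b = b}" "x \<in> {x \<in> E. f x = b}"
    then show "\<phi> h x \<in> {x \<in> E. f x = b}" using AE(2) f(2) by auto
    have "e x \<in> {y \<in> gset X. ?f y = d b}" using fib h by blast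
    then show "e (\<phi> h x) = gact ?F h (e x)" using X(4) h by (simp add: ghat_fiber_def)
  qed
  then have F: "cls {x \<in> E. f x = b} \<phi> \<doteq> poly_var ?F" by (rule cls_represents)
  have "cls E \<phi> \<doteq> poly_var X" by (rule cls_represents[OF X(5)])
  also have "poly_var X \<doteq> poly_var ?F * poly_var Y"
    using theta_cong_relation Theta_relations.fiber[OF X(1) Y(1) tm db] by blast
  also have "\<dots> \<doteq> cls {x \<in> E. f x = b} \<phi> * cls B \<psi>"
    by (intro theta_cong_mult theta_cong_sym[OF F] theta_cong_sym[OF cls_represents[OF Y(5)]])
  finally show ?thesis .
qed

lemma finitary_action_orbit:
  assumes "finitary_action U E \<phi>" "a \<in> E"
  shows "finitary_action U ((\<lambda>h. \<phi> h a) ` U) \<phi>" "a \<in> (\<lambda>h. \<phi> h a) ` U"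
proof -
  note S = finitary_actionD(1)[OF assms(1)]
  note A = smooth_actionD[OF S] and U = open_subD[OF smooth_actionD(1)[OF S]]
  show "finitary_action U ((\<lambda>h. \<phi> h a) ` U) \<phi>"
  proof (rule finitary_action_sub[OF assms(1)])
    show "(\<lambda>h. \<phi> h a) ` U \<subseteq> E" using A(2) assms(2) by blast
    fix h x assume h: "h \<in> U" "x \<in> (\<lambda>h. \<phi> h a) ` U"
    then obtain k where "k \<in> U" "x = \<phi> k a" by blast
    then have "\<phi> h x = \<phi> (h \<otimes> k) a" "h \<otimes> k \<in> U" using A(4) U(6) h(1) assms(2) by auto
    then show "\<phi> h x \<in> (\<lambda>h. \<phi> h a) ` U" by blast
  qed
  show "a \<in> (\<lambda>h. \<phi> h a) ` U" using A(3)[OF assms(2)] U(3) by (metis image_eqI)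
qed

text \<open>
  A finitary set is built from the empty set by adding one orbit at a time.
\<close>

lemma finitary_action_induct [consumes 1, case_names empty orbit]:
  assumes "finitary_action U E \<phi>"
    and "P {}"
    and step: "\<And>D a. finitary_action U D \<phi> \<Longrightarrow> D \<subseteq> E \<Longrightarrow> a \<in> E \<Longrightarrow>
      D \<inter> (\<lambda>h. \<phi> h a) ` U = {} \<Longrightarrow> P D \<Longrightarrow> P (D \<union> (\<lambda>h. \<phi> h a) ` U)"
  shows "P E"
proof -
  note S = finitary_actionD(1)[OF assms(1)]
  note A = smooth_actionD[OF S] and U = open_subD[OF smooth_actionD(1)[OF S]]
  obtain F where F: "finite F" "F \<subseteq> E" "\<forall>x\<in>E. \<exists>h\<in>U. \<exists>y\<in>F. x = \<phi> h y"
    using finitary_actionD(2)[OF assms(1)] by blast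
  let ?orb = "\<lambda>a. (\<lambda>h. \<phi> h a) ` U"
  have "finitary_action U (\<Union>(?orb ` C)) \<phi> \<and> P (\<Union>(?orb ` C))" if "finite C" "C \<subseteq> E" for C
    using that
  proof (induction C)
    case empty
    have "finitary_action U {} \<phi>" by (rule finitary_action_sub[OF assms(1)]) auto
    then show ?case using assms(2) by simp
  next
    case (insert a C)
    define D where "D = \<Union>(?orb ` C)"
    have D: "finitary_action U D \<phi>" "P D" and a: "a \<in> E" using insert by (auto simp: D_def)
    note AD = smooth_actionD[OF finitary_actionD(1)[OF D(1)]]
    note oa = finitary_action_orbit[OF assms(1) a]
    have DE: "D \<subseteq> E" using insert.prems A(2) unfolding D_def by blast
    have fin: "finitary_action U (D \<union> ?orb a) \<phi>" using finitary_action_Un[OF D(1) oa(1)] .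
    have "P (D \<union> ?orb a)"
    proof (cases "a \<in> D")
      case True
      then have "?orb a \<subseteq> D" using AD(2) by blast
      then have "D \<union> ?orb a = D" by blast
      then show ?thesis using D(2) by simp
    next
      case False
      have "D \<inter> ?orb a = {}"
      proof (rule ccontr)
        assume "D \<inter> ?orb a \<noteq> {}"
        then obtain h where h: "h \<in> U" "\<phi> h a \<in> D" by blast
        then have "\<phi> (inv h) (\<phi> h a) \<in> D" using AD(2) U(5) by blast
        then show False using False smooth_action_inv(1)[OF S h(1) a] by simp
      qed
      then show ?thesis using step[OF D(1) DE a _ D(2)] by blast
    qed
    moreover have "\<Union>(?orb ` insert a C) = D \<union> ?orb a" unfolding D_def by blast
    ultimately show ?case using fin by simp
  qed
  then have "P (\<Union>(?orb ` F))" using F by blast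
  moreover have "\<Union>(?orb ` F) = E"
  proof
    show "\<Union>(?orb ` F) \<subseteq> E" using F A(2) by blast
    show "E \<subseteq> \<Union>(?orb ` F)" using F(3) by blast
  qed
  ultimately show ?thesis by simp
qed

text \<open>
  Every orbit of the source maps onto the single orbit \<open>B\<close>, so the transitive case applies to each of
  them with the same factor \<open>cls B \<psi>\<close>.
\<close>

lemma cls_fiber_over_orbit:
  assumes "finitary_action U E \<phi>" "finitary_action U B \<psi>" "B = (\<lambda>h. \<psi> h b) ` U" "b \<in> B"
    and f: "f \<in> E \<rightarrow> B" "\<And>h x. h \<in> U \<Longrightarrow> x \<in> E \<Longrightarrow> f (\<phi> h x) = \<psi> h (f x)"
  shows "cls E \<phi> \<doteq> cls {x \<in> E. f x = b} \<phi> * cls B \<psi>"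
  using assms(1)
proof (induction rule: finitary_action_induct)
  case empty
  have "cls {} \<phi> * cls B \<psi> \<doteq> 0 * cls B \<psi>" by (intro theta_cong_mult cls_empty theta_cong_refl)
  then have "0 \<doteq> cls {} \<phi> * cls B \<psi>" by (simp add: theta_cong_sym)
  then show ?case using theta_cong_trans[OF cls_empty[of \<phi>]] by simp
next
  case (orbit D a)
  note SB = finitary_actionD(1)[OF assms(2)]
  let ?O = "(\<lambda>h. \<phi> h a) ` U" and ?V = "{h \<in> U. \<psi> h b = b}"
  note O = finitary_action_orbit[OF assms(1) orbit(3)]
  have OE: "?O \<subseteq> E" using smooth_actionD(2)[OF finitary_actionD(1)[OF assms(1)]] orbit(3) by blast
  have fD: "f \<in> D \<rightarrow> B" and fO: "f \<in> ?O \<rightarrow> B" using f(1) orbit(2) OE by blast+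
  have D: "finitary_action ?V {x \<in> D. f x = b} \<phi>"
    by (rule finitary_action_fiber[OF orbit(1) assms(4) SB fD]) (use f(2) orbit(2) in blast)
  have O': "finitary_action ?V {x \<in> ?O. f x = b} \<phi>"
    by (rule finitary_action_fiber[OF O(1) assms(4) SB fO]) (use f(2) OE in blast)
  have "cls (D \<union> ?O) \<phi> \<doteq> cls D \<phi> + cls ?O \<phi>"
    by (rule cls_Un[OF orbit(1) O(1) orbit(4)])
  also have "\<dots> \<doteq> cls {x \<in> D. f x = b} \<phi> * cls B \<psi> + cls {x \<in> ?O. f x = b} \<phi> * cls B \<psi>"
    by (intro theta_cong_add orbit(5)
        cls_fiber_transitive[OF O(1) assms(2) refl assms(3) O(2) assms(4) fO])
      (use f(2) OE in blast)
  also have "\<dots> = (cls {x \<in> D. f x = b} \<phi> + cls {x \<in> ?O. f x = b} \<phi>) * cls B \<psi>"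
    by (simp add: algebra_simps)
  also have "\<dots> \<doteq> cls ({x \<in> D. f x = b} \<union> {x \<in> ?O. f x = b}) \<phi> * cls B \<psi>"
    using orbit(4) by (intro theta_cong_mult theta_cong_refl theta_cong_sym[OF cls_Un[OF D O']]) blast
  also have "{x \<in> D. f x = b} \<union> {x \<in> ?O. f x = b} = {x \<in> D \<union> ?O. f x = b}" by blast
  finally show ?case .
qed

text \<open>
  Cutting \<open>B\<close> into orbits reduces the statement to a transitive base.
\<close>

lemma cls_constant_fiber:
  assumes E: "finitary_action U E \<phi>" and B: "finitary_action U B \<psi>"
    and f: "f \<in> E \<rightarrow> B" "\<And>h x. h \<in> U \<Longrightarrow> x \<in> E \<Longrightarrow> f (\<phi> h x) = \<psi> h (f x)"
    and fib: "\<And>b. b \<in> B \<Longrightarrow> cls {x \<in> E. f x = b} \<phi> \<doteq> c"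
  shows "cls E \<phi> \<doteq> c * cls B \<psi>"
proof -
  have "cls {x \<in> E. f x \<in> B} \<phi> \<doteq> c * cls B \<psi>"
    using B
  proof (induction rule: finitary_action_induct)
    case empty
    have "c * cls {} \<psi> \<doteq> c * 0" by (intro theta_cong_mult cls_empty theta_cong_refl)
    then have "0 \<doteq> c * cls {} \<psi>" by (simp add: theta_cong_sym)
    then show ?case using theta_cong_trans[OF cls_empty[of \<phi>]] by simp
  next
    case (orbit D b)
    let ?O = "(\<lambda>h. \<psi> h b) ` U"
    note O = finitary_action_orbit[OF B orbit(3)]
    have pre: "finitary_action U {x \<in> E. f x \<in> C} \<phi>" if "finitary_action U C \<psi>" for C
      by (rule finitary_action_sub[OF E])
        (use f(2) smooth_actionD(2)[OF finitary_actionD(1)[OF E]]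
           smooth_actionD(2)[OF finitary_actionD(1)[OF that]] in auto)
    note preD = pre[OF orbit(1)] and preO = pre[OF O(1)]
    have "{x \<in> E. f x \<in> D \<union> ?O} = {x \<in> E. f x \<in> D} \<union> {x \<in> E. f x \<in> ?O}" by blast
    then have "cls {x \<in> E. f x \<in> D \<union> ?O} \<phi> \<doteq> cls {x \<in> E. f x \<in> D} \<phi> + cls {x \<in> E. f x \<in> ?O} \<phi>"
      using cls_Un[OF preD preO] orbit(4) by auto
    also have "\<dots> \<doteq> c * cls D \<psi> + cls {x \<in> {x \<in> E. f x \<in> ?O}. f x = b} \<phi> * cls ?O \<psi>"
      by (intro theta_cong_add orbit(5) cls_fiber_over_orbit[OF preO O(1) refl O(2)])
        (use f(2) in auto)
    also have "{x \<in> {x \<in> E. f x \<in> ?O}. f x = b} = {x \<in> E. f x = b}" using O(2) by blast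
    also have "c * cls D \<psi> + cls {x \<in> E. f x = b} \<phi> * cls ?O \<psi> \<doteq> c * cls D \<psi> + c * cls ?O \<psi>"
      by (intro theta_cong_add theta_cong_mult theta_cong_refl fib[OF orbit(3)])
    also have "\<dots> = c * (cls D \<psi> + cls ?O \<psi>)" by (simp add: algebra_simps)
    also have "\<dots> \<doteq> c * cls (D \<union> ?O) \<psi>"
      by (intro theta_cong_mult theta_cong_refl theta_cong_sym[OF cls_Un[OF orbit(1) O(1) orbit(4)]])
    finally show ?case .
  qed
  moreover have "{x \<in> E. f x \<in> B} = E" using f(1) by auto
  ultimately show ?thesis by simp
qed

lemma cls_prod:
  assumes "finitary_action U E \<phi>" "finitary_action U B \<psi>"
  shows "cls (E \<times> B) (\<lambda>h. map_prod (\<phi> h) (\<psi> h)) \<doteq> cls E \<phi> * cls B \<psi>"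
proof (rule cls_constant_fiber[where f = snd and U = U and \<psi> = \<psi>])
  fix b assume b: "b \<in> B"
  note SB = finitary_actionD(1)[OF assms(2)]
  have fin: "finitary_action {h \<in> U. \<psi> h b = b} {x \<in> E \<times> B. snd x = b} (\<lambda>h. map_prod (\<phi> h) (\<psi> h))"
    by (rule finitary_action_fiber[where f = snd, OF finitary_action_prod[OF assms] b SB]) auto
  show "cls {x \<in> E \<times> B. snd x = b} (\<lambda>h. map_prod (\<phi> h) (\<psi> h)) \<doteq> cls E \<phi>"
    by (rule cls_iso[where f = fst, OF fin assms(1) _ open_sub_carrier])
      (use b in \<open>auto simp: bij_betw_def inj_on_def image_iff\<close>)
qed (auto simp: finitary_action_prod assms)

end

section \<open>Necklaces\<close>

definition rots :: "'x list \<Rightarrow> 'x list set" where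
  "rots l = range (\<lambda>k. rotate k l)"

definition nonconst_lists :: "nat \<Rightarrow> 'x set \<Rightarrow> 'x list set" where
  "nonconst_lists p A = {l. length l = p \<and> set l \<subseteq> A \<and> (\<forall>x. l \<noteq> replicate p x)}"

text \<open>
  For prime \<open>p\<close> rotation acts freely on the nonconstant lists, so a necklace consists of exactly \<open>p\<close>
  lists (\<open>card_rots\<close>).
\<close>

definition necklaces :: "nat \<Rightarrow> 'x set \<Rightarrow> 'x list set set" where
  "necklaces p A = rots ` nonconst_lists p A"

lemma rots_refl: "l \<in> rots l"
  unfolding rots_def by (rule range_eqI[of _ _ 0]) simp

lemma rots_sym:
  assumes "l' \<in> rots l"
  shows "l \<in> rots l'"
proof -
  obtain k where k: "l' = rotate k l" using assms by (auto simp: rots_def)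
  show ?thesis
  proof (cases "l = []")
    case True
    then show ?thesis using k rots_refl by simp
  next
    case False
    then have "k \<le> k * length l" by (cases "length l") auto
    then have "rotate (k * length l - k) l' = rotate (k * length l) l"
      unfolding k by (simp add: rotate_rotate)
    also have "\<dots> = l" by (rule rotate_id) simp
    finally show ?thesis unfolding rots_def by (metis rangeI)
  qed
qed

lemma rots_eq:
  assumes "l' \<in> rots l"
  shows "rots l' = rots l"
proof -
  have *: "rots b \<subseteq> rots a" if "b \<in> rots a" for a b :: "'x list"
    using that by (auto simp: rots_def rotate_rotate)
  show ?thesis using *[OF assms] *[OF rots_sym[OF assms]] by blast
qed

lemma rots_map: "map g ` rots l = rots (map g l)"
  by (auto simp: rots_def rotate_map image_iff)

lemma rots_replicate: "rots (replicate n x) = {replicate n x}"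
proof -
  have "rotate k (replicate n x) = replicate n x" for k by (induction k) auto
  then show ?thesis by (auto simp: rots_def)
qed

text \<open>
  The rotations fixing a list form a group; containing \<open>k\<close> and \<open>p\<close>, it contains their greatest common
  divisor \<open>1\<close>.
\<close>

lemma rotate_fixed_imp_constant:
  assumes "prime p" "length l = p" "rotate k l = l" "\<not> p dvd k"
  shows "\<exists>x. l = replicate p x"
proof -
  have "coprime k p" using assms(1,4) prime_imp_coprime coprime_commute by blast
  then obtain j where j: "[k * j = Suc 0] (mod p)" using cong_solve_coprime_nat by blast
  have "rotate (k * i) l = l" for i
    by (induction i) (simp_all add: rotate_rotate[symmetric] assms(3) add.commute)
  then have "rotate ((k * j) mod p) l = l" using rotate_conv_mod[of "k * j" l] assms(2) by simp
  moreover have "(k * j) mod p = 1" using j prime_gt_1_nat[OF assms(1)] by (simp add: cong_def)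
  ultimately have r: "rotate1 l = l" by simp
  have "l \<noteq> []" using assms(1,2) by auto
  then have "card (set l) = 1" using rotate1_fixpoint_card[OF r] by blast
  then obtain x where "set l = {x}" by (rule card_1_singletonE)
  then have "l = replicate p x" using assms(2) by (intro replicate_eqI) auto
  then show ?thesis by blast
qed

lemma rotate_inj:
  assumes "prime p" "l \<in> nonconst_lists p A" "rotate j l = rotate k l"
  shows "j mod p = k mod p"
proof -
  have l: "length l = p" "\<forall>x. l \<noteq> replicate p x" using assms(2) by (auto simp: nonconst_lists_def)
  have *: "i mod p = (i + d) mod p" if "rotate i l = rotate (i + d) l" for i d
  proof -
    have "inj (rotate i :: 'a list \<Rightarrow> 'a list)" unfolding rotate_def by (rule inj_fn[OF inj_rotate1])
    moreover have "rotate i (rotate d l) = rotate i l" using that by (simp add: rotate_rotate)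
    ultimately have "rotate d l = l" by (rule injD)
    then have "p dvd d" using rotate_fixed_imp_constant[OF assms(1) l(1)] l(2) by blast
    then show ?thesis by auto
  qed
  show ?thesis
  proof (cases "j \<le> k")
    case True
    then show ?thesis using *[of j "k - j"] assms(3) by simp
  next
    case False
    then show ?thesis using *[of k "j - k"] assms(3) by simp
  qed
qed

lemma card_rots:
  assumes "prime p" "l \<in> nonconst_lists p A"
  shows "card (rots l) = p"
proof -
  have l: "length l = p" using assms(2) by (auto simp: nonconst_lists_def)
  have p: "p > 0" using assms(1) prime_gt_0_nat by blast
  have "rots l = (\<lambda>k. rotate k l) ` {..<p}"
  proof -
    have "rotate k l \<in> (\<lambda>k. rotate k l) ` {..<p}" for k
      using rotate_conv_mod[of k l] l p by auto
    then show ?thesis by (auto simp: rots_def)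
  qed
  moreover have "inj_on (\<lambda>k. rotate k l) {..<p}"
    using rotate_inj[OF assms] by (auto simp: inj_on_def) (metis mod_less)
  ultimately show ?thesis by (simp add: card_image)
qed

lemma rots_nonconst:
  assumes "l \<in> nonconst_lists p A"
  shows "rots l \<subseteq> nonconst_lists p A"
proof
  fix l' assume l': "l' \<in> rots l"
  have "\<forall>x. l' \<noteq> replicate p x"
  proof (intro allI notI)
    fix x assume "l' = replicate p x"
    then have "l = replicate p x" using rots_sym[OF l'] by (simp add: rots_replicate)
    then show False using assms by (auto simp: nonconst_lists_def)
  qed
  then show "l' \<in> nonconst_lists p A" using l' assms by (auto simp: nonconst_lists_def rots_def)
qed

lemma necklacesE:
  assumes "N \<in> necklaces p A" "l \<in> N"
  shows "N = rots l" "l \<in> nonconst_lists p A"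
proof -
  obtain l' where l': "l' \<in> nonconst_lists p A" "N = rots l'"
    using assms(1) by (auto simp: necklaces_def)
  then show "N = rots l" using rots_eq[of l l'] assms(2) by simp
  show "l \<in> nonconst_lists p A" using rots_nonconst l' assms(2) by blast
qed

lemma necklaces_nonempty: "N \<in> necklaces p A \<Longrightarrow> \<exists>l. l \<in> N"
  using rots_refl by (auto simp: necklaces_def)

lemma rots_in_necklaces: "rots l \<in> necklaces p A \<longleftrightarrow> l \<in> nonconst_lists p A"
  using necklacesE(2)[OF _ rots_refl] by (auto simp: necklaces_def)

lemma necklace_fiber:
  assumes "N \<in> necklaces p A"
  shows "{l \<in> nonconst_lists p A. rots l = N} = N"
proof (intro equalityI subsetI)
  fix l assume "l \<in> N"
  then show "l \<in> {l \<in> nonconst_lists p A. rots l = N}" using necklacesE[OF assms] by blast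
qed (use rots_refl in blast)

lemma nonconst_lists_map:
  assumes "inj_on g A" "g ` A \<subseteq> B" "l \<in> nonconst_lists p A"
  shows "map g l \<in> nonconst_lists p B"
proof -
  have l: "length l = p" "set l \<subseteq> A" "\<forall>x. l \<noteq> replicate p x"
    using assms(3) by (auto simp: nonconst_lists_def)
  have "map g l \<noteq> replicate p y" for y
  proof
    assume eq: "map g l = replicate p y"
    have "p \<noteq> 0" using l by auto
    then obtain a where a: "a \<in> set l" using l(1) by (cases l) auto
    have gy: "g x = y" if "x \<in> set l" for x
    proof -
      have "g x \<in> set (map g l)" using that by simp
      then show ?thesis unfolding eq by simp
    qed
    have "x = a" if "x \<in> set l" for x
      using inj_onD[OF assms(1), of x a] gy[OF that] gy[OF a] that a l(2) by auto
    then have "l = replicate p a" using l(1) by (intro replicate_eqI) auto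
    then show False using l(3) by blast
  qed
  moreover have "set (map g l) \<subseteq> B" using l(2) assms(2) by auto
  ultimately show ?thesis using l(1) by (simp add: nonconst_lists_def)
qed

context pro_oligomorphic
begin

lemma cls_sum_fibers:
  assumes "finitary_action U E \<phi>" "finite B" "f \<in> E \<rightarrow> B"
    and "\<And>h x. h \<in> U \<Longrightarrow> x \<in> E \<Longrightarrow> f (\<phi> h x) = f x"
  shows "cls E \<phi> \<doteq> (\<Sum>b\<in>B. cls {x \<in> E. f x = b} \<phi>)"
proof -
  have sub: "finitary_action U {x \<in> E. f x \<in> C} \<phi>" for C
    by (rule finitary_action_sub[OF assms(1)])
      (use assms(4) smooth_actionD(2)[OF finitary_actionD(1)[OF assms(1)]] in auto)
  have main: "cls {x \<in> E. f x \<in> C} \<phi> \<doteq> (\<Sum>b\<in>C. cls {x \<in> E. f x = b} \<phi>)" if "finite C" for C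
    using that
  proof (induction C)
    case empty
    then show ?case by (simp add: cls_empty)
  next
    case (insert b C)
    have "{x \<in> E. f x \<in> insert b C} = {x \<in> E. f x \<in> {b}} \<union> {x \<in> E. f x \<in> C}" by blast
    then have "cls {x \<in> E. f x \<in> insert b C} \<phi> \<doteq> cls {x \<in> E. f x \<in> {b}} \<phi> + cls {x \<in> E. f x \<in> C} \<phi>"
      using cls_Un[OF sub[of "{b}"] sub[of C]] insert.hyps by auto
    also have "\<dots> \<doteq> cls {x \<in> E. f x \<in> {b}} \<phi> + (\<Sum>b\<in>C. cls {x \<in> E. f x = b} \<phi>)"
      by (intro theta_cong_add theta_cong_refl insert.IH)
    also have "\<dots> = (\<Sum>b\<in>insert b C. cls {x \<in> E. f x = b} \<phi>)" using insert.hyps by simp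
    finally show ?case .
  qed
  have "{x \<in> E. f x \<in> B} = E" using assms(3) by auto
  then show ?thesis using main[OF assms(2)] by simp
qed

text \<open>
  These lists are the points of an iterated product. Letting the factors vary with the position
  covers both powers of one set and the lists above a given list.
\<close>

lemma cls_list_all2:
  assumes "open_sub V" "\<And>b. b \<in> set m \<Longrightarrow> finitary_action V (X b) \<phi>"
  shows "finitary_action V {l. list_all2 (\<lambda>x b. x \<in> X b) l m} (\<lambda>h. map (\<phi> h)) \<and>
    cls {l. list_all2 (\<lambda>x b. x \<in> X b) l m} (\<lambda>h. map (\<phi> h)) \<doteq> prod_list (map (\<lambda>b. cls (X b) \<phi>) m)"
  using assms(2)
proof (induction m)
  case Nil
  have "finitary_action V {[]} (\<lambda>h. map (\<phi> h))"
    by (rule finitary_action_trivial[OF assms(1)]) simp_all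
  then show ?case using cls_singleton by simp
next
  case (Cons b m)
  let ?L = "\<lambda>m. {l. list_all2 (\<lambda>x b. x \<in> X b) l m}"
  have IH: "finitary_action V (?L m) (\<lambda>h. map (\<phi> h))"
      "cls (?L m) (\<lambda>h. map (\<phi> h)) \<doteq> prod_list (map (\<lambda>b. cls (X b) \<phi>) m)"
    using Cons by auto
  have b: "finitary_action V (X b) \<phi>" using Cons.prems by simp
  note prod = finitary_action_prod[OF b IH(1)]
  have im: "(\<lambda>(x, l). x # l) ` (X b \<times> ?L m) = ?L (b # m)"
    by (force simp: list_all2_Cons2 image_iff)
  have fin: "finitary_action V (?L (b # m)) (\<lambda>h. map (\<phi> h))"
    by (rule finitary_action_image[OF prod im]) auto
  have "cls (X b \<times> ?L m) (\<lambda>h. map_prod (\<phi> h) (map (\<phi> h))) \<doteq> cls (?L (b # m)) (\<lambda>h. map (\<phi> h))"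
  proof (rule cls_iso[OF prod fin _ assms(1)])
    show "bij_betw (\<lambda>(x, l). x # l) (X b \<times> ?L m) (?L (b # m))"
      using im by (auto simp: bij_betw_def inj_on_def)
  qed auto
  then have "cls (?L (b # m)) (\<lambda>h. map (\<phi> h)) \<doteq> cls (X b \<times> ?L m) (\<lambda>h. map_prod (\<phi> h) (map (\<phi> h)))"
    by (rule theta_cong_sym)
  also have "\<dots> \<doteq> cls (X b) \<phi> * cls (?L m) (\<lambda>h. map (\<phi> h))" by (rule cls_prod[OF b IH(1)])
  also have "\<dots> \<doteq> cls (X b) \<phi> * prod_list (map (\<lambda>b. cls (X b) \<phi>) m)"
    by (intro theta_cong_mult theta_cong_refl IH)
  finally show ?case using fin by simp
qed

lemma cls_lists:
  assumes "finitary_action U E \<phi>"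
  shows "cls (list_set n E) (\<lambda>h. map (\<phi> h)) \<doteq> cls E \<phi> ^ n"
proof -
  \<comment> \<open>Lists of length \<open>n\<close> are the lists above the list of \<open>n\<close> copies of the one point.\<close>
  have "list_set n E = {l. list_all2 (\<lambda>x b. x \<in> E) l (replicate n ())}"
    by (auto simp: list_set_def list_all2_conv_all_nth set_conv_nth)
  then show ?thesis
    using cls_list_all2[of U "replicate n ()" "\<lambda>_. E" \<phi>] assms
      finitary_action_open[OF assms]
    by (simp add: prod_list_replicate)
qed

definition neck_cls :: "nat \<Rightarrow> 'x set \<Rightarrow> ('a \<Rightarrow> 'x \<Rightarrow> 'x) \<Rightarrow> 'a theta_poly" where
  "neck_cls p E \<phi> = cls (necklaces p E) (\<lambda>h. image (map (\<phi> h)))"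

lemma finitary_action_nonconst_lists:
  assumes "finitary_action U E \<phi>"
  shows "finitary_action U (nonconst_lists p E) (\<lambda>h. map (\<phi> h))"
proof (rule finitary_action_sub[OF finitary_action_lists[OF assms]])
  show "nonconst_lists p E \<subseteq> list_set p E" by (auto simp: nonconst_lists_def list_set_def)
  fix h l assume "h \<in> U" "l \<in> nonconst_lists p E"
  then show "map (\<phi> h) l \<in> nonconst_lists p E"
    using smooth_action_bij[OF finitary_actionD(1)[OF assms], of h]
    by (intro nonconst_lists_map) (auto simp: bij_betw_def)
qed

lemma finitary_action_necklaces:
  assumes "finitary_action U E \<phi>"
  shows "finitary_action U (necklaces p E) (\<lambda>h. image (map (\<phi> h)))"
  by (rule finitary_action_image[OF finitary_action_nonconst_lists[OF assms, of p], where f = rots])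
    (simp_all add: necklaces_def rots_map)

text \<open>
  The constant lists of length \<open>p\<close> are a copy of \<open>E\<close>, and the other ones map \<open>p\<close> to one onto the
  necklaces.
\<close>

lemma cls_power_prime:
  assumes E: "finitary_action U E \<phi>" and p: "prime p"
  shows "cls E \<phi> ^ p \<doteq> cls E \<phi> + of_nat p * neck_cls p E \<phi>"
proof -
  let ?m = "\<lambda>h. map (\<phi> h)"
  note U = finitary_action_open[OF E]
  have p0: "p \<noteq> 0" using p by auto
  have const: "finitary_action U (replicate p ` E) ?m"
    by (rule finitary_action_image[OF E refl]) simp
  note nonconst = finitary_action_nonconst_lists[OF E, of p]
  note neck = finitary_action_necklaces[OF E, of p]
  have "list_set p E = replicate p ` E \<union> nonconst_lists p E"
  proof (intro equalityI subsetI)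
    fix l assume l: "l \<in> list_set p E"
    have "x \<in> E" if "l = replicate p x" for x using l p0 that by (simp add: list_set_def)
    then show "l \<in> replicate p ` E \<union> nonconst_lists p E"
      using l by (auto simp: list_set_def nonconst_lists_def)
  qed (auto simp: list_set_def nonconst_lists_def)
  moreover have "replicate p ` E \<inter> nonconst_lists p E = {}" by (auto simp: nonconst_lists_def)
  ultimately have "cls (list_set p E) ?m \<doteq> cls (replicate p ` E) ?m + cls (nonconst_lists p E) ?m"
    using cls_Un[OF const nonconst] by simp
  also have "\<dots> \<doteq> cls E \<phi> + of_nat p * cls (necklaces p E) (\<lambda>h. image (?m h))"
  proof (intro theta_cong_add)
    have "inj_on (replicate p :: 'x \<Rightarrow> 'x list) E" for E :: "'x set"
      using p0 by (auto simp: inj_on_def)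
    then have "cls E \<phi> \<doteq> cls (replicate p ` E) ?m"
      by (intro cls_iso[OF E const _ U]) (auto simp: bij_betw_def)
    then show "cls (replicate p ` E) ?m \<doteq> cls E \<phi>" by (rule theta_cong_sym)
    show "cls (nonconst_lists p E) ?m \<doteq> of_nat p * cls (necklaces p E) (\<lambda>h. image (?m h))"
    proof (rule cls_constant_fiber[where f = rots and U = U])
      fix N assume N: "N \<in> necklaces p E"
      obtain l where l: "l \<in> nonconst_lists p E" "N = rots l" using N by (auto simp: necklaces_def)
      have card: "card N = p" using card_rots[OF p l(1)] l(2) by simp
      have "finitary_action {h \<in> U. ?m h ` N = N} {l \<in> nonconst_lists p E. rots l = N} ?m"
        by (rule finitary_action_fiber[where f = rots, OF nonconst N finitary_actionD(1)[OF neck]])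
          (simp_all add: necklaces_def rots_map)
      then have "cls N ?m \<doteq> of_nat (card N)"
        unfolding necklace_fiber[OF N] using card p0 card_ge_0_finite[of N] by (intro cls_finite) auto
      then show "cls {l \<in> nonconst_lists p E. rots l = N} ?m \<doteq> of_nat p"
        using card necklace_fiber[OF N] by simp
    qed (simp_all add: nonconst neck rots_map rots_in_necklaces)
  qed
  finally have "cls (list_set p E) ?m \<doteq> cls E \<phi> + of_nat p * neck_cls p E \<phi>"
    by (simp add: neck_cls_def)
  then show ?thesis by (rule theta_cong_trans[OF theta_cong_sym[OF cls_lists[OF E]]])
qed

text \<open>
  Since rotation acts freely on the rotations of \<open>m\<close>, a necklace above the necklace of \<open>m\<close> contains
  exactly one list above \<open>m\<close> itself. The fiber is therefore a product of fibers of \<open>f\<close>.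
\<close>

lemma cls_over_necklace:
  assumes A: "finitary_action U A \<phi>" and B: "smooth_action U B \<psi>" and f: "f \<in> A \<rightarrow> B"
    and eq: "\<And>h x. h \<in> U \<Longrightarrow> x \<in> A \<Longrightarrow> f (\<phi> h x) = \<psi> h (f x)"
    and p: "prime p" and m: "m \<in> nonconst_lists p B"
  shows "cls {N \<in> necklaces p A. map f ` N = rots m} (\<lambda>h. image (map (\<phi> h))) \<doteq>
    prod_list (map (\<lambda>b. cls {x \<in> A. f x = b} \<phi>) m)"
proof -
  have mB: "set m \<subseteq> B" "length m = p" using m by (auto simp: nonconst_lists_def)
  obtain V where V: "open_sub V" "V \<subseteq> U" "\<forall>h\<in>V. \<forall>b\<in>set m. \<psi> h b = b"
    using open_sub_pointwise_stabilizer[OF B finite_set mB(1)] by blast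
  let ?L = "{l. list_all2 (\<lambda>x b. x \<in> {x \<in> A. f x = b}) l m}"
  let ?F = "{N \<in> necklaces p A. map f ` N = rots m}"
  have L: "?L = {l. set l \<subseteq> A \<and> map f l = m}"
    by (auto simp: list_all2_conv_all_nth set_conv_nth intro!: nth_equalityI)
  have "finitary_action V {x \<in> A. f x = b} \<phi>" if "b \<in> set m" for b
  proof (rule finitary_action_shrink[OF finitary_action_fiber[where f = f, OF A _ B f] V(1)])
    show "b \<in> B" using that mB by blast
    show "V \<subseteq> {h \<in> U. \<psi> h b = b}" using V that by blast
  qed (rule eq)
  from cls_list_all2[of V m "\<lambda>b. {x \<in> A. f x = b}" \<phi>, OF V(1) this]
  have finL: "finitary_action V ?L (\<lambda>h. map (\<phi> h))"
    and clsL: "cls ?L (\<lambda>h. map (\<phi> h)) \<doteq> prod_list (map (\<lambda>b. cls {x \<in> A. f x = b} \<phi>) m)"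
    by blast+
  have nc: "l \<in> nonconst_lists p A" if "l \<in> ?L" for l
  proof -
    have "set l \<subseteq> A" "map f l = m" using that L by auto
    moreover from this have "length l = p" using mB(2) by auto
    moreover have "l \<noteq> replicate p x" for x
    proof
      assume "l = replicate p x"
      then have "m = replicate p (f x)" using \<open>map f l = m\<close> by (simp add: map_replicate)
      then show False using m by (simp add: nonconst_lists_def)
    qed
    ultimately show ?thesis by (simp add: nonconst_lists_def)
  qed
  have im: "rots ` ?L = ?F"
  proof (intro equalityI subsetI)
    fix N assume "N \<in> rots ` ?L"
    then obtain l where l: "l \<in> ?L" "N = rots l" by blast
    then have "map f ` N = rots m" using L by (auto simp: rots_map)
    then show "N \<in> ?F" using nc[OF l(1)] l(2) by (simp add: rots_in_necklaces)
  next
    fix N assume N: "N \<in> ?F"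
    then have "m \<in> map f ` N" using rots_refl by simp
    then obtain l where l: "l \<in> N" "map f l = m" by blast
    then have "N = rots l" "l \<in> nonconst_lists p A" using necklacesE[of N p A l] N by auto
    then show "N \<in> rots ` ?L" using L l by (auto simp: nonconst_lists_def)
  qed
  have inj: "inj_on rots ?L"
  proof (rule inj_onI)
    fix l l' assume l: "l \<in> ?L" "l' \<in> ?L" "rots l = rots l'"
    then obtain k where k: "l' = rotate k l" using rots_refl[of l'] by (auto simp: rots_def)
    have fl: "map f l = m" "map f l' = m" using l L by auto
    then have "rotate k m = rotate 0 m" using k by (simp add: rotate_map[symmetric])
    then have "k mod p = 0" using rotate_inj[OF p m, of k 0] by simp
    then have "rotate k l = l" using fl(1) mB(2) by (intro rotate_id) auto
    then show "l = l'" using k by simp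
  qed
  have finF: "finitary_action V ?F (\<lambda>h. image (map (\<phi> h)))"
    by (rule finitary_action_image[where f = rots, OF finL im]) (simp add: rots_map)
  have "cls ?L (\<lambda>h. map (\<phi> h)) \<doteq> cls ?F (\<lambda>h. image (map (\<phi> h)))"
    by (rule cls_iso[where f = rots, OF finL finF _ V(1)]) (use inj im in \<open>simp_all add: bij_betw_def rots_map\<close>)
  then show ?thesis by (rule theta_cong_trans[OF theta_cong_sym clsL])
qed

end

section \<open>Words in two letters\<close>

text \<open>
  This is \<open>((a + b)\<^sup>p - a\<^sup>p - b\<^sup>p) / p\<close> written without a division (\<open>power_add_mixed\<close>), as a sum over
  necklaces in two letters; in this form it is the class of the necklaces that meet both parts of a
  disjoint union (\<open>neck_cls_Un\<close>).
\<close>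

definition mixed :: "nat \<Rightarrow> 'r::comm_ring_1 \<Rightarrow> 'r \<Rightarrow> 'r" where
  "mixed p a b =
    (\<Sum>M\<in>necklaces p (UNIV :: bool set). prod_list (map (\<lambda>i. if i then a else b) (SOME m. m \<in> M)))"

lemma prod_list_rotate: "prod_list (rotate k xs) = prod_list (xs :: 'r::comm_monoid_mult list)"
proof (induction k)
  case (Suc k)
  have "prod_list (rotate1 ys) = prod_list ys" for ys :: "'r list"
    by (cases ys) (simp_all add: mult.commute)
  then show ?case using Suc by simp
qed simp

lemma finite_bool_lists: "finite {m :: bool list. length m = n}"
  using finite_lists_length_eq[of "UNIV :: bool set" n] by simp

lemma sum_bool_lists:
  fixes v :: "bool \<Rightarrow> 'r::comm_ring_1"
  shows "(\<Sum>m | length m = n. prod_list (map v m)) = (v True + v False) ^ n"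
proof (induction n)
  case (Suc n)
  let ?S = "{m :: bool list. length m = n}"
  have "{m :: bool list. length m = Suc n} = (#) True ` ?S \<union> (#) False ` ?S"
    by (auto simp: length_Suc_conv image_iff)
  then have "(\<Sum>m | length m = Suc n. prod_list (map v m)) =
      (\<Sum>m\<in>(#) True ` ?S. prod_list (map v m)) + (\<Sum>m\<in>(#) False ` ?S. prod_list (map v m))"
    using finite_bool_lists[of n] by (simp only:) (rule sum.union_disjoint, auto)
  also have "\<dots> = v True * (\<Sum>m\<in>?S. prod_list (map v m)) + v False * (\<Sum>m\<in>?S. prod_list (map v m))"
    by (simp add: sum.reindex sum_distrib_left)
  finally show ?case using Suc by (simp add: algebra_simps)
qed simp

lemma finite_bool_nonconst: "finite (nonconst_lists p (UNIV :: bool set))"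
  by (rule finite_subset[OF _ finite_bool_lists[of p]]) (auto simp: nonconst_lists_def)

lemma finite_bool_necklaces: "finite (necklaces p (UNIV :: bool set))"
  unfolding necklaces_def by (rule finite_imageI[OF finite_bool_nonconst])

lemma necklace_some:
  assumes "M \<in> necklaces p A"
  shows "(SOME m. m \<in> M) \<in> nonconst_lists p A" "M = rots (SOME m. m \<in> M)"
proof -
  have "(SOME m. m \<in> M) \<in> M" using necklaces_nonempty[OF assms] by (rule someI_ex)
  then show "(SOME m. m \<in> M) \<in> nonconst_lists p A" "M = rots (SOME m. m \<in> M)"
    using necklacesE[OF assms] by blast+
qed

text \<open>
  Expand the power into words in \<open>a\<close> and \<open>b\<close>: two of them are constant, and the others come in
  necklaces of \<open>p\<close> words with the same product.
\<close>

lemma power_add_mixed: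
  assumes p: "prime p"
  shows "(a + b) ^ p = a ^ p + b ^ p + of_nat p * mixed p a b"
proof -
  define v where "v i = (if i then a else b)" for i
  let ?w = "\<lambda>m. prod_list (map v m)"
  let ?N = "nonconst_lists p (UNIV :: bool set)"
  have p0: "p \<noteq> 0" using p by auto
  have "{m :: bool list. length m = p} = {replicate p True, replicate p False} \<union> ?N"
    by (auto simp: nonconst_lists_def) (metis (full_types))
  then have "(\<Sum>m | length m = p. ?w m) = (\<Sum>m\<in>{replicate p True, replicate p False}. ?w m) + sum ?w ?N"
    using finite_bool_nonconst[of p] by (simp only:) (rule sum.union_disjoint, auto simp: nonconst_lists_def)
  also have "(\<Sum>m\<in>{replicate p True, replicate p False}. ?w m) = a ^ p + b ^ p"
    using p0 by (simp add: v_def prod_list_replicate)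
  also have "sum ?w ?N = (\<Sum>M\<in>rots ` ?N. sum ?w {m \<in> ?N. rots m = M})"
    by (rule sum.image_gen[OF finite_bool_nonconst])
  also have "\<dots> = (\<Sum>M\<in>necklaces p UNIV. of_nat p * ?w (SOME m. m \<in> M))"
    unfolding necklaces_def[symmetric]
  proof (rule sum.cong[OF refl])
    fix M :: "bool list set" assume M: "M \<in> necklaces p UNIV"
    define m where "m = (SOME m. m \<in> M)"
    note m = necklace_some[OF M, folded m_def]
    have "sum ?w {m \<in> ?N. rots m = M} = sum ?w (rots m)" using necklace_fiber[OF M] m(2) by simp
    also have "\<dots> = (\<Sum>_\<in>rots m. ?w m)"
      by (rule sum.cong[OF refl]) (auto simp: rots_def rotate_map[symmetric] prod_list_rotate)
    also have "\<dots> = of_nat p * ?w m" using card_rots[OF p m(1)] by simp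
    finally show "sum ?w {m \<in> ?N. rots m = M} = of_nat p * ?w (SOME m. m \<in> M)" by (simp add: m_def)
  qed
  also have "\<dots> = of_nat p * mixed p a b"
    by (simp add: mixed_def sum_distrib_left v_def[abs_def])
  finally have "(\<Sum>m | length m = p. ?w m) = a ^ p + b ^ p + of_nat p * mixed p a b" .
  moreover have "v True = a" "v False = b" by (simp_all add: v_def)
  ultimately show ?thesis using sum_bool_lists[of v p] by simp
qed

text \<open>
  A nonconstant word contains both letters.
\<close>

lemma dvd_mixed: "a dvd mixed p a b"
  unfolding mixed_def
proof (rule dvd_sum)
  fix M :: "bool list set" assume M: "M \<in> necklaces p UNIV"
  define m where "m = (SOME m. m \<in> M)"
  have m: "length m = p" "\<forall>x. m \<noteq> replicate p x"
    using necklace_some(1)[OF M] by (auto simp: nonconst_lists_def m_def)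
  have "True \<in> set m"
  proof (rule ccontr)
    assume "True \<notin> set m"
    then have "x = False" if "x \<in> set m" for x using that by (cases x) auto
    then have "m = replicate p False" using m(1) by (intro replicate_eqI) auto
    then show False using m(2) by blast
  qed
  then have "a \<in> set (map (\<lambda>i. if i then a else b) m)" by force
  moreover have "c dvd prod_list xs" if "c \<in> set xs" for c :: 'a and xs
    using that by (induction xs) auto
  ultimately show "a dvd prod_list (map (\<lambda>i. if i then a else b) (SOME m. m \<in> M))"
    unfolding m_def by blast
qed

section \<open>Necklaces of fibrations and of disjoint unions\<close>

context pro_oligomorphic
begin

lemma finitary_action_Diff:
  assumes "finitary_action U E \<phi>" "finitary_action U E' \<phi>" "E' \<subseteq> E"
  shows "finitary_action U (E - E') \<phi>"
proof (rule finitary_action_sub[OF assms(1)])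
  note S = finitary_actionD(1)[OF assms(1)]
  note A = smooth_actionD[OF S] and A' = smooth_actionD[OF finitary_actionD(1)[OF assms(2)]]
  fix h x assume h: "h \<in> U" "x \<in> E - E'"
  have "\<phi> h x \<notin> E'"
  proof
    assume "\<phi> h x \<in> E'"
    then have "\<phi> (inv h) (\<phi> h x) \<in> E'" using A'(2) open_subD(5)[OF A(1) h(1)] by blast
    then show False using smooth_action_inv(1)[OF S h(1)] h(2) by simp
  qed
  then show "\<phi> h x \<in> E - E'" using A(2) h by blast
qed blast

text \<open>
  The beads of a necklace either lie over a single point of the base, or they project to a necklace
  of the base.
\<close>

lemma necklace_split:
  assumes A: "finitary_action U A \<phi>" and B: "smooth_action U B \<psi>" and f: "f \<in> A \<rightarrow> B"
    and eqv: "\<forall>h\<in>U. \<forall>x\<in>A. f (\<phi> h x) = \<psi> h (f x)" and p: "prime p"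
  defines "P1 \<equiv> {N \<in> necklaces p A. \<exists>b\<in>B. map f ` N = {replicate p b}}"
    and "P2 \<equiv> {N \<in> necklaces p A. map f ` N \<in> necklaces p B}"
  shows "finitary_action U P1 (\<lambda>h. image (map (\<phi> h)))"
    and "finitary_action U P2 (\<lambda>h. image (map (\<phi> h)))"
    and "\<And>h N. h \<in> U \<Longrightarrow> N \<in> necklaces p A \<Longrightarrow> map f ` map (\<phi> h) ` N = map (\<psi> h) ` map f ` N"
    and "neck_cls p A \<phi> \<doteq> cls P1 (\<lambda>h. image (map (\<phi> h))) + cls P2 (\<lambda>h. image (map (\<phi> h)))"
proof -
  have p0: "p \<noteq> 0" using p by auto
  have eq: "f (\<phi> h x) = \<psi> h (f x)" if "h \<in> U" "x \<in> A" for h x using eqv that by blast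
  note neck = finitary_action_necklaces[OF A, of p]
  note AN = smooth_actionD[OF finitary_actionD(1)[OF neck]]
  show eqN: "map f ` map (\<phi> h) ` N = map (\<psi> h) ` map f ` N"
    if h: "h \<in> U" and N: "N \<in> necklaces p A" for h N
  proof -
    have "map f (map (\<phi> h) l) = map (\<psi> h) (map f l)" if "l \<in> N" for l
    proof -
      have "set l \<subseteq> A" using necklacesE(2)[OF N that] by (simp add: nonconst_lists_def)
      then show ?thesis using eq[OF h] by (auto simp: subset_iff)
    qed
    then show ?thesis unfolding image_image by (intro image_cong refl) simp
  qed
  show P2: "finitary_action U P2 (\<lambda>h. image (map (\<phi> h)))"
  proof (rule finitary_action_sub[OF neck])
    fix h N assume h: "h \<in> U" and N: "N \<in> P2"
    then have N': "N \<in> necklaces p A" "map f ` N \<in> necklaces p B" by (auto simp: P2_def)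
    obtain m where m: "m \<in> nonconst_lists p B" "map f ` N = rots m"
      using N'(2) by (auto simp: necklaces_def)
    have "map (\<psi> h) m \<in> nonconst_lists p B"
      using smooth_action_bij[OF B h] m(1) by (intro nonconst_lists_map) (auto simp: bij_betw_def)
    then have "map f ` map (\<phi> h) ` N \<in> necklaces p B"
      unfolding eqN[OF h N'(1)] m(2) by (simp add: rots_map rots_in_necklaces)
    then show "map (\<phi> h) ` N \<in> P2" using AN(2)[OF h N'(1)] by (simp add: P2_def)
  qed (simp add: P2_def)
  have P1_eq: "P1 = necklaces p A - P2"
  proof (intro equalityI subsetI)
    fix N assume "N \<in> P1"
    then obtain b where b: "N \<in> necklaces p A" "map f ` N = {replicate p b}" by (auto simp: P1_def)
    have "{replicate p b} \<notin> necklaces p B"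
      using necklacesE(2)[of "{replicate p b}" p B "replicate p b"] by (auto simp: nonconst_lists_def)
    then show "N \<in> necklaces p A - P2" using b by (simp add: P2_def)
  next
    fix N assume N: "N \<in> necklaces p A - P2"
    then obtain l where l: "l \<in> nonconst_lists p A" "N = rots l" by (auto simp: necklaces_def)
    have fN: "map f ` N = rots (map f l)" using l(2) by (simp add: rots_map)
    have "map f l \<notin> nonconst_lists p B" using N fN by (simp add: P2_def rots_in_necklaces)
    moreover have "length (map f l) = p" "set (map f l) \<subseteq> B" using l f by (auto simp: nonconst_lists_def)
    ultimately obtain b where b: "map f l = replicate p b" by (auto simp: nonconst_lists_def)
    then have "b \<in> B" using \<open>set (map f l) \<subseteq> B\<close> p0 by (simp del: set_map)
    then show "N \<in> P1" using N fN b by (auto simp: P1_def rots_replicate)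
  qed
  show P1: "finitary_action U P1 (\<lambda>h. image (map (\<phi> h)))"
    unfolding P1_eq by (rule finitary_action_Diff[OF neck P2]) (simp add: P2_def)
  have "necklaces p A = P1 \<union> P2" "P1 \<inter> P2 = {}" unfolding P1_eq by (auto simp: P2_def)
  then show "neck_cls p A \<phi> \<doteq> cls P1 (\<lambda>h. image (map (\<phi> h))) + cls P2 (\<lambda>h. image (map (\<phi> h)))"
    using cls_Un[OF P1 P2] by (simp add: neck_cls_def)
qed

lemma theta_cong_prod_list:
  "(\<And>b. b \<in> set m \<Longrightarrow> g b \<doteq> k b) \<Longrightarrow> prod_list (map g m) \<doteq> prod_list (map k m)"
  by (induction m) (auto intro: theta_cong_mult)

text \<open>
  The two parts of \<open>necklace_split\<close> are fibered over \<open>B\<close> and over the necklaces of \<open>B\<close>, with constant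
  fiber classes \<open>d\<close> and \<open>c\<^sup>p\<close>.
\<close>

lemma neck_cls_fibration:
  assumes A: "finitary_action U A \<phi>" and B: "finitary_action U B \<psi>" and f: "f \<in> A \<rightarrow> B"
    and eq: "\<And>h x. h \<in> U \<Longrightarrow> x \<in> A \<Longrightarrow> f (\<phi> h x) = \<psi> h (f x)" and p: "prime p"
    and c: "\<And>b. b \<in> B \<Longrightarrow> cls {x \<in> A. f x = b} \<phi> \<doteq> c"
    and d: "\<And>b. b \<in> B \<Longrightarrow> neck_cls p {x \<in> A. f x = b} \<phi> \<doteq> d"
  shows "neck_cls p A \<phi> \<doteq> d * cls B \<psi> + c ^ p * neck_cls p B \<psi>"
proof -
  let ?a = "\<lambda>h. image (map (\<phi> h))"
  define P1 where "P1 = {N \<in> necklaces p A. \<exists>b\<in>B. map f ` N = {replicate p b}}"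
  define P2 where "P2 = {N \<in> necklaces p A. map f ` N \<in> necklaces p B}"
  have eqv: "\<forall>h\<in>U. \<forall>x\<in>A. f (\<phi> h x) = \<psi> h (f x)" using eq by blast
  note split = necklace_split[where f = f, OF A finitary_actionD(1)[OF B] f eqv p, folded P1_def P2_def]
  have p0: "p \<noteq> 0" using p by auto
  define g where "g N = f (hd (SOME l. l \<in> N))" for N
  have gN: "g N = b" if "N \<in> necklaces p A" "map f ` N = {replicate p b}" for N b
  proof -
    have "(SOME l. l \<in> N) \<in> N" using necklaces_nonempty[OF that(1)] by (rule someI_ex)
    then have "map f (SOME l. l \<in> N) = replicate p b" using that(2) by blast
    then show ?thesis unfolding g_def using p0
      by (metis hd_map hd_replicate map_is_Nil_conv replicate_empty)
  qed
  have fib: "{N \<in> P1. g N = b} = necklaces p {x \<in> A. f x = b}" if b: "b \<in> B" for b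
  proof (intro equalityI subsetI)
    fix N assume "N \<in> {N \<in> P1. g N = b}"
    then have N: "N \<in> necklaces p A" "map f ` N = {replicate p b}" using gN by (auto simp: P1_def)
    obtain l where l: "l \<in> nonconst_lists p A" "N = rots l" using N(1) by (auto simp: necklaces_def)
    have "map f l = replicate p b" using N(2) l(2) rots_refl[of l] by blast
    then have "f x = b" if "x \<in> set l" for x
      using that by (metis imageI in_set_replicate list.set_map)
    then have "l \<in> nonconst_lists p {x \<in> A. f x = b}" using l(1) by (auto simp: nonconst_lists_def)
    then show "N \<in> necklaces p {x \<in> A. f x = b}" using l(2) by (simp add: rots_in_necklaces)
  next
    fix N assume "N \<in> necklaces p {x \<in> A. f x = b}"
    then obtain l where l: "l \<in> nonconst_lists p {x \<in> A. f x = b}" "N = rots l"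
      by (auto simp: necklaces_def)
    have "map f l = replicate p b"
      using l(1) by (intro replicate_eqI) (auto simp: nonconst_lists_def)
    then have fN: "map f ` N = {replicate p b}" using l(2) by (simp add: rots_map rots_replicate)
    have "l \<in> nonconst_lists p A" using l(1) by (auto simp: nonconst_lists_def)
    then have "N \<in> necklaces p A" using l(2) by (simp add: rots_in_necklaces)
    then show "N \<in> {N \<in> P1. g N = b}" using fN gN b by (auto simp: P1_def)
  qed
  have "cls P1 ?a \<doteq> d * cls B \<psi>"
  proof (rule cls_constant_fiber[where f = g and U = U])
    show "g \<in> P1 \<rightarrow> B" using gN by (auto simp: P1_def)
    fix h N assume h: "h \<in> U" and N: "N \<in> P1"
    then obtain b where b: "b \<in> B" "N \<in> necklaces p A" "map f ` N = {replicate p b}"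
      by (auto simp: P1_def)
    have "map f ` map (\<phi> h) ` N = {replicate p (\<psi> h b)}" using split(3)[OF h b(2)] b(3) by simp
    moreover have "map (\<phi> h) ` N \<in> necklaces p A"
      using smooth_actionD(2)[OF finitary_actionD(1)[OF finitary_action_necklaces[OF A]] h b(2)] .
    ultimately show "g (map (\<phi> h) ` N) = \<psi> h (g N)" using gN b by simp
  next
    fix b assume b: "b \<in> B"
    show "cls {N \<in> P1. g N = b} ?a \<doteq> d"
      using d[OF b] unfolding fib[OF b] neck_cls_def .
  qed (use split(1) B in simp_all)
  moreover have "cls P2 ?a \<doteq> c ^ p * neck_cls p B \<psi>"
    unfolding neck_cls_def
  proof (rule cls_constant_fiber[where f = "image (map f)" and U = U])
    fix M assume M: "M \<in> necklaces p B"
    then obtain m where m: "m \<in> nonconst_lists p B" "M = rots m" by (auto simp: necklaces_def)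
    have mB: "length m = p" "set m \<subseteq> B" using m(1) by (auto simp: nonconst_lists_def)
    have "{N \<in> P2. map f ` N = M} = {N \<in> necklaces p A. map f ` N = rots m}"
      using M m(2) by (auto simp: P2_def)
    then have "cls {N \<in> P2. map f ` N = M} ?a \<doteq> prod_list (map (\<lambda>b. cls {x \<in> A. f x = b} \<phi>) m)"
      using cls_over_necklace[where f = f, OF A finitary_actionD(1)[OF B] f eq p m(1)] by simp
    also have "\<dots> \<doteq> prod_list (map (\<lambda>b. c) m)"
      using mB(2) c by (intro theta_cong_prod_list) blast
    also have "\<dots> = c ^ p" using mB(1) by (simp add: map_replicate_const prod_list_replicate)
    finally show "cls {N \<in> P2. map f ` N = M} ?a \<doteq> c ^ p" .
  next
    show "finitary_action U P2 ?a" by (rule split(2))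
    show "finitary_action U (necklaces p B) (\<lambda>h. image (map (\<psi> h)))"
      by (rule finitary_action_necklaces[OF B])
    show "image (map f) \<in> P2 \<rightarrow> necklaces p B" by (auto simp: P2_def)
    show "map f ` map (\<phi> h) ` N = map (\<psi> h) ` map f ` N" if "h \<in> U" "N \<in> P2" for h N
      using split(3) that by (auto simp: P2_def)
  qed
  ultimately show ?thesis using theta_cong_trans[OF split(4) theta_cong_add] by blast
qed

text \<open>
  Apply \<open>necklace_split\<close> to the truth value that tells the two parts apart, with the trivial action on
  the base \<open>bool\<close>. The mixed necklaces lie over the finitely many necklaces in two letters.
\<close>

lemma neck_cls_Un:
  assumes 1: "finitary_action U A1 \<phi>" and 2: "finitary_action U A2 \<phi>" and disj: "A1 \<inter> A2 = {}"
    and p: "prime p"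
  shows "neck_cls p (A1 \<union> A2) \<phi> \<doteq>
    neck_cls p A1 \<phi> + neck_cls p A2 \<phi> + mixed p (cls A1 \<phi>) (cls A2 \<phi>)"
proof -
  let ?a = "\<lambda>h. image (map (\<phi> h))" and ?A = "A1 \<union> A2" and ?B = "UNIV :: bool set"
  let ?\<psi> = "\<lambda>(h :: 'a) (b :: bool). b"
  define f where "f x = (x \<in> A1)" for x
  have p0: "p \<noteq> 0" using p by auto
  note A = finitary_action_Un[OF 1 2]
  note S1 = smooth_actionD[OF finitary_actionD(1)[OF 1]] and S2 = smooth_actionD[OF finitary_actionD(1)[OF 2]]
  have B: "finitary_action U ?B ?\<psi>" by (rule finitary_action_trivial[OF S1(1)]) simp_all
  have eq: "f (\<phi> h x) = f x" if "h \<in> U" "x \<in> ?A" for h x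
    using that S1(2) S2(2) disj by (auto simp: f_def)
  have f: "f \<in> ?A \<rightarrow> ?B" by simp
  have fib: "{x \<in> ?A. f x = b} = (if b then A1 else A2)" for b
    using disj by (auto simp: f_def)
  define P1 where "P1 = {N \<in> necklaces p ?A. \<exists>b\<in>?B. map f ` N = {replicate p b}}"
  define P2 where "P2 = {N \<in> necklaces p ?A. map f ` N \<in> necklaces p ?B}"
  have eqv: "\<forall>h\<in>U. \<forall>x\<in>?A. f (\<phi> h x) = ?\<psi> h (f x)" using eq by blast
  note split = necklace_split[where f = f and \<psi> = ?\<psi>, OF A finitary_actionD(1)[OF B] f eqv p,
      folded P1_def P2_def]
  have P1: "P1 = necklaces p A1 \<union> necklaces p A2"
  proof (intro equalityI subsetI)
    fix N assume "N \<in> P1"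
    then obtain b where b: "N \<in> necklaces p ?A" "map f ` N = {replicate p b}" by (auto simp: P1_def)
    obtain l where l: "l \<in> nonconst_lists p ?A" "N = rots l" using b(1) by (auto simp: necklaces_def)
    have "map f l = replicate p b" using b(2) l(2) rots_refl[of l] by blast
    then have "f x = b" if "x \<in> set l" for x
      using that by (metis imageI in_set_replicate list.set_map)
    then have "set l \<subseteq> {x \<in> ?A. f x = b}" using l(1) by (auto simp: nonconst_lists_def)
    then have "l \<in> nonconst_lists p A1 \<or> l \<in> nonconst_lists p A2"
      using l(1) unfolding fib by (cases b) (auto simp: nonconst_lists_def)
    then show "N \<in> necklaces p A1 \<union> necklaces p A2" using l(2) by (auto simp: rots_in_necklaces)
  next
    fix N assume "N \<in> necklaces p A1 \<union> necklaces p A2"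
    then obtain b where "N \<in> necklaces p {x \<in> ?A. f x = b}"
      unfolding fib by (metis (full_types) UnE)
    then obtain l where l: "l \<in> nonconst_lists p {x \<in> ?A. f x = b}" "N = rots l"
      by (auto simp: necklaces_def)
    have "map f l = replicate p b"
      using l(1) by (intro replicate_eqI) (auto simp: nonconst_lists_def)
    then have fN: "map f ` N = {replicate p b}" using l(2) by (simp add: rots_map rots_replicate)
    have "l \<in> nonconst_lists p ?A" using l(1) by (auto simp: nonconst_lists_def)
    then show "N \<in> P1" using l(2) fN by (auto simp: P1_def rots_in_necklaces)
  qed
  have disjN: "necklaces p A1 \<inter> necklaces p A2 = {}"
  proof (rule ccontr)
    assume "necklaces p A1 \<inter> necklaces p A2 \<noteq> {}"
    then obtain N where N: "N \<in> necklaces p A1" "N \<in> necklaces p A2" by blast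
    obtain l where l: "l \<in> N" using necklaces_nonempty[OF N(1)] by blast
    have "set l \<subseteq> A1" "set l \<subseteq> A2" "length l = p"
      using necklacesE(2)[OF N(1) l] necklacesE(2)[OF N(2) l] by (auto simp: nonconst_lists_def)
    then show False using disj p0 by (cases l) auto
  qed
  have "cls P1 ?a \<doteq> neck_cls p A1 \<phi> + neck_cls p A2 \<phi>"
    unfolding P1 neck_cls_def
    by (rule cls_Un[OF finitary_action_necklaces[OF 1] finitary_action_necklaces[OF 2] disjN])
  moreover have "cls P2 ?a \<doteq> mixed p (cls A1 \<phi>) (cls A2 \<phi>)"
  proof -
    have "cls P2 ?a \<doteq> (\<Sum>M\<in>necklaces p ?B. cls {N \<in> P2. map f ` N = M} ?a)"
    proof (rule cls_sum_fibers[OF split(2) finite_bool_necklaces])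
      show "image (map f) \<in> P2 \<rightarrow> necklaces p ?B" by (auto simp: P2_def)
      show "map f ` map (\<phi> h) ` N = map f ` N" if "h \<in> U" "N \<in> P2" for h N
        using split(3)[of h N] that by (simp add: P2_def)
    qed
    also have "\<dots> \<doteq> mixed p (cls A1 \<phi>) (cls A2 \<phi>)"
      unfolding mixed_def
    proof (rule theta_cong_sum)
      fix M assume M: "M \<in> necklaces p ?B"
      define m where "m = (SOME m. m \<in> M)"
      note m = necklace_some[OF M, folded m_def]
      have "{N \<in> P2. map f ` N = M} = {N \<in> necklaces p ?A. map f ` N = rots m}"
        using M m(2) by (auto simp: P2_def)
      then have "cls {N \<in> P2. map f ` N = M} ?a \<doteq> prod_list (map (\<lambda>b. cls {x \<in> ?A. f x = b} \<phi>) m)"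
        using cls_over_necklace[where f = f and \<psi> = ?\<psi>, OF A finitary_actionD(1)[OF B] f eq p m(1)] by simp
      also have "(\<lambda>b. cls {x \<in> ?A. f x = b} \<phi>) = (\<lambda>b. if b then cls A1 \<phi> else cls A2 \<phi>)"
        unfolding fib by auto
      finally show "cls {N \<in> P2. map f ` N = M} ?a \<doteq>
          prod_list (map (\<lambda>i. if i then cls A1 \<phi> else cls A2 \<phi>) (SOME m. m \<in> M))"
        by (simp only: m_def)
    qed
    finally show ?thesis .
  qed
  ultimately show ?thesis using theta_cong_trans[OF split(4) theta_cong_add] by blast
qed

lemma neck_cls_conj:
  assumes "finitary_action U E \<phi>" "finitary_action U' E' \<phi>'" "g \<in> carrier G"
    "bij_betw f E E'" "open_sub W" "W \<subseteq> U"
    and eq: "\<And>h x. h \<in> W \<Longrightarrow> x \<in> E \<Longrightarrow> f (\<phi> h x) = \<phi>' (g \<otimes> h \<otimes> inv g) (f x)"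
  shows "neck_cls p E \<phi> \<doteq> neck_cls p E' \<phi>'"
  unfolding neck_cls_def
proof (rule cls_conj[where f = "image (map f)", OF
      finitary_action_necklaces[OF assms(1)] finitary_action_necklaces[OF assms(2)] assms(3) _ assms(5)])
  have inj: "inj_on f E" "f ` E = E'" using assms(4) by (auto simp: bij_betw_def)
  show "bij_betw (image (map f)) (necklaces p E) (necklaces p E')"
  proof (rule bij_betw_imageI)
    have "inj_on (map f) (nonconst_lists p E)"
    proof (rule inj_onI)
      fix l l' assume l: "l \<in> nonconst_lists p E" "l' \<in> nonconst_lists p E" "map f l = map f l'"
      have "inj_on f (set l \<union> set l')"
        by (rule inj_on_subset[OF inj(1)]) (use l in \<open>auto simp: nonconst_lists_def\<close>)
      then show "l = l'" using l(3) by (rule map_inj_on[rotated])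
    qed
    then have "inj_on (image (map f)) (Pow (nonconst_lists p E))" by (rule inj_on_image_Pow)
    moreover have "necklaces p E \<subseteq> Pow (nonconst_lists p E)" using necklacesE(2) by blast
    ultimately show "inj_on (image (map f)) (necklaces p E)" by (rule inj_on_subset)
    show "image (map f) ` necklaces p E = necklaces p E'"
    proof (intro equalityI subsetI)
      fix N assume "N \<in> image (map f) ` necklaces p E"
      then obtain l where l: "l \<in> nonconst_lists p E" "N = map f ` rots l" by (auto simp: necklaces_def)
      then have "map f l \<in> nonconst_lists p E'" using nonconst_lists_map[of f E E' l p] inj by simp
      then show "N \<in> necklaces p E'" using l(2) by (simp add: rots_map rots_in_necklaces)
    next
      fix N assume "N \<in> necklaces p E'"
      then obtain l where l: "l \<in> nonconst_lists p E'" "N = rots l" by (auto simp: necklaces_def)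
      let ?l = "map (inv_into E f) l"
      have il: "?l \<in> nonconst_lists p E"
        using bij_betw_inv_into[OF assms(4)]
        by (intro nonconst_lists_map[OF _ _ l(1)]) (simp_all add: bij_betw_def)
      have "map f ?l = l" using l(1) inj(2)
        by (auto simp: nonconst_lists_def f_inv_into_f subset_iff intro!: map_idI)
      then have "N = map f ` rots ?l" using l(2) by (simp add: rots_map)
      then show "N \<in> image (map f) ` necklaces p E" using il by (auto simp: rots_in_necklaces)
    qed
  qed
  fix h N assume h: "h \<in> W" "N \<in> necklaces p E"
  have "map f (map (\<phi> h) l) = map (\<phi>' (g \<otimes> h \<otimes> inv g)) (map f l)" if "l \<in> N" for l
  proof -
    have "set l \<subseteq> E" using necklacesE(2)[OF h(2) that] by (simp add: nonconst_lists_def)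
    then show ?thesis using eq[OF h(1)] by (auto simp: subset_iff)
  qed
  then show "map f ` map (\<phi> h) ` N = map (\<phi>' (g \<otimes> h \<otimes> inv g)) ` map f ` N"
    unfolding image_image by (intro image_cong refl) simp
qed


section \<open>Tuples of distinct points and finite subsets\<close>

definition distinct_lists :: "nat \<Rightarrow> 'x set \<Rightarrow> 'x list set" where
  "distinct_lists n E = {l. length l = n \<and> distinct l \<and> set l \<subseteq> E}"

lemma finitary_action_distinct_lists:
  assumes "finitary_action U E \<phi>"
  shows "finitary_action U (distinct_lists n E) (\<lambda>h. map (\<phi> h))"
proof (rule finitary_action_sub[OF finitary_action_lists[OF assms, of n]])
  show "distinct_lists n E \<subseteq> list_set n E" by (auto simp: distinct_lists_def list_set_def)
  fix h l assume h: "h \<in> U" and l: "l \<in> distinct_lists n E"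
  have bij: "bij_betw (\<phi> h) E E" by (rule smooth_action_bij[OF finitary_actionD(1)[OF assms] h])
  have "inj_on (\<phi> h) (set l)"
    by (rule inj_on_subset[OF bij_betw_imp_inj_on[OF bij]]) (use l in \<open>auto simp: distinct_lists_def\<close>)
  moreover have "set (map (\<phi> h) l) \<subseteq> E"
    using l bij_betw_imp_surj_on[OF bij] by (auto simp: distinct_lists_def)
  ultimately show "map (\<phi> h) l \<in> distinct_lists n E"
    using l by (simp add: distinct_lists_def distinct_map)
qed

text \<open>
  A list extends by the points outside it, which have class \<open>[E] - n\<close>.
\<close>

lemma cls_distinct_lists:
  assumes E: "finitary_action U E \<phi>"
  shows "cls (distinct_lists n E) (\<lambda>h. map (\<phi> h)) \<doteq> (\<Prod>i<n. cls E \<phi> - of_nat i)"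
proof (induction n)
  case 0
  have eq: "distinct_lists 0 E = {[]}" by (auto simp: distinct_lists_def)
  show ?case using cls_singleton[of U "[]"] finitary_action_distinct_lists[OF E, of 0] by (simp add: eq)
next
  case (Suc n)
  let ?m = "\<lambda>h. map (\<phi> h)"
  note S = finitary_actionD(1)[OF E]
  note fin = finitary_action_distinct_lists[OF E]
  have "cls (distinct_lists (Suc n) E) ?m \<doteq> (cls E \<phi> - of_nat n) * cls (distinct_lists n E) ?m"
  proof (rule cls_constant_fiber[where f = tl and U = U])
    fix l assume l: "l \<in> distinct_lists n E"
    then have l': "length l = n" "distinct l" "set l \<subseteq> E" by (auto simp: distinct_lists_def)
    obtain V where V: "open_sub V" "V \<subseteq> U" "\<forall>h\<in>V. \<forall>x\<in>set l. \<phi> h x = x"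
      using open_sub_pointwise_stabilizer[OF S finite_set l'(3)] by blast
    note EV = finitary_action_shrink[OF E V(1,2)]
    have lV: "finitary_action V (set l) \<phi>"
      by (rule finitary_action_sub[OF EV l'(3)]) (use V(3) in auto)
    note dV = finitary_action_Diff[OF EV lV l'(3)]
    let ?F = "{k \<in> distinct_lists (Suc n) E. tl k = l}"
    have im: "(\<lambda>x. x # l) ` (E - set l) = ?F"
    proof (intro equalityI subsetI)
      fix k assume k: "k \<in> ?F"
      then obtain x where "k = x # l" by (cases k) (auto simp: distinct_lists_def)
      then show "k \<in> (\<lambda>x. x # l) ` (E - set l)" using k by (auto simp: distinct_lists_def)
    qed (use l' in \<open>auto simp: distinct_lists_def\<close>)
    have map_l: "map (\<phi> h) l = l" if "h \<in> V" for h
      by (rule map_idI) (use V(3) that in blast)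
    have fF: "finitary_action V ?F ?m"
      by (rule finitary_action_image[OF dV im]) (simp add: map_l)
    have F: "cls (E - set l) \<phi> \<doteq> cls ?F ?m"
      by (rule cls_iso[where f = "\<lambda>x. x # l", OF dV fF _ V(1)])
        (use im in \<open>auto simp: bij_betw_def inj_on_def map_l\<close>)
    have "cls E \<phi> \<doteq> cls (E - set l) \<phi> + of_nat n"
    proof -
      have "E = (E - set l) \<union> set l" using l'(3) by blast
      then have "cls E \<phi> \<doteq> cls (E - set l) \<phi> + cls (set l) \<phi>" using cls_Un[OF dV lV] by auto
      also have "\<dots> \<doteq> cls (E - set l) \<phi> + of_nat (card (set l))"
        by (intro theta_cong_add theta_cong_refl cls_finite[OF lV]) simp
      finally show ?thesis using l' by (simp add: distinct_card)
    qed
    then have "cls E \<phi> - of_nat n \<doteq> cls (E - set l) \<phi>"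
      using theta_cong_diff[OF _ theta_cong_refl[of "of_nat n"]] by fastforce
    then show "cls ?F ?m \<doteq> cls E \<phi> - of_nat n"
      by (rule theta_cong_sym[OF theta_cong_trans[OF _ F]])
  next
    show "tl \<in> distinct_lists (Suc n) E \<rightarrow> distinct_lists n E"
      by (auto simp: distinct_lists_def length_Suc_conv)
  qed (simp_all add: fin map_tl)
  also have "\<dots> \<doteq> (cls E \<phi> - of_nat n) * (\<Prod>i<n. cls E \<phi> - of_nat i)"
    by (intro theta_cong_mult theta_cong_refl Suc.IH)
  also have "\<dots> = (\<Prod>i<Suc n. cls E \<phi> - of_nat i)" by (simp add: mult.commute)
  finally show ?case .
qed

text \<open>
  Each of the \<open>n\<close>-element subsets has \<open>n!\<close> orderings.
\<close>

lemma cls_falling_factorial: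
  assumes E: "finitary_action U E \<phi>"
  shows "(\<Prod>i<n. cls E \<phi> - of_nat i) \<doteq> of_nat (fact n) * cls (set ` distinct_lists n E) (\<lambda>h. image (\<phi> h))"
proof -
  let ?m = "\<lambda>h. map (\<phi> h)"
  note fin = finitary_action_distinct_lists[OF E, of n]
  have finS: "finitary_action U (set ` distinct_lists n E) (\<lambda>h. image (\<phi> h))"
    by (rule finitary_action_image[OF fin refl]) simp
  have "cls (distinct_lists n E) ?m \<doteq> of_nat (fact n) * cls (set ` distinct_lists n E) (\<lambda>h. image (\<phi> h))"
  proof (rule cls_constant_fiber[where f = set and U = U])
    fix S assume S: "S \<in> set ` distinct_lists n E"
    then have S': "finite S" "card S = n" "S \<subseteq> E"
      by (auto simp: distinct_lists_def distinct_card)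
    have eq: "{l \<in> distinct_lists n E. set l = S} = {l. length l = n \<and> distinct l \<and> set l \<subseteq> S}"
    proof (intro equalityI subsetI)
      fix l assume l: "l \<in> {l. length l = n \<and> distinct l \<and> set l \<subseteq> S}"
      then have "set l = S" using S' by (intro card_subset_eq) (auto simp: distinct_card)
      then show "l \<in> {l \<in> distinct_lists n E. set l = S}" using l S' by (auto simp: distinct_lists_def)
    qed (auto simp: distinct_lists_def)
    have card: "card {l. length l = n \<and> distinct l \<and> set l \<subseteq> S} = fact n"
      using card_lists_distinct_length_eq[OF S'(1), of n] S'(2) by (simp add: fact_prod)
    have "finitary_action {h \<in> U. \<phi> h ` S = S} {l \<in> distinct_lists n E. set l = S} ?m"
      by (rule finitary_action_fiber[where f = set, OF fin S finitary_actionD(1)[OF finS]]) simp_all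
    then have "cls {l \<in> distinct_lists n E. set l = S} ?m \<doteq> of_nat (card {l \<in> distinct_lists n E. set l = S})"
      by (rule cls_finite) (rule card_ge_0_finite, simp add: eq card)
    then show "cls {l \<in> distinct_lists n E. set l = S} ?m \<doteq> of_nat (fact n)"
      by (simp add: eq card)
  qed (simp_all add: fin finS)
  then show ?thesis by (rule theta_cong_trans[OF theta_cong_sym[OF cls_distinct_lists[OF E]]])
qed

end

section \<open>Integer polynomials\<close>

type_synonym 's int_poly = "('s \<Rightarrow>\<^sub>0 nat) \<Rightarrow>\<^sub>0 int"

lemma lookup_of_nat_mult:
  fixes x :: "'s int_poly"
  shows "Poly_Mapping.lookup (of_nat n * x) m = int n * Poly_Mapping.lookup x m"
  by (induction n) (simp_all add: algebra_simps lookup_add)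

lemma int_poly_torsion_free:
  fixes x y :: "'s int_poly"
  assumes "of_nat n * x = of_nat n * y" "n \<noteq> 0"
  shows "x = y"
proof (rule poly_mapping_eqI)
  fix m
  have "Poly_Mapping.lookup (of_nat n * x) m = Poly_Mapping.lookup (of_nat n * y) m" using assms(1) by simp
  then show "Poly_Mapping.lookup x m = Poly_Mapping.lookup y m"
    using assms(2) by (simp add: lookup_of_nat_mult)
qed

lemma frag_of_add: "(frag_of (a + b) :: 'm::comm_monoid_add \<Rightarrow>\<^sub>0 int) = frag_of a * frag_of b"
  by (simp add: mult_single)

lemma frag_of_sum: "(frag_of (sum g K) :: 'm::comm_monoid_add \<Rightarrow>\<^sub>0 int) = (\<Prod>s\<in>K. frag_of (g s))"
  by (induction K rule: infinite_finite_induct) (simp_all add: frag_of_add)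

lemma frag_of_single: "(frag_of (Poly_Mapping.single s n) :: 's int_poly) = poly_var s ^ n"
proof (induction n)
  case (Suc n)
  have "Poly_Mapping.single s (Suc n) = Poly_Mapping.single s 1 + Poly_Mapping.single s n"
    by (simp add: single_add[symmetric])
  then have "(frag_of (Poly_Mapping.single s (Suc n)) :: 's int_poly) =
      frag_of (Poly_Mapping.single s 1) * frag_of (Poly_Mapping.single s n)"
    by (simp only: frag_of_add)
  then show ?case using Suc by (simp add: poly_var_def)
qed simp

definition mono_subst :: "('s \<Rightarrow> 's int_poly) \<Rightarrow> ('s \<Rightarrow>\<^sub>0 nat) \<Rightarrow> 's int_poly" where
  "mono_subst v m = (\<Prod>s\<in>Poly_Mapping.keys m. v s ^ Poly_Mapping.lookup m s)"

text \<open>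
  The evaluation homomorphism that sends each variable \<open>s\<close> to \<open>v s\<close>.
\<close>

definition poly_subst :: "('s \<Rightarrow> 's int_poly) \<Rightarrow> 's int_poly \<Rightarrow> 's int_poly" where
  "poly_subst v = frag_extend (mono_subst v)"

lemma mono_subst_super:
  assumes "finite K" "Poly_Mapping.keys m \<subseteq> K"
  shows "mono_subst v m = (\<Prod>s\<in>K. v s ^ Poly_Mapping.lookup m s)"
  unfolding mono_subst_def
  by (rule prod.mono_neutral_left[OF assms]) (simp add: in_keys_iff)

lemma mono_subst_add: "mono_subst v (a + b) = mono_subst v a * mono_subst v b"
proof -
  let ?K = "Poly_Mapping.keys a \<union> Poly_Mapping.keys b"
  have "mono_subst v (a + b) = (\<Prod>s\<in>?K. v s ^ Poly_Mapping.lookup (a + b) s)"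
    by (rule mono_subst_super) (use keys_add[of a b] in auto)
  also have "\<dots> = (\<Prod>s\<in>?K. v s ^ Poly_Mapping.lookup a s) * (\<Prod>s\<in>?K. v s ^ Poly_Mapping.lookup b s)"
    by (simp add: lookup_add power_add prod.distrib)
  also have "\<dots> = mono_subst v a * mono_subst v b"
    by (simp add: mono_subst_super[of ?K])
  finally show ?thesis .
qed

lemma mono_subst_var: "mono_subst poly_var m = frag_of m"
proof -
  let ?K = "Poly_Mapping.keys m"
  have "m = (\<Sum>s\<in>?K. Poly_Mapping.single s (Poly_Mapping.lookup m s))"
  proof (rule poly_mapping_eqI)
    fix t
    have "Poly_Mapping.lookup (\<Sum>s\<in>?K. Poly_Mapping.single s (Poly_Mapping.lookup m s)) t =
        (\<Sum>s\<in>?K. if s = t then Poly_Mapping.lookup m s else 0)"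
      by (simp add: lookup_sum lookup_single when_def)
    also have "\<dots> = Poly_Mapping.lookup m t" by (simp add: in_keys_iff)
    finally show "Poly_Mapping.lookup m t =
        Poly_Mapping.lookup (\<Sum>s\<in>?K. Poly_Mapping.single s (Poly_Mapping.lookup m s)) t" by simp
  qed
  then have "(frag_of m :: 'a int_poly) =
      frag_of (\<Sum>s\<in>?K. Poly_Mapping.single s (Poly_Mapping.lookup m s))" by simp
  then show ?thesis by (simp only: frag_of_sum frag_of_single mono_subst_def)
qed

lemma frag_induct [case_names zero one diff]:
  assumes "P 0" "\<And>a. P (frag_of a)" "\<And>x y. P x \<Longrightarrow> P y \<Longrightarrow> P (x - y)"
  shows "P (x :: 'm \<Rightarrow>\<^sub>0 int)"
  by (rule frag_induction[of x UNIV P]) (use assms in auto)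

lemma int_poly_induct [case_names var one diff mult]:
  fixes x :: "'s int_poly"
  assumes "\<And>s. P (poly_var s)" "P 1" "\<And>x y. P x \<Longrightarrow> P y \<Longrightarrow> P (x - y)"
    "\<And>x y. P x \<Longrightarrow> P y \<Longrightarrow> P (x * y)"
  shows "P x"
proof -
  have mono: "P (frag_of m)" for m :: "'s \<Rightarrow>\<^sub>0 nat"
  proof -
    have pow: "P (y ^ n)" if "P y" for y n using that assms(2,4) by (induction n) auto
    have "P (\<Prod>s\<in>K. poly_var s ^ Poly_Mapping.lookup m s)" for K
      by (induction K rule: infinite_finite_induct) (use assms pow in auto)
    then show ?thesis by (simp add: mono_subst_var[symmetric] mono_subst_def)
  qed
  show ?thesis
  proof (induction x rule: frag_induct)
    case zero
    show ?case using assms(3)[OF assms(2) assms(2)] by simp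
  qed (use mono assms(3) in auto)
qed

lemma poly_subst_var: "poly_subst v (poly_var s) = v s"
  by (simp add: poly_subst_def poly_var_def mono_subst_def)

lemma poly_subst_one: "poly_subst v 1 = 1"
proof -
  have "poly_subst v (frag_of 0) = mono_subst v 0" unfolding poly_subst_def by (rule frag_extend_of)
  then show ?thesis by (simp add: mono_subst_def)
qed

lemma poly_subst_zero: "poly_subst v 0 = 0"
  by (simp add: poly_subst_def)

lemma poly_subst_diff: "poly_subst v (x - y) = poly_subst v x - poly_subst v y"
  by (simp add: poly_subst_def frag_extend_diff)

lemma poly_subst_add: "poly_subst v (x + y) = poly_subst v x + poly_subst v y"
  by (simp add: poly_subst_def frag_extend_add)

lemma poly_subst_mult: "poly_subst v (x * y) = poly_subst v x * poly_subst v y"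
proof -
  have single: "poly_subst v (frag_of a * y) = poly_subst v (frag_of a) * poly_subst v y" for a y
  proof (induction y rule: frag_induct)
    case zero
    show ?case by (simp add: poly_subst_zero)
  next
    case (one b)
    show ?case
      unfolding frag_of_add[symmetric] by (simp add: poly_subst_def mono_subst_add)
  next
    case (diff y z)
    then show ?case by (simp add: right_diff_distrib poly_subst_diff)
  qed
  show ?thesis
  proof (induction x rule: frag_induct)
    case zero
    show ?case by (simp add: poly_subst_zero)
  next
    case (one b)
    show ?case by (rule single)
  next
    case (diff y z)
    then show ?case by (simp add: left_diff_distrib poly_subst_diff)
  qed
qed

lemma poly_subst_of_nat: "poly_subst v (of_nat n) = of_nat n"
  by (induction n) (simp_all add: poly_subst_zero poly_subst_one poly_subst_add)

lemma poly_subst_id_on: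
  assumes x: "\<And>m. m \<in> Poly_Mapping.keys x \<Longrightarrow> Poly_Mapping.keys m \<subseteq> S"
    and v: "\<And>s. s \<in> S \<Longrightarrow> v s = poly_var s"
  shows "poly_subst v x = x"
proof -
  have "mono_subst v m = frag_of m" if "m \<in> Poly_Mapping.keys x" for m
  proof -
    have "mono_subst v m = mono_subst poly_var m"
      unfolding mono_subst_def using x[OF that] v by (intro prod.cong refl) auto
    then show ?thesis by (simp add: mono_subst_var)
  qed
  then have "poly_subst v x = frag_extend frag_of x"
    unfolding poly_subst_def by (rule frag_extend_eq)
  then show ?thesis by (simp add: frag_expansion[symmetric])
qed

section \<open>A lift of the Frobenius and torsion\<close>

context pro_oligomorphic
begin

lemma theta_ideal_gen_symbol: "X \<notin> Theta_symbols G T \<Longrightarrow> poly_var X \<in> theta_ideal"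
  unfolding theta_ideal_def by (intro ideal_hull.gen) blast

lemma theta_ideal_iff_cong: "x \<in> theta_ideal \<longleftrightarrow> x \<doteq> 0"
  by (simp add: theta_cong_def)

lemma theta_ideal_zero: "0 \<in> theta_ideal"
  and theta_ideal_add: "x \<in> theta_ideal \<Longrightarrow> y \<in> theta_ideal \<Longrightarrow> x + y \<in> theta_ideal"
  and theta_ideal_diff: "x \<in> theta_ideal \<Longrightarrow> y \<in> theta_ideal \<Longrightarrow> x - y \<in> theta_ideal"
  and theta_ideal_mult: "x \<in> theta_ideal \<Longrightarrow> y * x \<in> theta_ideal"
  and theta_ideal_dvd: "x \<in> theta_ideal \<Longrightarrow> x dvd y \<Longrightarrow> y \<in> theta_ideal"
  unfolding theta_ideal_def
  by (simp_all add: ideal_hull.zero ideal_hull.add ideal_hull.mult ideal_hull_diff)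
    (rule ideal_hull_dvd)

lemma theta_cong_mixed:
  assumes "a \<doteq> a'" "b \<doteq> b'"
  shows "mixed p a b \<doteq> mixed p a' b'"
  unfolding mixed_def by (intro theta_cong_sum theta_cong_prod_list) (use assms in auto)

text \<open>
  On symbols this is forced by \<open>cls_power_prime\<close>: it reduces to the Frobenius modulo \<open>p\<close>, and to the
  identity modulo the relations. On the variables that are not symbols the correction may be any
  polynomial of the ideal, here \<open>0\<close>.
\<close>

definition frob :: "nat \<Rightarrow> 'a theta_poly \<Rightarrow> 'a theta_poly" where
  "frob p = poly_subst (\<lambda>X. poly_var X ^ p -
    of_nat p * (if X \<in> Theta_symbols G T then neck_cls p (gset X) (gact X) else 0))"

lemma frob_symbol:
  "X \<in> Theta_symbols G T \<Longrightarrow>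
    frob p (poly_var X) = poly_var X ^ p - of_nat p * neck_cls p (gset X) (gact X)"
  by (simp add: frob_def poly_subst_var)

lemma frob_simps:
  "frob p 1 = 1" "frob p (x - y) = frob p x - frob p y" "frob p (x + y) = frob p x + frob p y"
  "frob p (x * y) = frob p x * frob p y" "frob p (of_nat n) = of_nat n"
  by (simp_all add: frob_def poly_subst_one poly_subst_diff poly_subst_add poly_subst_mult
      poly_subst_of_nat)

lemma symbol_finitary_action:
  "X \<in> Theta_symbols G T \<Longrightarrow> finitary_action (gdom X) (gset X) (gact X)"
  using ghat_set_finitary_action by (simp add: Theta_symbols_def)

lemma frob_cong:
  assumes p: "prime p"
  shows "frob p x \<doteq> x"
proof (induction x rule: int_poly_induct)
  case (var X)
  show ?case
  proof (cases "X \<in> Theta_symbols G T")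
    case True
    let ?n = "of_nat p * neck_cls p (gset X) (gact X)"
    have X: "cls (gset X) (gact X) \<doteq> poly_var X" by (rule cls_symbol[OF True])
    have "poly_var X ^ p \<doteq> cls (gset X) (gact X) ^ p" by (rule theta_cong_power[OF theta_cong_sym[OF X]])
    also have "\<dots> \<doteq> cls (gset X) (gact X) + ?n"
      by (rule cls_power_prime[OF symbol_finitary_action[OF True] p])
    also have "\<dots> \<doteq> poly_var X + ?n" by (intro theta_cong_add X theta_cong_refl)
    finally have "poly_var X ^ p - ?n \<doteq> poly_var X + ?n - ?n" by (intro theta_cong_diff theta_cong_refl)
    then show ?thesis by (simp add: frob_symbol[OF True])
  next
    case False
    have "p > 0" using p prime_gt_0_nat by blast
    then have "poly_var X dvd poly_var X ^ p" by (simp add: dvd_power)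
    then have "poly_var X ^ p \<in> theta_ideal" using theta_ideal_dvd theta_ideal_gen_symbol[OF False] by blast
    then have "poly_var X ^ p - poly_var X \<in> theta_ideal"
      using theta_ideal_diff theta_ideal_gen_symbol[OF False] by blast
    then show ?thesis using False by (simp add: frob_def poly_subst_var theta_cong_def)
  qed
qed (auto simp: frob_simps intro: theta_cong_diff theta_cong_mult)

lemma frob_lift_diff:
  assumes p: "prime p" and x: "frob p x = x ^ p + of_nat p * d" and y: "frob p y = y ^ p + of_nat p * e"
  shows "frob p (x - y) = (x - y) ^ p + of_nat p * (mixed p (x - y) y + d - e)"
proof -
  have "x ^ p = (x - y) ^ p + y ^ p + of_nat p * mixed p (x - y) y"
    using power_add_mixed[OF p, of "x - y" y] by simp
  then show ?thesis using x y by (simp add: frob_simps algebra_simps)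
qed

lemma frob_lift_mult:
  assumes x: "frob p x = x ^ p + of_nat p * d" and y: "frob p y = y ^ p + of_nat p * e"
  shows "frob p (x * y) = (x * y) ^ p + of_nat p * (x ^ p * e + d * y ^ p + of_nat p * d * e)"
  using x y by (simp add: frob_simps algebra_simps power_mult_distrib)

lemma frob_lift:
  assumes p: "prime p"
  shows "\<exists>d. frob p x = x ^ p + of_nat p * d"
proof (induction x rule: int_poly_induct)
  case (var X)
  show ?case
    by (rule exI[of _ "- (if X \<in> Theta_symbols G T then neck_cls p (gset X) (gact X) else 0)"])
      (simp add: frob_def poly_subst_var)
next
  case one
  show ?case by (rule exI[of _ 0]) (simp add: frob_simps)
next
  case (diff x y)
  then show ?case using frob_lift_diff[OF p] by blast
next
  case (mult x y)
  then show ?case using frob_lift_mult by blast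
qed

text \<open>
  The quotient \<open>\<delta>(a - b)\<close> differs from \<open>d - e\<close> by \<open>mixed p (a - b) b\<close>, a multiple of \<open>a - b\<close>. So a
  relation \<open>a = b\<close> is respected by \<open>\<delta>\<close> once both sides have congruent values.
\<close>

lemma frob_lift_relation:
  assumes p: "prime p" and ab: "a \<doteq> b"
    and a: "frob p a = a ^ p + of_nat p * d" and b: "frob p b = b ^ p + of_nat p * e" and de: "d \<doteq> e"
  shows "\<exists>c\<in>theta_ideal. frob p (a - b) = (a - b) ^ p + of_nat p * c"
proof -
  have "mixed p (a - b) b \<in> theta_ideal"
    using ab dvd_mixed theta_ideal_dvd unfolding theta_cong_def by blast
  then have "mixed p (a - b) b + (d - e) \<in> theta_ideal"
    using de theta_ideal_add unfolding theta_cong_def by blast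
  then have "mixed p (a - b) b + d - e \<in> theta_ideal" by (simp add: algebra_simps)
  then show ?thesis using frob_lift_diff[OF p a b] by blast
qed

lemma neck_cls_singleton:
  assumes "prime p"
  shows "neck_cls p {x} \<phi> \<doteq> 0"
proof -
  have "l = replicate p x" if "length l = p" "set l \<subseteq> {x}" for l
    using that by (intro replicate_eqI) auto
  then have "nonconst_lists p {x} = {}" by (fastforce simp: nonconst_lists_def)
  then have "necklaces p {x} = {}" by (simp add: necklaces_def)
  then show ?thesis by (simp add: neck_cls_def cls_empty)
qed

lemma neck_cls_iso:
  assumes "finitary_action U E \<phi>" "finitary_action U' E' \<phi>'" "bij_betw f E E'" "open_sub W" "W \<subseteq> U"
    and "\<And>h x. h \<in> W \<Longrightarrow> x \<in> E \<Longrightarrow> f (\<phi> h x) = \<phi>' h (f x)"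
  shows "neck_cls p E \<phi> \<doteq> neck_cls p E' \<phi>'"
  by (rule neck_cls_conj[where f = f and g = \<one>, OF assms(1,2) _ assms(3-5)])
    (use assms(6) open_subD(4)[OF assms(4)] in simp_all)

lemma ghat_isoE:
  assumes "ghat_iso G T X Y"
  obtains f W where "bij_betw f (gset X) (gset Y)" "open_sub W" "W \<subseteq> gdom X" "W \<subseteq> gdom Y"
    "\<And>h x. h \<in> W \<Longrightarrow> x \<in> gset X \<Longrightarrow> f (gact X h x) = gact Y h (f x)"
  using assms unfolding ghat_iso_def ghat_map_def by blast

lemma
  assumes X: "finitary_action W E \<phi>" and Y: "finitary_action W E' \<phi>'"
  defines "\<psi> \<equiv> \<lambda>h. map_sum (\<phi> h) (\<phi>' h)"
  shows finitary_action_sum: "finitary_action W (Inl ` E \<union> Inr ` E') \<psi>"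
    and cls_sum: "cls (Inl ` E \<union> Inr ` E') \<psi> \<doteq> cls E \<phi> + cls E' \<phi>'"
    and neck_cls_sum: "prime p \<Longrightarrow> neck_cls p (Inl ` E \<union> Inr ` E') \<psi> \<doteq>
      neck_cls p E \<phi> + neck_cls p E' \<phi>' + mixed p (cls E \<phi>) (cls E' \<phi>')"
proof -
  note W = finitary_action_open[OF X]
  have lX: "finitary_action W (Inl ` E) \<psi>"
    by (rule finitary_action_image[OF X refl]) (simp add: \<psi>_def)
  have rY: "finitary_action W (Inr ` E') \<psi>"
    by (rule finitary_action_image[OF Y refl]) (simp add: \<psi>_def)
  have bX: "bij_betw Inl E (Inl ` E)" and bY: "bij_betw Inr E' (Inr ` E')"
    by (auto simp: bij_betw_def)
  have cX: "cls E \<phi> \<doteq> cls (Inl ` E) \<psi>" by (rule cls_iso[OF X lX bX W]) (simp add: \<psi>_def)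
  have cY: "cls E' \<phi>' \<doteq> cls (Inr ` E') \<psi>" by (rule cls_iso[OF Y rY bY W]) (simp add: \<psi>_def)
  have nX: "neck_cls p E \<phi> \<doteq> neck_cls p (Inl ` E) \<psi>"
    by (rule neck_cls_iso[OF X lX bX W order_refl]) (simp add: \<psi>_def)
  have nY: "neck_cls p E' \<phi>' \<doteq> neck_cls p (Inr ` E') \<psi>"
    by (rule neck_cls_iso[OF Y rY bY W order_refl]) (simp add: \<psi>_def)
  show "finitary_action W (Inl ` E \<union> Inr ` E') \<psi>" by (rule finitary_action_Un[OF lX rY])
  have disj: "Inl ` E \<inter> Inr ` E' = {}" by blast
  show "cls (Inl ` E \<union> Inr ` E') \<psi> \<doteq> cls E \<phi> + cls E' \<phi>'"
    by (intro theta_cong_trans[OF cls_Un[OF lX rY disj]] theta_cong_add theta_cong_sym[OF cX]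
        theta_cong_sym[OF cY])
  assume p: "prime p"
  show "neck_cls p (Inl ` E \<union> Inr ` E') \<psi> \<doteq>
      neck_cls p E \<phi> + neck_cls p E' \<phi>' + mixed p (cls E \<phi>) (cls E' \<phi>')"
    by (intro theta_cong_trans[OF neck_cls_Un[OF lX rY disj p]] theta_cong_add theta_cong_mixed
        theta_cong_sym[OF cX] theta_cong_sym[OF cY] theta_cong_sym[OF nX] theta_cong_sym[OF nY])
qed

lemma neck_cls_coprod:
  assumes X: "X \<in> Theta_symbols G T" and Y: "Y \<in> Theta_symbols G T" and Z: "Z \<in> Theta_symbols G T"
    and iso: "ghat_iso G T Z (ghat_coprod X Y)" and p: "prime p"
  shows "neck_cls p (gset Z) (gact Z) \<doteq> neck_cls p (gset X) (gact X) + neck_cls p (gset Y) (gact Y) +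
    mixed p (poly_var X) (poly_var Y)"
proof -
  obtain f W where f: "bij_betw f (gset Z) (gset (ghat_coprod X Y))" and W: "open_sub W" "W \<subseteq> gdom Z"
      "W \<subseteq> gdom (ghat_coprod X Y)"
    and eq: "\<And>h x. h \<in> W \<Longrightarrow> x \<in> gset Z \<Longrightarrow> f (gact Z h x) = gact (ghat_coprod X Y) h (f x)"
    using ghat_isoE[OF iso] by metis
  let ?\<phi> = "\<lambda>h. map_sum (gact X h) (gact Y h)"
  have WX: "W \<subseteq> gdom X" and WY: "W \<subseteq> gdom Y" using W(3) by (auto simp: ghat_coprod_def)
  have fX: "finitary_action W (gset X) (gact X)"
    by (rule finitary_action_shrink[OF symbol_finitary_action[OF X] W(1) WX])
  have fY: "finitary_action W (gset Y) (gact Y)"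
    by (rule finitary_action_shrink[OF symbol_finitary_action[OF Y] W(1) WY])
  have E: "gset (ghat_coprod X Y) = Inl ` gset X \<union> Inr ` gset Y" by (simp add: ghat_coprod_def Plus_def)
  have "neck_cls p (gset Z) (gact Z) \<doteq> neck_cls p (Inl ` gset X \<union> Inr ` gset Y) ?\<phi>"
  proof (rule neck_cls_iso[where f = f, OF symbol_finitary_action[OF Z] finitary_action_sum[OF fX fY] _ W(1,2)])
    show "bij_betw f (gset Z) (Inl ` gset X \<union> Inr ` gset Y)" using f by (simp only: E)
    fix h x assume h: "h \<in> W" "x \<in> gset Z"
    then have "f x \<in> gset (ghat_coprod X Y)" using f by (auto simp: bij_betw_def)
    then show "f (gact Z h x) = ?\<phi> h (f x)" using eq[OF h] by (simp add: ghat_coprod_def)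
  qed
  also have "\<dots> \<doteq> neck_cls p (gset X) (gact X) + neck_cls p (gset Y) (gact Y) +
      mixed p (cls (gset X) (gact X)) (cls (gset Y) (gact Y))"
    by (rule neck_cls_sum[OF fX fY p])
  also have "\<dots> \<doteq> neck_cls p (gset X) (gact X) + neck_cls p (gset Y) (gact Y) +
      mixed p (poly_var X) (poly_var Y)"
    by (intro theta_cong_add theta_cong_mixed theta_cong_refl cls_symbol X Y)
  finally show ?thesis .
qed

lemma neck_cls_ghat_conj:
  assumes X: "X \<in> Theta_symbols G T" and g: "g \<in> carrier G"
  shows "neck_cls p (gset X) (gact X) \<doteq> neck_cls p (gset (ghat_conj G g X)) (gact (ghat_conj G g X))"
proof -
  have "ghat_conj G g X \<in> Theta_symbols G T"
    using finitary_ghat_conj[OF _ g] X by (simp add: Theta_symbols_def)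
  note fZ = symbol_finitary_action[OF this]
  note fX = symbol_finitary_action[OF X]
  note U = finitary_action_open[OF fX]
  show ?thesis
  proof (rule neck_cls_conj[where f = "\<lambda>x. x", OF fX fZ g _ U order_refl])
    show "bij_betw (\<lambda>x. x) (gset X) (gset (ghat_conj G g X))" by (simp add: ghat_conj_def bij_betw_def)
    fix h x assume "h \<in> gdom X"
    then show "gact X h x = gact (ghat_conj G g X) (g \<otimes> h \<otimes> inv g) x"
      using conj_cancel[OF g] open_subD(4)[OF U] by (simp add: ghat_conj_def)
  qed
qed

text \<open>
  All fibers are translates of one of them, so \<open>neck_cls_fibration\<close> applies with constant classes.
\<close>

lemma neck_cls_fiber:
  assumes X: "X \<in> Theta_symbols G T" and Y: "Y \<in> Theta_symbols G T"
    and f: "transitive_map G X Y f" and y: "y \<in> gset Y" and p: "prime p"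
  defines "F \<equiv> ghat_fiber G X Y f y"
  shows "F \<in> Theta_symbols G T"
    and "neck_cls p (gset X) (gact X) \<doteq>
      neck_cls p (gset F) (gact F) * poly_var Y + poly_var F ^ p * neck_cls p (gset Y) (gact Y)"
proof -
  note fX = symbol_finitary_action[OF X] and fY = symbol_finitary_action[OF Y]
  note AX = smooth_actionD[OF finitary_actionD(1)[OF fX]] and AY = smooth_actionD[OF finitary_actionD(1)[OF fY]]
  have dom: "gdom X = gdom Y" and ff: "f \<in> gset X \<rightarrow> gset Y"
    and eq: "\<And>h x. h \<in> gdom X \<Longrightarrow> x \<in> gset X \<Longrightarrow> f (gact X h x) = gact Y h (f x)"
    and trY: "transitive_action (ghat_grp G Y) (gset Y) (gact Y)"
    using f by (auto simp: transitive_map_def)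
  have eq': "f (gact X h x) = gact Y h (f x)" if "h \<in> gdom Y" "x \<in> gset X" for h x
    using eq that dom by simp
  show FS: "F \<in> Theta_symbols G T"
  proof -
    have "is_ghat_set G T X" "is_ghat_set G T Y"
      using X Y by (simp_all add: Theta_symbols_def finitary_ghat_set_def)
    then show ?thesis
      unfolding F_def using finitary_ghat_fiber[OF is_group _ _ f y] by (simp add: Theta_symbols_def)
  qed
  note fF = symbol_finitary_action[OF FS]
  let ?Fb = "\<lambda>b. {x \<in> gset X. f x = b}" and ?S = "\<lambda>b. {h \<in> gdom Y. gact Y h b = b}"
  have finFb: "finitary_action (?S b) (?Fb b) (gact X)" if "b \<in> gset Y" for b
    by (rule finitary_action_fiber[where f = f, OF fX[unfolded dom] that finitary_actionD(1)[OF fY] ff eq'])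
  note S = open_sub_stabilizer[OF finitary_actionD(1)[OF fY]]
  have gF: "gset F = ?Fb y" by (simp add: F_def ghat_fiber_def)
  have bF: "bij_betw (\<lambda>x. x) (gset F) (?Fb y)" by (simp add: gF bij_betw_def)
  note WF = finitary_action_open[OF fF]
  have aF: "gact F h x = gact X h x" if "x \<in> gset F" for h x
    using that by (simp add: F_def ghat_fiber_def)
  have cF: "cls (?Fb y) (gact X) \<doteq> poly_var F"
    using theta_cong_trans[OF theta_cong_sym[OF cls_iso[where f = "\<lambda>x. x", OF fF finFb[OF y] bF WF]]
        cls_symbol[OF FS]] aF by simp
  have nF: "neck_cls p (?Fb y) (gact X) \<doteq> neck_cls p (gset F) (gact F)"
    by (rule theta_cong_sym[OF neck_cls_iso[where f = "\<lambda>x. x", OF fF finFb[OF y] bF WF order_refl]])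
      (simp add: aF)
  \<comment> \<open>Any other fiber is a conjugate of the given one.\<close>
  have move: "\<exists>u\<in>carrier G. bij_betw (gact X u) (?Fb y) (?Fb b) \<and>
      (\<forall>h\<in>?S y. \<forall>x\<in>?Fb y. gact X u (gact X h x) = gact X (u \<otimes> h \<otimes> inv u) (gact X u x))"
    if b: "b \<in> gset Y" for b
  proof -
    obtain u where u: "u \<in> gdom Y" "gact Y u y = b"
      using transitive_action.unique_orbit[OF trY y b] by auto
    note U = open_subD[OF AY(1)]
    have iu: "gact Y (inv u) b = y" using smooth_action_inv(1)[OF finitary_actionD(1)[OF fY] u(1) y] u(2) by simp
    have "bij_betw (gact X u) (?Fb y) (?Fb b)"
    proof (rule bij_betwI[where g = "gact X (inv u)"])
      show "gact X u \<in> ?Fb y \<rightarrow> ?Fb b" using u eq' AX(2) dom by auto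
      show "gact X (inv u) \<in> ?Fb b \<rightarrow> ?Fb y" using U(5)[OF u(1)] iu eq' AX(2) dom by auto
    qed (use smooth_action_inv[OF finitary_actionD(1)[OF fX], of u] u(1) dom in auto)
    moreover have "gact X u (gact X h x) = gact X (u \<otimes> h \<otimes> inv u) (gact X u x)"
      if h: "h \<in> ?S y" and x: "x \<in> ?Fb y" for h x
    proof -
      have hU: "h \<in> gdom X" "u \<in> gdom X" "inv u \<in> gdom X" "u \<otimes> h \<in> gdom X"
        using h u(1) dom U by auto
      have xX: "x \<in> gset X" using x by simp
      have "gact X (u \<otimes> h \<otimes> inv u) (gact X u x) = gact X (u \<otimes> h) (gact X (inv u) (gact X u x))"
        using AX(4)[OF hU(4,3)] AX(2)[OF hU(2) xX] by simp
      also have "\<dots> = gact X (u \<otimes> h) x"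
        using smooth_action_inv(1)[OF finitary_actionD(1)[OF fX] hU(2) xX] by simp
      also have "\<dots> = gact X u (gact X h x)" using AX(4)[OF hU(2,1) xX] .
      finally show ?thesis by simp
    qed
    ultimately show ?thesis using U(4)[OF u(1)] by blast
  qed
  have "neck_cls p (gset X) (gact X) \<doteq>
      neck_cls p (gset F) (gact F) * cls (gset Y) (gact Y) + poly_var F ^ p * neck_cls p (gset Y) (gact Y)"
  proof (rule neck_cls_fibration[where f = f and U = "gdom Y", OF _ fY ff _ p])
    show "finitary_action (gdom Y) (gset X) (gact X)" using fX dom by simp
    show "f (gact X h x) = gact Y h (f x)" if "h \<in> gdom Y" "x \<in> gset X" for h x by (rule eq'[OF that])
  next
    fix b assume b: "b \<in> gset Y"
    obtain u where u: "u \<in> carrier G" "bij_betw (gact X u) (?Fb y) (?Fb b)"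
        "\<forall>h\<in>?S y. \<forall>x\<in>?Fb y. gact X u (gact X h x) = gact X (u \<otimes> h \<otimes> inv u) (gact X u x)"
      using move[OF b] by blast
    have "cls (?Fb y) (gact X) \<doteq> cls (?Fb b) (gact X)"
      by (rule cls_conj[where f = "gact X u", OF finFb[OF y] finFb[OF b] u(1,2) S[OF y]]) (use u(3) in blast)
    then show "cls (?Fb b) (gact X) \<doteq> poly_var F" using theta_cong_trans[OF theta_cong_sym cF] by blast
    have "neck_cls p (?Fb y) (gact X) \<doteq> neck_cls p (?Fb b) (gact X)"
      by (rule neck_cls_conj[where f = "gact X u", OF finFb[OF y] finFb[OF b] u(1,2) S[OF y] order_refl])
        (use u(3) in blast)
    then show "neck_cls p (?Fb b) (gact X) \<doteq> neck_cls p (gset F) (gact F)"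
      using theta_cong_trans[OF theta_cong_sym nF] by blast
  qed
  also have "\<dots> \<doteq> neck_cls p (gset F) (gact F) * poly_var Y + poly_var F ^ p * neck_cls p (gset Y) (gact Y)"
    by (intro theta_cong_add theta_cong_mult theta_cong_refl cls_symbol[OF Y])
  finally show "neck_cls p (gset X) (gact X) \<doteq>
      neck_cls p (gset F) (gact F) * poly_var Y + poly_var F ^ p * neck_cls p (gset Y) (gact Y)" .
qed

text \<open>
  For each kind of relation, \<open>\<delta>\<close> of the two sides is compared through the class of the necklaces. In the
  product relation, \<open>Y\<^sup>p - p [N Y]\<close> is congruent to \<open>Y\<close>.
\<close>

lemma frob_lift_generator:
  assumes r: "r \<in> Theta_relations G T" and p: "prime p"
  shows "\<exists>c\<in>theta_ideal. frob p r = r ^ p + of_nat p * c"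
proof -
  let ?n = "\<lambda>X. neck_cls p (gset X) (gact X)"
  have sym: "frob p (poly_var X) = poly_var X ^ p + of_nat p * (- ?n X)" if "X \<in> Theta_symbols G T" for X
    using frob_symbol[OF that] by simp
  have rel: "\<exists>c\<in>theta_ideal. frob p r = r ^ p + of_nat p * c"
    if "r = a - b" "frob p a = a ^ p + of_nat p * d" "frob p b = b ^ p + of_nat p * e" "d \<doteq> e"
    for a b d e
    using frob_lift_relation[OF p theta_cong_relation that(2-4)] r that(1) by simp
  show ?thesis
    using r
  proof (cases rule: Theta_relations.cases)
    case (iso X Y)
    obtain f W where f: "bij_betw f (gset X) (gset Y)" and W: "open_sub W" "W \<subseteq> gdom X" "W \<subseteq> gdom Y"
      and eq: "\<And>h x. h \<in> W \<Longrightarrow> x \<in> gset X \<Longrightarrow> f (gact X h x) = gact Y h (f x)"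
      using ghat_isoE[OF iso(4)] by metis
    have "?n X \<doteq> ?n Y"
      by (rule neck_cls_iso[where f = f, OF symbol_finitary_action[OF iso(2)]
            symbol_finitary_action[OF iso(3)] f W(1,2)]) (rule eq)
    then show ?thesis
      by (intro rel[OF iso(1) sym[OF iso(2)] sym[OF iso(3)]] theta_cong_uminus)
  next
    case (singleton X x)
    have "- ?n X \<doteq> - 0" unfolding singleton(3) by (rule theta_cong_uminus[OF neck_cls_singleton[OF p]])
    moreover have "frob p 1 = 1 ^ p + of_nat p * (- 0)" by (simp add: frob_simps)
    ultimately show ?thesis using rel[OF singleton(1) sym[OF singleton(2)]] by blast
  next
    case (coprod X Y Z)
    let ?e = "- (?n X + ?n Y + mixed p (poly_var X) (poly_var Y))"
    have "- ?n Z \<doteq> ?e" by (rule theta_cong_uminus[OF neck_cls_coprod[OF coprod(2-5) p]])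
    moreover have "frob p (poly_var X + poly_var Y) = (poly_var X + poly_var Y) ^ p + of_nat p * ?e"
      unfolding power_add_mixed[OF p] using sym[OF coprod(2)] sym[OF coprod(3)]
      by (simp add: frob_simps algebra_simps)
    ultimately show ?thesis using rel[OF coprod(1) sym[OF coprod(4)]] by blast
  next
    case (conj X g)
    have Z: "ghat_conj G g X \<in> Theta_symbols G T"
      using finitary_ghat_conj[OF _ conj(3)] conj(2) by (simp add: Theta_symbols_def)
    have "- ?n X \<doteq> - ?n (ghat_conj G g X)"
      by (rule theta_cong_uminus[OF neck_cls_ghat_conj[OF conj(2,3)]])
    then show ?thesis by (rule rel[OF conj(1) sym[OF conj(2)] sym[OF Z]])
  next
    case (fiber X Y f y)
    let ?F = "ghat_fiber G X Y f y"
    note F = neck_cls_fiber[OF fiber(2-5) p]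
    let ?e = "poly_var ?F ^ p * - ?n Y + - ?n ?F * poly_var Y ^ p + of_nat p * - ?n ?F * - ?n Y"
    have "frob p (poly_var ?F * poly_var Y) = (poly_var ?F * poly_var Y) ^ p + of_nat p * ?e"
      by (rule frob_lift_mult[OF sym[OF F(1)] sym[OF fiber(3)]])
    moreover have "- ?n X \<doteq> ?e"
    proof -
      have "poly_var Y \<doteq> frob p (poly_var Y)" by (rule theta_cong_sym[OF frob_cong[OF p]])
      then have "?n X \<doteq> ?n ?F * frob p (poly_var Y) + poly_var ?F ^ p * ?n Y"
        by (intro theta_cong_trans[OF F(2)] theta_cong_add theta_cong_mult theta_cong_refl)
      then have "- ?n X \<doteq> - (?n ?F * frob p (poly_var Y) + poly_var ?F ^ p * ?n Y)"
        by (rule theta_cong_uminus)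
      also have "\<dots> = ?e" unfolding frob_symbol[OF fiber(3)] by (simp add: algebra_simps)
      finally show ?thesis .
    qed
    ultimately show ?thesis using rel[OF fiber(1) sym[OF fiber(2)]] by blast
  qed
qed

text \<open>
  The formulas for \<open>\<delta>\<close> of sums and of products propagate the property from generators to the ideal.
\<close>

lemma frob_lift_ideal:
  assumes p: "prime p" and "x \<in> theta_ideal"
  shows "\<exists>c\<in>theta_ideal. frob p x = x ^ p + of_nat p * c"
  using assms(2) unfolding theta_ideal_def
proof (induction x rule: ideal_hull.induct)
  case zero
  have "frob p 0 = 0 ^ p + of_nat p * 0"
    using frob_simps(5)[of p 0] prime_gt_0_nat[OF p] by (simp add: zero_power)
  then show ?case using ideal_hull.zero by blast
next
  case (gen r)
  then consider "r \<in> Theta_relations G T" | X where "X \<notin> Theta_symbols G T" "r = poly_var X" by blast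
  then show ?case
  proof cases
    case 1
    then show ?thesis using frob_lift_generator[OF _ p] by (simp add: theta_ideal_def)
  next
    case 2
    then have "frob p r = r ^ p + of_nat p * 0" by (simp add: frob_def poly_subst_var)
    then show ?thesis using ideal_hull.zero by blast
  qed
next
  case (add x y)
  then obtain c d where c: "c \<in> theta_ideal" "frob p x = x ^ p + of_nat p * c"
    and d: "d \<in> theta_ideal" "frob p y = y ^ p + of_nat p * d" by (auto simp: theta_ideal_def)
  have "frob p (x + y) = (x + y) ^ p + of_nat p * (c + d - mixed p x y)"
    unfolding power_add_mixed[OF p] using c(2) d(2) by (simp add: frob_simps algebra_simps)
  moreover have "x \<in> theta_ideal" using add(1) by (simp add: theta_ideal_def)
  then have "mixed p x y \<in> theta_ideal" by (rule theta_ideal_dvd[OF _ dvd_mixed])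
  then have "c + d - mixed p x y \<in> theta_ideal" using c d theta_ideal_add theta_ideal_diff by blast
  ultimately show ?case by (auto simp: theta_ideal_def)
next
  case (mult x y)
  then obtain c where c: "c \<in> theta_ideal" "frob p x = x ^ p + of_nat p * c" by (auto simp: theta_ideal_def)
  obtain d where d: "frob p y = y ^ p + of_nat p * d" using frob_lift[OF p] by blast
  have "x dvd d * x ^ p" using p prime_gt_0_nat[OF p] by (simp add: dvd_power)
  then have "d * x ^ p \<in> theta_ideal" using mult(1) theta_ideal_dvd by (auto simp: theta_ideal_def)
  moreover have "y ^ p * c \<in> theta_ideal" "of_nat p * d * c \<in> theta_ideal" using c(1) theta_ideal_mult by auto
  ultimately have "y ^ p * c + d * x ^ p + of_nat p * d * c \<in> theta_ideal" using theta_ideal_add by blast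
  then show ?case using frob_lift_mult[OF d c(2)] by (auto simp: theta_ideal_def)
qed

text \<open>
  Let \<open>c\<close> be the value of \<open>\<delta>\<close> at \<open>p x\<close>, which lies in the ideal. Dividing
  \<open>p * frob p x = (p x)\<^sup>p + p c\<close> by \<open>p\<close> in the polynomial ring turns the first term into a multiple of
  \<open>p x\<close>, since \<open>p \<ge> 2\<close>.
\<close>

lemma theta_torsion_free_prime:
  assumes p: "prime p" and x: "of_nat p * x \<in> theta_ideal"
  shows "x \<in> theta_ideal"
proof -
  obtain c where c: "c \<in> theta_ideal" "frob p (of_nat p * x) = (of_nat p * x) ^ p + of_nat p * c"
    using frob_lift_ideal[OF p x] by blast
  obtain q where q: "p = Suc (Suc q)" using prime_ge_2_nat[OF p] by (metis Suc_diff_le add_2_eq_Suc le_add_diff_inverse)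
  have pow: "y ^ p = y * (y * y ^ q)" for y :: "'a theta_poly" by (simp add: q)
  have "of_nat p * frob p x = of_nat p * (of_nat p * x * (x * (of_nat p * x) ^ q) + c)"
    using c(2) unfolding pow by (simp add: frob_simps algebra_simps)
  then have "frob p x = of_nat p * x * (x * (of_nat p * x) ^ q) + c"
    by (rule int_poly_torsion_free) (simp add: q)
  moreover have "of_nat p * x * (x * (of_nat p * x) ^ q) \<in> theta_ideal"
    by (rule theta_ideal_dvd[OF x]) simp
  ultimately have "frob p x \<in> theta_ideal" using c(1) theta_ideal_add by simp
  moreover have "frob p x - x \<in> theta_ideal" using frob_cong[OF p] by (simp add: theta_cong_def)
  ultimately have "frob p x - (frob p x - x) \<in> theta_ideal" by (rule theta_ideal_diff)
  then show ?thesis by simp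
qed

lemma theta_torsion_free:
  assumes "n > 0" "of_nat n * x \<in> theta_ideal"
  shows "x \<in> theta_ideal"
  using assms
proof (induction n rule: less_induct)
  case (less n)
  show ?case
  proof (cases "n = 1")
    case True
    then show ?thesis using less.prems by simp
  next
    case False
    then obtain p where p: "prime p" "p dvd n" using prime_factor_nat by blast
    then obtain m where m: "n = p * m" by (auto simp: dvd_def)
    have "of_nat p * (of_nat m * x) \<in> theta_ideal" using less.prems(2) m by (simp add: mult.assoc)
    then have "of_nat m * x \<in> theta_ideal" by (rule theta_torsion_free_prime[OF p(1)])
    moreover have "m < n" "m > 0" using m less.prems(1) prime_gt_1_nat[OF p(1)] by auto
    ultimately show ?thesis using less.IH by blast
  qed
qed

end

section \<open>Divisibility of falling factorials\<close>

context pro_oligomorphic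
begin

definition effective :: "'a theta_poly \<Rightarrow> bool" where
  "effective x \<longleftrightarrow> (\<exists>Y\<in>Theta_symbols G T. x \<doteq> poly_var Y)"

lemma effective_cls:
  assumes "finitary_action U E \<phi>"
  shows "effective (cls E \<phi>)"
proof -
  obtain Y where "Y \<in> Theta_symbols G T" "represents Y E \<phi>"
    using finitary_action_symbol[OF assms] by metis
  then show ?thesis unfolding effective_def using cls_represents by blast
qed

lemma effective_theta_cong: "x \<doteq> y \<Longrightarrow> effective y \<Longrightarrow> effective x"
  unfolding effective_def using theta_cong_trans by blast

lemma effective_of_nat: "effective (of_nat n)"
proof -
  have fin: "finitary_action (carrier G) {..<n} (\<lambda>h x. x)"
    by (rule finitary_action_trivial[OF open_sub_carrier]) simp_all
  have "cls {..<n} (\<lambda>(h::'a) x. x) \<doteq> of_nat n" using cls_finite[OF fin] by simp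
  then show ?thesis using effective_theta_cong[OF theta_cong_sym effective_cls[OF fin]] by blast
qed

lemma effective_pair:
  assumes "effective x" "effective y"
  obtains X Y :: "('a, nat \<times> 'a set) ghat_set" and W
  where "finitary_action W (gset X) (gact X)" "finitary_action W (gset Y) (gact Y)"
    "x \<doteq> cls (gset X) (gact X)" "y \<doteq> cls (gset Y) (gact Y)"
proof -
  obtain X Y where X: "X \<in> Theta_symbols G T" "x \<doteq> poly_var X"
    and Y: "Y \<in> Theta_symbols G T" "y \<doteq> poly_var Y"
    using assms by (auto simp: effective_def)
  note fX = symbol_finitary_action[OF X(1)] and fY = symbol_finitary_action[OF Y(1)]
  have W: "open_sub (gdom X \<inter> gdom Y)"
    by (rule open_sub_Int[OF finitary_action_open[OF fX] finitary_action_open[OF fY]])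
  have "finitary_action (gdom X \<inter> gdom Y) (gset X) (gact X)"
    by (rule finitary_action_shrink[OF fX W]) blast
  moreover have "finitary_action (gdom X \<inter> gdom Y) (gset Y) (gact Y)"
    by (rule finitary_action_shrink[OF fY W]) blast
  moreover have "x \<doteq> cls (gset X) (gact X)"
    by (rule theta_cong_trans[OF X(2) theta_cong_sym[OF cls_symbol[OF X(1)]]])
  moreover have "y \<doteq> cls (gset Y) (gact Y)"
    by (rule theta_cong_trans[OF Y(2) theta_cong_sym[OF cls_symbol[OF Y(1)]]])
  ultimately show ?thesis by (rule that)
qed

lemma effective_mult:
  assumes "effective x" "effective y"
  shows "effective (x * y)"
proof -
  obtain X Y :: "('a, nat \<times> 'a set) ghat_set" and W where
    XY: "finitary_action W (gset X) (gact X)" "finitary_action W (gset Y) (gact Y)"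
    "x \<doteq> cls (gset X) (gact X)" "y \<doteq> cls (gset Y) (gact Y)"
    by (rule effective_pair[OF assms])
  have "x * y \<doteq> cls (gset X \<times> gset Y) (\<lambda>h. map_prod (gact X h) (gact Y h))"
    by (rule theta_cong_trans[OF theta_cong_mult[OF XY(3,4)] theta_cong_sym[OF cls_prod[OF XY(1,2)]]])
  then show ?thesis
    by (rule effective_theta_cong) (rule effective_cls[OF finitary_action_prod[OF XY(1,2)]])
qed

lemma effective_add:
  assumes "effective x" "effective y"
  shows "effective (x + y)"
proof -
  obtain X Y :: "('a, nat \<times> 'a set) ghat_set" and W where
    XY: "finitary_action W (gset X) (gact X)" "finitary_action W (gset Y) (gact Y)"
    "x \<doteq> cls (gset X) (gact X)" "y \<doteq> cls (gset Y) (gact Y)"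
    by (rule effective_pair[OF assms])
  have "x + y \<doteq> cls (Inl ` gset X \<union> Inr ` gset Y) (\<lambda>h. map_sum (gact X h) (gact Y h))"
    by (rule theta_cong_trans[OF theta_cong_add[OF XY(3,4)] theta_cong_sym[OF cls_sum[OF XY(1,2)]]])
  then show ?thesis
    by (rule effective_theta_cong) (rule effective_cls[OF finitary_action_sum[OF XY(1,2)]])
qed

text \<open>
  Modulo \<open>N\<close> negatives are positive multiples, so no formal differences are needed.
\<close>

lemma effective_representative:
  assumes "N > 0"
  shows "\<exists>w z. effective w \<and> x \<doteq> w + of_nat N * z"
proof (induction x rule: int_poly_induct)
  case (var X)
  have "effective 0" using effective_of_nat[of 0] by simp
  show ?case
  proof (cases "X \<in> Theta_symbols G T")
    case True
    then have "effective (poly_var X)" unfolding effective_def by blast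
    then show ?thesis by (intro exI[of _ "poly_var X"] exI[of _ 0]) simp
  next
    case False
    then have "poly_var X \<doteq> 0 + of_nat N * 0"
      using theta_ideal_gen_symbol by (simp add: theta_cong_def)
    then show ?thesis using \<open>effective 0\<close> by blast
  qed
next
  case one
  show ?case using effective_of_nat[of 1] by (intro exI[of _ 1] exI[of _ 0]) simp
next
  case (diff x y)
  then obtain w z w' z' where x: "effective w" "x \<doteq> w + of_nat N * z"
    and y: "effective w'" "y \<doteq> w' + of_nat N * z'" by blast
  \<comment> \<open>Subtracting is adding \<open>N - 1\<close> copies, modulo \<open>N\<close>.\<close>
  have "x - y \<doteq> w + of_nat N * z - (w' + of_nat N * z')" by (rule theta_cong_diff[OF x(2) y(2)])
  also have "\<dots> = (w + of_nat (N - 1) * w') + of_nat N * (z - z' - w')"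
    using assms by (simp add: of_nat_diff algebra_simps)
  finally show ?case
    using effective_add[OF x(1) effective_mult[OF effective_of_nat y(1)]] by blast
next
  case (mult x y)
  then obtain w z w' z' where x: "effective w" "x \<doteq> w + of_nat N * z"
    and y: "effective w'" "y \<doteq> w' + of_nat N * z'" by blast
  have "x * y \<doteq> (w + of_nat N * z) * (w' + of_nat N * z')" by (rule theta_cong_mult[OF x(2) y(2)])
  also have "\<dots> = w * w' + of_nat N * (w * z' + z * w' + of_nat N * z * z')" by (simp add: algebra_simps)
  finally show ?case using effective_mult[OF x(1) y(1)] by blast
qed

lemma falling_product_shift:
  fixes w :: "'r::comm_ring_1"
  shows "\<exists>c. (\<Prod>i<n. w + N * z - of_nat i) = (\<Prod>i<n. w - of_nat i) + N * c"
proof (induction n)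
  case 0
  show ?case by (rule exI[of _ 0]) simp
next
  case (Suc n)
  then obtain c where c: "(\<Prod>i<n. w + N * z - of_nat i) = (\<Prod>i<n. w - of_nat i) + N * c" by blast
  show ?case
    by (rule exI[of _ "z * (\<Prod>i<n. w - of_nat i) + c * (w + N * z - of_nat n)"])
      (simp add: c algebra_simps)
qed

lemma theta_cong_prod: "(\<And>i. i \<in> I \<Longrightarrow> f i \<doteq> g i) \<Longrightarrow> prod f I \<doteq> prod g I"
  by (induction I rule: infinite_finite_induct) (auto intro: theta_cong_mult)

text \<open>
  Replace \<open>x\<close> by the class of a set congruent to it modulo \<open>n!\<close>, which changes the product by a multiple
  of \<open>n!\<close> only.
\<close>

lemma falling_factorial_divisible:
  "\<exists>y. (\<Prod>i<n. x - of_nat i) \<doteq> of_nat (fact n) * y"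
proof -
  obtain w z where w: "effective w" "x \<doteq> w + of_nat (fact n) * z"
    using effective_representative[of "fact n" x] by auto
  obtain Y where Y: "Y \<in> Theta_symbols G T" "w \<doteq> poly_var Y" using w(1) by (auto simp: effective_def)
  let ?C = "cls (gset Y) (gact Y)" and ?N = "of_nat (fact n) :: 'a theta_poly"
  have wC: "w \<doteq> ?C" by (rule theta_cong_trans[OF Y(2) theta_cong_sym[OF cls_symbol[OF Y(1)]]])
  have "x \<doteq> ?C + ?N * z" by (intro theta_cong_trans[OF w(2)] theta_cong_add wC theta_cong_refl)
  then have "(\<Prod>i<n. x - of_nat i) \<doteq> (\<Prod>i<n. ?C + ?N * z - of_nat i)"
    by (intro theta_cong_prod theta_cong_diff theta_cong_refl)
  moreover obtain c where "(\<Prod>i<n. ?C + ?N * z - of_nat i) = (\<Prod>i<n. ?C - of_nat i) + ?N * c"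
    using falling_product_shift by blast
  ultimately have "(\<Prod>i<n. x - of_nat i) \<doteq> (\<Prod>i<n. ?C - of_nat i) + ?N * c" by simp
  also have "\<dots> \<doteq> ?N * cls (set ` distinct_lists n (gset Y)) (\<lambda>h. image (gact Y h)) + ?N * c"
    by (intro theta_cong_add theta_cong_refl cls_falling_factorial[OF symbol_finitary_action[OF Y(1)]])
  also have "\<dots> = ?N * (cls (set ` distinct_lists n (gset Y)) (\<lambda>h. image (gact Y h)) + c)"
    by (simp add: algebra_simps)
  finally show ?thesis by blast
qed

end

section \<open>Tensoring with the rationals\<close>

text \<open>
  Integer multiples move across the tensor sign. Here \<open>H\<close> is the subgroup of bilinearity relations, and
  the induction on \<open>n\<close> takes place in \<open>H\<close>.
\<close>

lemma pure_tensor_add_pow: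
  fixes R (structure)
  assumes "cring R" and y: "y \<in> carrier R"
  shows "pure_tensor R ([n] \<cdot> y) q = pure_tensor R y (of_nat n * q)"
proof -
  interpret cring R by fact
  let ?F = "rat_tensor_free R"
  define H where "H = generate ?F (rat_tensor_relations R)"
  interpret F: group ?F by (rule group_free_Abelian_group)
  have F: "carrier ?F = {c. Poly_Mapping.keys c \<subseteq> carrier R \<times> UNIV}" "monoid.mult ?F = (+)"
    by (simp_all add: free_Abelian_group_def)
  have frag: "frag_of (x, q) \<in> carrier ?F" if "x \<in> carrier R" for x q
    using that by (simp add: F)
  have Fd: "a - b \<in> carrier ?F" if "a \<in> carrier ?F" "b \<in> carrier ?F" for a b
    using that keys_diff[of a b] by (auto simp: F)
  have Fa: "a + b \<in> carrier ?F" if "a \<in> carrier ?F" "b \<in> carrier ?F" for a b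
    using F.m_closed[OF that] by (simp add: F)
  have "rat_tensor_relations R \<subseteq> carrier ?F"
    unfolding rat_tensor_relations_def by (auto intro!: Fd Fa frag simp del: F)
  then have H: "subgroup H ?F" unfolding H_def by (rule F.generate_is_subgroup)
  have rel: "r \<in> H" if "r \<in> rat_tensor_relations R" for r
    unfolding H_def using that by (rule generate.incl)
  have H_add: "a + b \<in> H" if "a \<in> H" "b \<in> H" for a b
    using subgroup.m_closed[OF H that] by (simp add: F)
  have H_minus: "- a \<in> H" if "a \<in> H" for a
  proof -
    have "a \<in> carrier ?F" using subgroup.mem_carrier[OF H that] .
    then have "inv\<^bsub>?F\<^esub> a = - a" by (simp add: F inv_free_Abelian_group)
    then show ?thesis using subgroup.m_inv_closed[OF H that] by simp
  qed
  have H_diff: "a - b \<in> H" if "a \<in> H" "b \<in> H" for a b using H_add[OF that(1) H_minus[OF that(2)]] by simp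
  have add1: "frag_of (x \<oplus> x', q) - (frag_of (x, q) + frag_of (x', q)) \<in> H"
    if "x \<in> carrier R" "x' \<in> carrier R" for x x' q
    by (rule rel) (use that in \<open>unfold rat_tensor_relations_def, blast\<close>)
  have add2: "frag_of (x, p + q) - (frag_of (x, p) + frag_of (x, q)) \<in> H" if "x \<in> carrier R" for x p q
    by (rule rel) (use that in \<open>unfold rat_tensor_relations_def, blast\<close>)
  have "frag_of ([n] \<cdot> y, q) - frag_of (y, of_nat n * q) \<in> H"
  proof (induction n)
    case 0
    have "- frag_of (\<zero>, q) \<in> H" using add1[of \<zero> \<zero> q] by simp
    moreover have "- frag_of (y, 0) \<in> H" using add2[OF y, of 0 0] by simp
    ultimately have "- frag_of (y, 0) - - frag_of (\<zero>, q) \<in> H" by (intro H_diff)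
    then show ?case by (simp add: add_pow_def nat_pow_def)
  next
    case (Suc n)
    have ny: "[n] \<cdot> y \<in> carrier R" using y by simp
    have "[Suc n] \<cdot> y = [n] \<cdot> y \<oplus> y" by (simp add: add_pow_def nat_pow_def)
    moreover have "of_nat (Suc n) * q = of_nat n * q + q" by (simp add: algebra_simps)
    moreover have "frag_of ([n] \<cdot> y \<oplus> y, q) - frag_of (y, of_nat n * q + q) =
        (frag_of ([n] \<cdot> y \<oplus> y, q) - (frag_of ([n] \<cdot> y, q) + frag_of (y, q))) +
        (frag_of ([n] \<cdot> y, q) - frag_of (y, of_nat n * q)) -
        (frag_of (y, of_nat n * q + q) - (frag_of (y, of_nat n * q) + frag_of (y, q)))"
      by (simp add: algebra_simps)
    ultimately show ?case using H_diff[OF H_add[OF add1[OF ny y, of q] Suc] add2[OF y, of "of_nat n * q" q]] by simp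
  qed
  then have "(frag_of ([n] \<cdot> y, q) - frag_of (y, of_nat n * q)) \<otimes>\<^bsub>?F\<^esub> frag_of (y, of_nat n * q) \<in>
      H #>\<^bsub>?F\<^esub> frag_of (y, of_nat n * q)"
    unfolding r_coset_def by blast
  then have "frag_of ([n] \<cdot> y, q) \<in> H #>\<^bsub>?F\<^esub> frag_of (y, of_nat n * q)" by (simp add: F)
  then have "H #>\<^bsub>?F\<^esub> frag_of (y, of_nat n * q) = H #>\<^bsub>?F\<^esub> frag_of ([n] \<cdot> y, q)"
    by (rule F.repr_independence[OF _ frag[OF y] H])
  then show ?thesis by (simp add: pure_tensor_def H_def)
qed

section \<open>Descent to \<open>\<Theta>(G)\<close>\<close>

context pro_oligomorphic
begin

abbreviation theta_poly_ring :: "'a theta_poly ring" where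
  "theta_poly_ring \<equiv> int_poly_ring (Theta_symbols G T)"

abbreviation theta_polys :: "'a theta_poly set" where
  "theta_polys \<equiv> carrier theta_poly_ring"

abbreviation theta_coset :: "'a theta_poly \<Rightarrow> 'a theta_poly set" where
  "theta_coset x \<equiv> genideal theta_poly_ring (Theta_relations G T) +>\<^bsub>theta_poly_ring\<^esub> x"

lemma theta_poly_ring_simps:
  "monoid.mult theta_poly_ring = (*)" "monoid.one theta_poly_ring = 1"
  "ring.zero theta_poly_ring = 0" "ring.add theta_poly_ring = (+)"
  by (simp_all add: int_poly_ring_def)

lemma theta_poly_ring_closed:
  "x \<in> theta_polys \<Longrightarrow> y \<in> theta_polys \<Longrightarrow> x + y \<in> theta_polys"
  "x \<in> theta_polys \<Longrightarrow> y \<in> theta_polys \<Longrightarrow> x * y \<in> theta_polys"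
  "x \<in> theta_polys \<Longrightarrow> y \<in> theta_polys \<Longrightarrow> x - y \<in> theta_polys"
  "0 \<in> theta_polys" "1 \<in> theta_polys" "of_nat n \<in> theta_polys"
proof -
  interpret R: cring theta_poly_ring by (rule cring_int_poly_ring)
  note simps = theta_poly_ring_simps
  show "x + y \<in> theta_polys" "x * y \<in> theta_polys"
    if "x \<in> theta_polys" "y \<in> theta_polys"
    using R.a_closed[OF that] R.m_closed[OF that] by (simp_all only: simps)
  show "x - y \<in> theta_polys"
    if "x \<in> theta_polys" "y \<in> theta_polys"
  proof -
    have c: "c \<in> theta_polys \<longleftrightarrow>
        (\<forall>m\<in>Poly_Mapping.keys c. Poly_Mapping.keys m \<subseteq> Theta_symbols G T)" for c
      by (simp add: int_poly_ring_def)
    show ?thesis using that keys_diff[of x y] unfolding c by blast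
  qed
  show z: "0 \<in> theta_polys" and o: "1 \<in> theta_polys"
    using R.zero_closed R.one_closed by (simp_all only: simps)
  show "of_nat n \<in> theta_polys"
  proof (induction n)
    case (Suc n)
    then show ?case using R.a_closed[OF o Suc] by (simp only: simps of_nat_Suc)
  qed (use z in simp)
qed

text \<open>
  This retraction onto the polynomials in the symbols turns a representation of an element of
  \<open>theta_ideal\<close> with coefficients in all variables into one inside the ring that defines \<open>\<Theta>(G)\<close>.
\<close>

definition theta_retract :: "'a theta_poly \<Rightarrow> 'a theta_poly" where
  "theta_retract = poly_subst (\<lambda>X. if X \<in> Theta_symbols G T then poly_var X else 0)"

lemma theta_retract_closed: "theta_retract x \<in> theta_polys"
proof (induction x rule: int_poly_induct)
  case (var X)
  have "poly_var X \<in> theta_polys" if "X \<in> Theta_symbols G T"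
    using that by (simp add: int_poly_ring_def poly_var_def)
  then show ?case by (simp add: theta_retract_def poly_subst_var theta_poly_ring_closed)
qed (simp_all add: theta_retract_def poly_subst_one poly_subst_diff poly_subst_mult theta_poly_ring_closed)

lemma theta_retract_id: "x \<in> theta_polys \<Longrightarrow> theta_retract x = x"
  unfolding theta_retract_def
  by (rule poly_subst_id_on[where S = "Theta_symbols G T"]) (auto simp: int_poly_ring_def)

lemma theta_retract_cong: "theta_retract x \<doteq> x"
proof (induction x rule: int_poly_induct)
  case (var X)
  then show ?case
    using theta_cong_sym[of "poly_var X" 0] theta_ideal_gen_symbol[of X]
    by (auto simp: theta_retract_def poly_subst_var theta_ideal_iff_cong)
qed (auto simp: theta_retract_def poly_subst_one poly_subst_diff poly_subst_mult
    intro: theta_cong_diff theta_cong_mult)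

lemma mem_genideal_iff:
  assumes "x \<in> theta_polys"
  shows "x \<in> genideal theta_poly_ring (Theta_relations G T) \<longleftrightarrow> x \<in> theta_ideal"
proof
  interpret R: cring theta_poly_ring by (rule cring_int_poly_ring)
  let ?I = "genideal theta_poly_ring (Theta_relations G T)"
  interpret I: ideal ?I theta_poly_ring by (rule R.genideal_ideal[OF Theta_relations_subset])
  note simps = theta_poly_ring_simps
  have I_simps: "0 \<in> ?I" "a + b \<in> ?I" if "a \<in> ?I" "b \<in> ?I" for a b
    using I.zero_closed I.a_closed[OF that] by (simp_all add: simps)
  have I_mult: "y * a \<in> ?I" if "a \<in> ?I" "y \<in> theta_polys" for a y
    using I.I_l_closed[OF that] by (simp add: simps)
  have "theta_retract x \<in> ?I" if "x \<in> theta_ideal" for x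
    using that unfolding theta_ideal_def
  proof (induction x rule: ideal_hull.induct)
    case zero
    show ?case using I.zero_closed by (simp add: theta_retract_def poly_subst_zero simps)
  next
    case (gen r)
    then consider "r \<in> Theta_relations G T" | X where "X \<notin> Theta_symbols G T" "r = poly_var X" by blast
    then show ?case
    proof cases
      case 1
      then have "theta_retract r = r" using theta_retract_id Theta_relations_subset by blast
      then show ?thesis using R.genideal_self[OF Theta_relations_subset] 1 by auto
    next
      case 2
      then show ?thesis using I.zero_closed by (simp add: theta_retract_def poly_subst_var simps)
    qed
  next
    case (add x y)
    then show ?case using I_simps(2) by (simp add: theta_retract_def poly_subst_add)
  next
    case (mult x y)
    then show ?case using I_mult theta_retract_closed[of y] by (simp add: theta_retract_def poly_subst_mult)
  qed
  then show "x \<in> ?I" if "x \<in> theta_ideal"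
    using that theta_retract_id[OF assms] by metis
  have "ideal (theta_ideal \<inter> theta_polys) theta_poly_ring"
  proof (rule idealI)
    show "ring theta_poly_ring" by (rule R.ring_axioms)
    show "subgroup (theta_ideal \<inter> theta_polys) (add_monoid theta_poly_ring)"
    proof (rule R.add.subgroupI)
      show "theta_ideal \<inter> theta_polys \<noteq> {}"
        using theta_ideal_zero theta_poly_ring_closed(4) by blast
      fix a assume a: "a \<in> theta_ideal \<inter> theta_polys"
      have ma: "- a \<in> theta_polys" using theta_poly_ring_closed(3)[of 0 a] theta_poly_ring_closed(4) a by simp
      have "\<ominus>\<^bsub>theta_poly_ring\<^esub> a = - a"
        by (rule R.minus_equality) (use a ma in \<open>simp_all add: simps\<close>)
      then show "\<ominus>\<^bsub>theta_poly_ring\<^esub> a \<in> theta_ideal \<inter> theta_polys"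
        using ma theta_ideal_diff[OF theta_ideal_zero, of a] a by simp
      fix b assume "b \<in> theta_ideal \<inter> theta_polys"
      then show "a \<oplus>\<^bsub>theta_poly_ring\<^esub> b \<in> theta_ideal \<inter> theta_polys"
        using a theta_ideal_add theta_poly_ring_closed(1) by (simp add: simps)
    qed blast
    fix a y assume a: "a \<in> theta_ideal \<inter> theta_polys" and y: "y \<in> theta_polys"
    show "y \<otimes>\<^bsub>theta_poly_ring\<^esub> a \<in> theta_ideal \<inter> theta_polys"
      "a \<otimes>\<^bsub>theta_poly_ring\<^esub> y \<in> theta_ideal \<inter> theta_polys"
      using a y theta_ideal_mult[of a y] theta_poly_ring_closed(2) by (simp_all add: simps mult.commute)
  qed
  moreover have "Theta_relations G T \<subseteq> theta_ideal \<inter> theta_polys"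
    using Theta_relations_subset by (auto simp: theta_ideal_def intro: ideal_hull.gen)
  ultimately have "?I \<subseteq> theta_ideal \<inter> theta_polys" by (rule R.genideal_minimal)
  then show "x \<in> theta_ideal" if "x \<in> ?I" using that by blast
qed

lemma theta_coset_eq_iff:
  assumes "x \<in> theta_polys" "y \<in> theta_polys"
  shows "theta_coset x = theta_coset y \<longleftrightarrow> x \<doteq> y"
proof -
  interpret R: cring theta_poly_ring by (rule cring_int_poly_ring)
  have my: "- y \<in> theta_polys"
    using theta_poly_ring_closed(3)[of 0 y] theta_poly_ring_closed(4) assms(2) by simp
  have "\<ominus>\<^bsub>theta_poly_ring\<^esub> y = - y"
    by (rule R.minus_equality) (use assms my in \<open>simp_all add: theta_poly_ring_simps\<close>)
  then have "x \<ominus>\<^bsub>theta_poly_ring\<^esub> y = x - y" by (simp add: a_minus_def theta_poly_ring_simps)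
  then show ?thesis
    using R.quotient_eq_iff_same_a_r_cos[OF R.genideal_ideal[OF Theta_relations_subset] assms]
      mem_genideal_iff[OF theta_poly_ring_closed(3)[OF assms]] by (simp add: theta_cong_def)
qed

lemma theta_coset_hom:
  assumes "x \<in> theta_polys" "y \<in> theta_polys"
  shows "theta_coset x \<in> carrier (Theta G T)"
    "theta_coset (x + y) = theta_coset x \<oplus>\<^bsub>Theta G T\<^esub> theta_coset y"
    "theta_coset (x * y) = theta_coset x \<otimes>\<^bsub>Theta G T\<^esub> theta_coset y"
    "theta_coset (x - y) = theta_coset x \<ominus>\<^bsub>Theta G T\<^esub> theta_coset y"
    "theta_coset 1 = \<one>\<^bsub>Theta G T\<^esub>" "theta_coset 0 = \<zero>\<^bsub>Theta G T\<^esub>"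
proof -
  interpret R: cring theta_poly_ring by (rule cring_int_poly_ring)
  interpret Q: cring "Theta G T" by (rule cring_Theta)
  interpret h: ring_hom_ring theta_poly_ring "Theta G T" "\<lambda>x. theta_coset x"
    unfolding Theta_def by (rule ideal.rcos_ring_hom_ring[OF R.genideal_ideal[OF Theta_relations_subset]])
  show "theta_coset x \<in> carrier (Theta G T)" by (rule h.hom_closed[OF assms(1)])
  have add: "theta_coset (a + b) = theta_coset a \<oplus>\<^bsub>Theta G T\<^esub> theta_coset b"
    if "a \<in> theta_polys" "b \<in> theta_polys" for a b
    using h.hom_add[OF that] by (simp add: theta_poly_ring_simps)
  show "theta_coset (x + y) = theta_coset x \<oplus>\<^bsub>Theta G T\<^esub> theta_coset y" by (rule add[OF assms])
  show "theta_coset (x * y) = theta_coset x \<otimes>\<^bsub>Theta G T\<^esub> theta_coset y"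
    using h.hom_mult[OF assms] by (simp add: theta_poly_ring_simps)
  show "theta_coset 1 = \<one>\<^bsub>Theta G T\<^esub>" "theta_coset 0 = \<zero>\<^bsub>Theta G T\<^esub>"
    using h.hom_one h.hom_zero by (simp_all add: theta_poly_ring_simps)
  have d: "x - y \<in> theta_polys" using theta_poly_ring_closed(3)[OF assms] .
  have "theta_coset x = theta_coset (x - y) \<oplus>\<^bsub>Theta G T\<^esub> theta_coset y" using add[OF d assms(2)] by simp
  then show "theta_coset (x - y) = theta_coset x \<ominus>\<^bsub>Theta G T\<^esub> theta_coset y"
    using h.hom_closed[OF d] h.hom_closed[OF assms(2)] by (simp add: a_minus_def Q.a_assoc Q.r_neg)
qed

lemma theta_cosetE:
  assumes "X \<in> carrier (Theta G T)"
  obtains x where "x \<in> theta_polys" "X = theta_coset x"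
  using assms by (auto simp: Theta_def FactRing_def A_RCOSETS_def RCOSETS_def a_r_coset_def)

lemma theta_coset_add_pow:
  assumes "x \<in> theta_polys"
  shows "[n] \<cdot>\<^bsub>Theta G T\<^esub> theta_coset x = theta_coset (of_nat n * x)"
proof (induction n)
  case 0
  then show ?case using theta_coset_hom(6)[OF assms assms] by (simp add: add_pow_def nat_pow_def)
next
  case (Suc n)
  have nx: "of_nat n * x \<in> theta_polys"
    using theta_poly_ring_closed(2)[OF theta_poly_ring_closed(6) assms] .
  have "[Suc n] \<cdot>\<^bsub>Theta G T\<^esub> theta_coset x = ([n] \<cdot>\<^bsub>Theta G T\<^esub> theta_coset x) \<oplus>\<^bsub>Theta G T\<^esub> theta_coset x"
    by (simp add: add_pow_def nat_pow_def)
  also have "\<dots> = theta_coset (of_nat n * x + x)" using Suc theta_coset_hom(2)[OF nx assms] by simp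
  finally show ?case by (simp add: algebra_simps)
qed

lemma Theta_torsion_free:
  fixes k :: int
  assumes X: "X \<in> carrier (Theta G T)" and k: "k \<noteq> 0" and kX: "[k] \<cdot>\<^bsub>Theta G T\<^esub> X = \<zero>\<^bsub>Theta G T\<^esub>"
  shows "X = \<zero>\<^bsub>Theta G T\<^esub>"
proof -
  interpret Q: cring "Theta G T" by (rule cring_Theta)
  obtain x where x: "x \<in> theta_polys" "X = theta_coset x" using theta_cosetE[OF X] .
  define n where "n = nat \<bar>k\<bar>"
  have n: "n > 0" using k by (simp add: n_def)
  have nx: "of_nat n * x \<in> theta_polys"
    using theta_poly_ring_closed(2)[OF theta_poly_ring_closed(6) x(1)] .
  have nX: "[n] \<cdot>\<^bsub>Theta G T\<^esub> X \<in> carrier (Theta G T)"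
    unfolding x(2) theta_coset_add_pow[OF x(1)] by (rule theta_coset_hom(1)[OF nx nx])
  have "[n] \<cdot>\<^bsub>Theta G T\<^esub> X = \<zero>\<^bsub>Theta G T\<^esub>"
  proof (cases "k < 0")
    case True
    have "nat (- k) = n" using True by (simp add: n_def)
    then have "[k] \<cdot>\<^bsub>Theta G T\<^esub> X = \<ominus>\<^bsub>Theta G T\<^esub> ([n] \<cdot>\<^bsub>Theta G T\<^esub> X)"
      unfolding add_pow_def int_pow_def2 a_inv_def by (simp only: True if_True)
    then have "\<ominus>\<^bsub>Theta G T\<^esub> ([n] \<cdot>\<^bsub>Theta G T\<^esub> X) = \<zero>\<^bsub>Theta G T\<^esub>" using kX by simp
    then show ?thesis using Q.minus_minus[OF nX] Q.minus_zero by simp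
  next
    case False
    then have "nat k = n" by (simp add: n_def)
    then have "[k] \<cdot>\<^bsub>Theta G T\<^esub> X = [n] \<cdot>\<^bsub>Theta G T\<^esub> X"
      unfolding add_pow_def int_pow_def2 by (simp only: False if_False)
    then show ?thesis using kX by simp
  qed
  then have "theta_coset (of_nat n * x) = theta_coset 0"
    using theta_coset_add_pow[OF x(1), of n] theta_coset_hom(6)[OF x(1) x(1)] x(2) by simp
  then have "of_nat n * x \<doteq> 0" using theta_coset_eq_iff[OF nx theta_poly_ring_closed(4)] by simp
  then have "x \<doteq> 0" using theta_torsion_free[OF n] by (simp add: theta_ideal_iff_cong)
  then have "theta_coset x = theta_coset 0" using theta_coset_eq_iff[OF x(1) theta_poly_ring_closed(4)] by simp
  then show ?thesis using theta_coset_hom(6)[OF x(1) x(1)] x(2) by simp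
qed

lemma theta_coset_falling_product:
  assumes "x \<in> theta_polys"
  shows "(\<Prod>i<n. x - of_nat i) \<in> theta_polys"
    and "falling_product (Theta G T) (theta_coset x) n = theta_coset (\<Prod>i<n. x - of_nat i)"
proof -
  interpret Q: cring "Theta G T" by (rule cring_Theta)
  have cl: "x - of_nat i \<in> theta_polys" for i
    using theta_poly_ring_closed(3)[OF assms theta_poly_ring_closed(6)] .
  show prod: "(\<Prod>i<n. x - of_nat i) \<in> theta_polys" for n
    by (induction n) (simp_all add: theta_poly_ring_closed cl)
  have one: "theta_coset 1 = \<one>\<^bsub>Theta G T\<^esub>" by (rule theta_coset_hom(5)[OF assms assms])
  have factor: "theta_coset x \<ominus>\<^bsub>Theta G T\<^esub> ([i] \<cdot>\<^bsub>Theta G T\<^esub> \<one>\<^bsub>Theta G T\<^esub>) = theta_coset (x - of_nat i)" for i :: nat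
    using theta_coset_add_pow[OF theta_poly_ring_closed(5), of i] theta_coset_hom(4)[OF assms theta_poly_ring_closed(6), of i]
    by (simp add: one)
  have "falling_product (Theta G T) (theta_coset x) n =
      (\<Otimes>\<^bsub>Theta G T\<^esub>i\<in>{..<n}. theta_coset (x - of_nat i))"
    by (simp add: falling_product_def factor)
  also have "\<dots> = theta_coset (\<Prod>i<n. x - of_nat i)"
  proof (induction n)
    case 0
    then show ?case by (simp add: one)
  next
    case (Suc n)
    have "(\<Otimes>\<^bsub>Theta G T\<^esub>i\<in>insert n {..<n}. theta_coset (x - of_nat i)) =
        theta_coset (x - of_nat n) \<otimes>\<^bsub>Theta G T\<^esub> (\<Otimes>\<^bsub>Theta G T\<^esub>i\<in>{..<n}. theta_coset (x - of_nat i))"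
      by (rule Q.finprod_insert) (auto intro: theta_coset_hom(1)[OF cl cl])
    also have "\<dots> = theta_coset ((x - of_nat n) * (\<Prod>i<n. x - of_nat i))"
      using Suc theta_coset_hom(3)[OF cl prod] by simp
    finally show ?case by (simp add: lessThan_Suc mult.commute)
  qed
  finally show "falling_product (Theta G T) (theta_coset x) n = theta_coset (\<Prod>i<n. x - of_nat i)" .
qed

lemma Theta_binomial_element:
  assumes X: "X \<in> carrier (Theta G T)"
  shows "binomial_element (Theta G T) X n \<in> (\<lambda>y. pure_tensor (Theta G T) y 1) ` carrier (Theta G T)"
proof -
  obtain x where x: "x \<in> theta_polys" "X = theta_coset x" using theta_cosetE[OF X] .
  obtain y0 where y0: "(\<Prod>i<n. x - of_nat i) \<doteq> of_nat (fact n) * y0"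
    using falling_factorial_divisible by blast
  define y where "y = theta_retract y0"
  have y: "y \<in> theta_polys" unfolding y_def by (rule theta_retract_closed)
  have "(\<Prod>i<n. x - of_nat i) \<doteq> of_nat (fact n) * y"
    unfolding y_def
    by (intro theta_cong_trans[OF y0] theta_cong_mult theta_cong_refl theta_cong_sym[OF theta_retract_cong])
  then have "theta_coset (\<Prod>i<n. x - of_nat i) = theta_coset (of_nat (fact n) * y)"
    using theta_coset_eq_iff[OF theta_coset_falling_product(1)[OF x(1)]
        theta_poly_ring_closed(2)[OF theta_poly_ring_closed(6) y]] by blast
  then have "falling_product (Theta G T) X n = [(fact n :: nat)] \<cdot>\<^bsub>Theta G T\<^esub> theta_coset y"
    using theta_coset_falling_product(2)[OF x(1)] theta_coset_add_pow[OF y] x(2) by simp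
  then have "binomial_element (Theta G T) X n = pure_tensor (Theta G T) (theta_coset y) 1"
    unfolding binomial_element_def
    using pure_tensor_add_pow[OF cring_Theta theta_coset_hom(1)[OF y y], of "fact n" "1 / of_nat (fact n)"]
    by simp
  then show ?thesis using theta_coset_hom(1)[OF y y] by blast
qed

end

theorem theorem5p1:
  fixes G :: "('a, 'm) monoid_scheme" and T :: "'a topology"
  assumes "pro_oligomorphic G T"
  shows "binomial_ring (Theta G T)"
proof -
  interpret pro_oligomorphic G T by (rule assms)
  show ?thesis
    unfolding binomial_ring_def using cring_Theta Theta_torsion_free Theta_binomial_element by blast
qed

end
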